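(* Let $a_1,\dots,a_4,\rho_1,\rho_2,d_1,d_2\in\mathbb{C}$ satisfy the non-degeneracy conditions $a_i-a_j\notin\mathbb{Z}$ for $i\neq j$, $\rho_1,\rho_2\neq 0$, $\rho_1\neq\rho_2$. Let $L$ be a vector bundle of rank $2$ on $\mathbb{P}^1$ with a d-connection $A$ that has parameters $(a_1,\dots,a_4;\rho_1,\rho_2;d_1,d_2)$. Then for any integers $m_1,\dots,m_4,k_1,k_2$ there exists a unique (up to isomorphism) vector bundle $L'$ of rank $2$ with a d-connection $A'$ such that $(L',A')$ is related to $(L,A)$ by a modification and $(L',A')$ has the shifted parameters $(a_1+m_1,\dots,a_4+m_4;\rho_1,\rho_2;d_1+k_1,d_2+k_2)$.
   Context: The ground field is $\mathbb{C}$ and $z$ is the coordinate on $\mathbb{P}^1$. A d-connection on a vector bundle $L$ on $\mathbb{P}^1$ is a linear operator $A(z):L_z\to L_{z+1}$ between fibers, depending on $z\in\mathbb{C}$ rationally (i.e. a rational map between $L$ and $s^*L$, where $s(z)=z+1$); here it is regular (polynomial) on $\mathbb{C}$. A d-connection $A$ on a rank $2$ bundle $L$ has parameters $(a_1,\dots,a_4;\rho_1,\rho_2;d_1,d_2)$ if: (i) $A(z)$ is regular for all $z\in\mathbb{C}$, is invertible for $z\in\mathbb{C}\setminus\{a_1,\dots,a_4\}$, and $\det A(z)$ has a zero of order exactly $1$ at each of the distinct points $a_1,\dots,a_4$; (ii) there is a trivialization of $L$ in a neighborhood of $z=\infty$ with respect to which the matrix of $A(z)$ has the form $$\begin{bmatrix}\rho_1&0\\0&\rho_2\end{bmatrix}z^2+\begin{bmatrix}\rho_1d_1&0\\0&\rho_2d_2\end{bmatrix}z+O(1),\qquad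 z\to\infty .$$ The matrix of $A$ with respect to a trivialization $S(z):\mathbb{C}^2\to L_z$ is $S(z+1)^{-1}A(z)S(z)$. $(L',A')$ is related to $(L,A)$ by a modification if there is a rational isomorphism $R:L\dashrightarrow L'$ (an isomorphism over the generic point of $\mathbb{P}^1$) with $R(z+1)A(z)=A'(z)R(z)$. An isomorphism of bundles with d-connections is a regular isomorphism of bundles with the same compatibility. *)

theory Defs
  imports "HOL-Complex_Analysis.Complex_Analysis" "HOL-Library.Landau_Symbols"
begin

section \<open>The projective line and its regular functions\<close>

datatype p1 = Fin complex | Inf

definition zariski_open :: "p1 set \<Rightarrow> bool" where
  "zariski_open U \<longleftrightarrow> U = {} \<or> finite (- U)"

text \<open>A polynomial of degree at most \<open>n\<close> stands for its homogenization of degree \<open>n\<close>;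
  \<open>homog_eval\<close> is the value of that form at the representatives \<open>(z : 1)\<close> and \<open>(1 : 0)\<close>.\<close>

fun homog_eval :: "nat \<Rightarrow> complex poly \<Rightarrow> p1 \<Rightarrow> complex" where
  "homog_eval n p (Fin z) = poly p z"
| "homog_eval n p Inf = coeff p n"

definition regular_on :: "p1 set \<Rightarrow> (p1 \<Rightarrow> complex) \<Rightarrow> bool" where
  "regular_on U f \<longleftrightarrow>
     (\<forall>x\<in>U. \<exists>V n p q. zariski_open V \<and> x \<in> V \<and> V \<subseteq> U \<and> degree p \<le> n \<and> degree q \<le> n \<and>
        (\<forall>y\<in>V. homog_eval n q y \<noteq> 0 \<and> f y = homog_eval n p y / homog_eval n q y))"

definition mat_regular_on :: "p1 set \<Rightarrow> (p1 \<Rightarrow> complex^'n^'m) \<Rightarrow> bool" where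
  "mat_regular_on U M \<longleftrightarrow> (\<forall>i j. regular_on U (\<lambda>x. M x $ i $ j))"

section \<open>Vector bundles\<close>

text \<open>A vector bundle of rank \<open>n\<close> is a family of \<open>n\<close>-dimensional vector spaces \<open>L\<^sub>x\<close>, one for each
  point \<open>x\<close> of the projective line, with an atlas of local trivializations \<open>S(x) : \<complex>\<^sup>n \<rightarrow> L\<^sub>x\<close>.
  Each fibre is identified with \<open>\<complex>\<^sup>n\<close> as an abstract vector space, by an arbitrary choice of a
  basis at each point separately. These bases carry no geometric meaning: \<open>S\<close> need not depend
  regularly on \<open>x\<close>, and only the matrices comparing two trivializations do. So this does not force
  the bundle to be trivial; the bundle structure is the atlas.\<close>

type_synonym 'n triv = "p1 set \<times> (p1 \<Rightarrow> complex^'n^'n)"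
type_synonym 'n vbundle = "'n triv set"

definition frame :: "('n::finite) triv \<Rightarrow> bool" where
  "frame = (\<lambda>(U, S). zariski_open U \<and> (\<forall>x\<in>U. invertible (S x)))"

definition compatible :: "('n::finite) triv \<Rightarrow> 'n triv \<Rightarrow> bool" where
  "compatible = (\<lambda>(U, S) (V, T).
     mat_regular_on (U \<inter> V) (\<lambda>x. matrix_inv (T x) ** S x) \<and>
     mat_regular_on (U \<inter> V) (\<lambda>x. matrix_inv (S x) ** T x))"

definition vector_bundle :: "('n::finite) vbundle \<Rightarrow> bool" where
  "vector_bundle L \<longleftrightarrow>
     (\<forall>c\<in>L. frame c) \<and> (\<Union>(U, S)\<in>L. U) = UNIV \<and> (\<forall>c\<in>L. \<forall>c'\<in>L. compatible c c')"

definition trivialization :: "('n::finite) vbundle \<Rightarrow> 'n triv \<Rightarrow> bool" where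
  "trivialization L c \<longleftrightarrow> frame c \<and> (\<forall>c'\<in>L. compatible c c')"

text \<open>A map between bundles is a family of linear maps \<open>\<phi>(x) : L\<^sub>x \<rightarrow> M\<^sub>x\<close>. For a rational map, the
  values of \<open>\<phi>\<close> outside some nonempty open set are irrelevant.\<close>

definition regular_map_on ::
    "p1 set \<Rightarrow> ('n::finite) vbundle \<Rightarrow> 'n vbundle \<Rightarrow> (p1 \<Rightarrow> complex^'n^'n) \<Rightarrow> bool" where
  "regular_map_on W L M \<phi> \<longleftrightarrow>
     (\<forall>(U, S)\<in>L. \<forall>(V, T)\<in>M.
        mat_regular_on (W \<inter> U \<inter> V) (\<lambda>x. matrix_inv (T x) ** \<phi> x ** S x))"

definition rational_map ::
    "('n::finite) vbundle \<Rightarrow> 'n vbundle \<Rightarrow> (p1 \<Rightarrow> complex^'n^'n) \<Rightarrow> bool" where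
  "rational_map L M \<phi> \<longleftrightarrow> (\<exists>W. zariski_open W \<and> W \<noteq> {} \<and> regular_map_on W L M \<phi>)"

section \<open>d-connections\<close>

fun shift :: "p1 \<Rightarrow> p1" where
  "shift (Fin z) = Fin (z + 1)"
| "shift Inf = Inf"

definition shift_pullback :: "('n::finite) vbundle \<Rightarrow> 'n vbundle" where
  "shift_pullback L = (\<lambda>(U, S). (shift -` U, S \<circ> shift)) ` L"

definition d_connection :: "('n::finite) vbundle \<Rightarrow> (p1 \<Rightarrow> complex^'n^'n) \<Rightarrow> bool" where
  "d_connection L A \<longleftrightarrow> rational_map L (shift_pullback L) A"

text \<open>The order of vanishing of \<open>det A\<close> is taken for the matrix of \<open>A\<close> in trivializations of \<open>L\<close> near
  \<open>z\<close> and near \<open>z + 1\<close>; for regular \<open>A\<close> it does not depend on them. The value \<open>A Inf\<close> is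
  irrelevant.\<close>

definition has_parameters ::
    "2 vbundle \<Rightarrow> (p1 \<Rightarrow> complex^2^2) \<Rightarrow> (4 \<Rightarrow> complex) \<Rightarrow> (2 \<Rightarrow> complex) \<Rightarrow> (2 \<Rightarrow> complex) \<Rightarrow> bool" where
  "has_parameters L A a \<rho> d \<longleftrightarrow>
     regular_map_on (range Fin) L (shift_pullback L) A \<and>
     (\<forall>z. z \<notin> range a \<longrightarrow> invertible (A (Fin z))) \<and>
     inj a \<and>
     (\<forall>i. \<forall>(U, S)\<in>L. \<forall>(V, T)\<in>L. Fin (a i) \<in> U \<longrightarrow> Fin (a i + 1) \<in> V \<longrightarrow>
        zorder (\<lambda>z. det (matrix_inv (T (Fin (z + 1))) ** A (Fin z) ** S (Fin z))) (a i) = 1) \<and>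
     (\<exists>W S. trivialization L (W, S) \<and> Inf \<in> W \<and>
        (\<forall>i j. (\<lambda>z. (matrix_inv (S (Fin (z + 1))) ** A (Fin z) ** S (Fin z)) $ i $ j
                    - (if i = j then \<rho> i * z ^ 2 + \<rho> i * d i * z else 0))
               \<in> O[at_infinity](\<lambda>_. 1)))"

definition related_by_modification ::
    "('n::finite) vbundle \<Rightarrow> (p1 \<Rightarrow> complex^'n^'n) \<Rightarrow> 'n vbundle \<Rightarrow> (p1 \<Rightarrow> complex^'n^'n) \<Rightarrow> bool" where
  "related_by_modification L A L' A' \<longleftrightarrow>
     (\<exists>R W. zariski_open W \<and> W \<noteq> {} \<and> regular_map_on W L L' R \<and>
        (\<forall>x\<in>W. invertible (R x)) \<and>
        (\<forall>z. Fin z \<in> W \<longrightarrow> Fin (z + 1) \<in> W \<longrightarrow>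
           R (Fin (z + 1)) ** A (Fin z) = A' (Fin z) ** R (Fin z)))"

text \<open>The compatibility is required at every finite point, so this is meant for \<open>A\<close> and \<open>A'\<close> that
  are regular on the affine line.\<close>

definition isomorphic_d_connections ::
    "('n::finite) vbundle \<Rightarrow> (p1 \<Rightarrow> complex^'n^'n) \<Rightarrow> 'n vbundle \<Rightarrow> (p1 \<Rightarrow> complex^'n^'n) \<Rightarrow> bool" where
  "isomorphic_d_connections L A L' A' \<longleftrightarrow>
     (\<exists>\<phi>. regular_map_on UNIV L L' \<phi> \<and> (\<forall>x. invertible (\<phi> x)) \<and>
        (\<forall>z. \<phi> (Fin (z + 1)) ** A (Fin z) = A' (Fin z) ** \<phi> (Fin z)))"

end

(* In a rational frame a bundle is a family of lattices N(x) over the local rings of the projective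
   line, almost all of them standard, and a d-connection is one rational matrix B. A modification
   keeps B and changes finitely many of the lattices.

   Existence: replacing the lattice at a_i + 1 by the image under B of the lattice at a_i moves the
   zero a_i of det B to a_i + 1, and replacing the lattice at a_i by the preimage of the lattice at
   a_i + 1 moves it to a_i - 1. At infinity the gauge transformation by diag(z^{+-1}, 1), followed by
   one of the form 1 + X/z, shifts one d_i by +-1 and restores the normal form; this uses
   rho_1 /= rho_2.

   Uniqueness: a rational intertwiner R(z+1) A'(z) = A''(z) R(z) has no poles in the affine line,
   since a pole would propagate along z + Z in a direction that meets no a_i. At infinity, comparing
   the two leading coefficients shows that R has order 0. The same holds for the inverse of R. *)

theory Submission
  imports Defs "HOL-Computational_Algebra.Fraction_Field"
begin

section \<open>Rational functions on the projective line\<close>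

text \<open>The given notions are pointwise: fibres are identified with \<open>complex^'n\<close> by
  bases unrelated from point to point, maps are functions on points, and the conditions on zeros and
  at infinity are analytic. The argument is algebra over the function field. The bridge is that a
  regular function on an open set is the value function of one rational function, unique because two
  nonempty open sets share infinitely many points. A bundle is then recorded by two families:
  \<open>N x\<close>, a rational basis of the lattice at \<open>x\<close>, and \<open>E x\<close>,
  an invertible complex matrix that absorbs the arbitrary basis of the fibre and cancels from every
  intrinsic statement. In the same way \<open>zorder\<close> turns into a factorization in a local
  ring, and boundedness near infinity into regularity at infinity.\<close>

type_synonym ratfun = "complex poly fract"

lemma homog_eval_add: "homog_eval n (p + q) x = homog_eval n p x + homog_eval n q x"
  by (cases x) auto

lemma homog_eval_uminus: "homog_eval n (- p) x = - homog_eval n p x"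
  by (cases x) auto

text \<open>At infinity the value is the coefficient at the degree bound. It is multiplicative
  because, under the bounds \<open>n\<close> and \<open>m\<close>, only one pair of coefficients
  contributes in degree \<open>n + m\<close>.\<close>

lemma homog_eval_mult:
  assumes "degree p \<le> n" "degree q \<le> m"
  shows "homog_eval (n + m) (p * q) x = homog_eval n p x * homog_eval m q x"
proof (cases x)
  case Inf
  show ?thesis
  proof (cases "degree p = n \<and> degree q = m")
    case True
    then show ?thesis using Inf coeff_mult_degree_sum[of p q] by auto
  next
    case False
    then have "degree (p * q) < n + m"
      using assms degree_mult_le[of p q] by linarith
    moreover from False have "degree p < n \<or> degree q < m" using assms by linarith
    ultimately show ?thesis using Inf by (auto simp: coeff_eq_0)
  qed
qed auto

text \<open>Any fraction representing \<open>r\<close> may serve as witness, reduced or not, and the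
  common degree bound \<open>n\<close> lets finite points and infinity be treated alike. For fixed
  \<open>x\<close> this is the local ring of the projective line at \<open>x\<close>.\<close>

definition reg_at :: "p1 \<Rightarrow> ratfun \<Rightarrow> bool" where
  "reg_at x r \<longleftrightarrow> (\<exists>n p q. r = Fract p q \<and> degree p \<le> n \<and> degree q \<le> n \<and> homog_eval n q x \<noteq> 0)"

text \<open>The value is unspecified at a pole.\<close>

definition val :: "p1 \<Rightarrow> ratfun \<Rightarrow> complex" where
  "val x r = (THE v. \<exists>n p q. r = Fract p q \<and> degree p \<le> n \<and> degree q \<le> n \<and> homog_eval n q x \<noteq> 0 \<and>
     v = homog_eval n p x / homog_eval n q x)"

lemma homog_eval_0 [simp]: "homog_eval n 0 x = 0"
  by (cases x) auto

lemma homog_eval_nonzeroD: "homog_eval n q x \<noteq> 0 \<Longrightarrow> q \<noteq> 0"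
  by auto

lemma val_Fract:
  assumes "degree p \<le> n" "degree q \<le> n" "homog_eval n q x \<noteq> 0"
  shows "val x (Fract p q) = homog_eval n p x / homog_eval n q x"
  unfolding val_def
proof (rule the_equality)
  show "\<exists>n' p' q'. Fract p q = Fract p' q' \<and> degree p' \<le> n' \<and> degree q' \<le> n' \<and> homog_eval n' q' x \<noteq> 0 \<and>
     homog_eval n p x / homog_eval n q x = homog_eval n' p' x / homog_eval n' q' x"
    using assms by blast
next
  fix v
  assume "\<exists>n' p' q'. Fract p q = Fract p' q' \<and> degree p' \<le> n' \<and> degree q' \<le> n' \<and> homog_eval n' q' x \<noteq> 0 \<and>
     v = homog_eval n' p' x / homog_eval n' q' x"
  then obtain n' p' q' where *: "Fract p q = Fract p' q'" "degree p' \<le> n'" "degree q' \<le> n'"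
    "homog_eval n' q' x \<noteq> 0" "v = homog_eval n' p' x / homog_eval n' q' x" by blast
  \<comment> \<open>The cross-multiplied identity is evaluated in degree \<open>n + n'\<close>;
    neither denominator vanishes at \<open>x\<close>, so the two quotients agree there.\<close>
  have "p * q' = p' * q"
    using * assms by (metis eq_fract(1) homog_eval_nonzeroD)
  then have "homog_eval (n + n') (p * q') x = homog_eval (n' + n) (p' * q) x"
    by (simp add: add.commute)
  then have "homog_eval n p x * homog_eval n' q' x = homog_eval n' p' x * homog_eval n q x"
    using assms * by (simp add: homog_eval_mult)
  then show "v = homog_eval n p x / homog_eval n q x"
    using assms * by (simp add: frac_eq_eq mult.commute)
qed

lemma reg_at_Fract:
  assumes "degree p \<le> n" "degree q \<le> n" "homog_eval n q x \<noteq> 0"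
  shows "reg_at x (Fract p q)"
  using assms unfolding reg_at_def by blast

lemma reg_atE:
  assumes "reg_at x r"
  obtains n p q where "r = Fract p q" "degree p \<le> n" "degree q \<le> n" "homog_eval n q x \<noteq> 0"
    "val x r = homog_eval n p x / homog_eval n q x"
  using assms val_Fract unfolding reg_at_def by metis

lemma reg_at_add_val:
  assumes "reg_at x r" "reg_at x s"
  shows "reg_at x (r + s) \<and> val x (r + s) = val x r + val x s"
proof -
  obtain n p q where r: "r = Fract p q" "degree p \<le> n" "degree q \<le> n" "homog_eval n q x \<noteq> 0"
    "val x r = homog_eval n p x / homog_eval n q x" using assms(1) by (rule reg_atE)
  obtain m p' q' where s: "s = Fract p' q'" "degree p' \<le> m" "degree q' \<le> m" "homog_eval m q' x \<noteq> 0"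
    "val x s = homog_eval m p' x / homog_eval m q' x" using assms(2) by (rule reg_atE)
  have eq: "r + s = Fract (p * q' + p' * q) (q * q')"
    using r s by (metis add_fract homog_eval_nonzeroD)
  have d: "degree (p * q' + p' * q) \<le> n + m" "degree (q * q') \<le> n + m"
    using r s degree_mult_le[of p q'] degree_mult_le[of p' q] degree_mult_le[of q q']
    by (auto intro!: degree_add_le)
  have h1: "homog_eval (n + m) (q * q') x = homog_eval n q x * homog_eval m q' x"
    "homog_eval (n + m) (p * q') x = homog_eval n p x * homog_eval m q' x"
    using r s by (auto simp: homog_eval_mult)
  have h2: "homog_eval (n + m) (p' * q) x = homog_eval m p' x * homog_eval n q x"
    using r s homog_eval_mult[of p' m q n x] by (simp add: add.commute)
  have nz: "homog_eval (n + m) (q * q') x \<noteq> 0" using h1 r s by simp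
  have "val x (r + s) = (homog_eval n p x * homog_eval m q' x + homog_eval m p' x * homog_eval n q x) /
      (homog_eval n q x * homog_eval m q' x)"
    unfolding eq val_Fract[OF d nz] by (simp only: homog_eval_add h1 h2)
  also have "\<dots> = val x r + val x s"
    unfolding r(5) s(5) using r(4) s(4) by (simp add: add_frac_eq)
  finally show ?thesis unfolding eq using reg_at_Fract[OF d nz] by simp
qed

lemma reg_at_mult_val:
  assumes "reg_at x r" "reg_at x s"
  shows "reg_at x (r * s) \<and> val x (r * s) = val x r * val x s"
proof -
  obtain n p q where r: "r = Fract p q" "degree p \<le> n" "degree q \<le> n" "homog_eval n q x \<noteq> 0"
    "val x r = homog_eval n p x / homog_eval n q x" using assms(1) by (rule reg_atE)
  obtain m p' q' where s: "s = Fract p' q'" "degree p' \<le> m" "degree q' \<le> m" "homog_eval m q' x \<noteq> 0"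
    "val x s = homog_eval m p' x / homog_eval m q' x" using assms(2) by (rule reg_atE)
  have d: "degree (p * p') \<le> n + m" "degree (q * q') \<le> n + m"
    using r s degree_mult_le[of p p'] degree_mult_le[of q q'] by linarith+
  have h1: "homog_eval (n + m) (q * q') x = homog_eval n q x * homog_eval m q' x"
    "homog_eval (n + m) (p * p') x = homog_eval n p x * homog_eval m p' x"
    using r s by (auto simp: homog_eval_mult)
  have nz: "homog_eval (n + m) (q * q') x \<noteq> 0" using h1 r s by simp
  show ?thesis
    using reg_at_Fract[OF d nz] val_Fract[OF d nz] r s h1 by auto
qed

lemma reg_at_inverse_val:
  assumes "reg_at x r" "val x r \<noteq> 0"
  shows "reg_at x (inverse r) \<and> val x (inverse r) = inverse (val x r)"
proof -
  obtain n p q where r: "r = Fract p q" "degree p \<le> n" "degree q \<le> n" "homog_eval n q x \<noteq> 0"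
    "val x r = homog_eval n p x / homog_eval n q x" using assms(1) by (rule reg_atE)
  then have "homog_eval n p x \<noteq> 0" using assms by auto
  then show ?thesis using r by (auto simp: reg_at_Fract val_Fract)
qed

lemma reg_at_uminus_val:
  assumes "reg_at x r"
  shows "reg_at x (- r) \<and> val x (- r) = - val x r"
proof -
  obtain n p q where r: "r = Fract p q" "degree p \<le> n" "degree q \<le> n" "homog_eval n q x \<noteq> 0"
    "val x r = homog_eval n p x / homog_eval n q x" using assms(1) by (rule reg_atE)
  then show ?thesis
    by (auto simp: reg_at_Fract val_Fract homog_eval_uminus)
qed

section \<open>Constants and the coordinate function\<close>

definition cst :: "complex \<Rightarrow> ratfun" where "cst c = Fract [:c:] 1"

definition crd :: ratfun where "crd = Fract [:0, 1:] 1"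

lemma homog_eval_const_0 [simp]: "homog_eval 0 [:c:] x = c" "homog_eval 0 1 x = 1"
  by (cases x; simp)+

lemma reg_at_cst_val: "reg_at x (cst c) \<and> val x (cst c) = c"
  unfolding cst_def using reg_at_Fract[of "[:c:]" 0 1] val_Fract[of "[:c:]" 0 1] by simp

lemma cst_simps: "cst 0 = 0" "cst 1 = 1" "cst (a + b) = cst a + cst b" "cst (a * b) = cst a * cst b"
  "cst (- a) = - cst a" "cst (a - b) = cst a - cst b"
  by (auto simp: cst_def Zero_fract_def One_fract_def one_pCons eq_fract)

lemma cst_eq_0_iff [simp]: "cst c = 0 \<longleftrightarrow> c = 0"
  by (auto simp: cst_def Zero_fract_def eq_fract)

lemma reg_at_crd_val: "reg_at (Fin z) crd" "val (Fin z) crd = z"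
  unfolding crd_def using reg_at_Fract[of "[:0,1:]" 1 1 "Fin z"] val_Fract[of "[:0,1:]" 1 1 "Fin z"] by auto

lemma reg_at_inverse_crd_val: "reg_at Inf (inverse crd)" "val Inf (inverse crd) = 0"
  unfolding crd_def using reg_at_Fract[of 1 1 "[:0,1:]" Inf] val_Fract[of 1 1 "[:0,1:]" Inf] by auto

lemma crd_nonzero [simp]: "crd \<noteq> 0"
  by (auto simp: crd_def Zero_fract_def eq_fract)

lemma reg_at_0_1_val: "reg_at x 0" "val x 0 = 0" "reg_at x 1" "val x 1 = 1"
  using reg_at_cst_val[of x 0] reg_at_cst_val[of x 1] by (auto simp: cst_simps)

lemma reg_at_diff_val:
  assumes "reg_at x r" "reg_at x s"
  shows "reg_at x (r - s) \<and> val x (r - s) = val x r - val x s"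
  using reg_at_add_val[OF assms(1), of "- s"] reg_at_uminus_val[OF assms(2)] by simp

lemmas reg_at_intros = reg_at_add_val[THEN conjunct1] reg_at_mult_val[THEN conjunct1]
  reg_at_uminus_val[THEN conjunct1] reg_at_diff_val[THEN conjunct1] reg_at_0_1_val(1,3)
  reg_at_cst_val[THEN conjunct1] reg_at_crd_val(1) reg_at_inverse_crd_val(1)

lemmas val_simps = reg_at_add_val[THEN conjunct2] reg_at_mult_val[THEN conjunct2]
  reg_at_uminus_val[THEN conjunct2] reg_at_diff_val[THEN conjunct2] reg_at_0_1_val(2,4)
  reg_at_cst_val[THEN conjunct2] reg_at_crd_val(2) reg_at_inverse_crd_val(2)

section \<open>Finiteness of zeros and poles, and the identity principle\<close>

lemma finite_p1_iff: "finite (A :: p1 set) \<longleftrightarrow> finite {z. Fin z \<in> A}"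
proof
  assume "finite A"
  have "inj Fin" by (auto simp: inj_def)
  then show "finite {z. Fin z \<in> A}" using finite_vimageI[OF \<open>finite A\<close>] by (simp add: vimage_def)
next
  assume "finite {z. Fin z \<in> A}"
  moreover have "A \<subseteq> insert Inf (Fin ` {z. Fin z \<in> A})"
  proof
    fix x assume "x \<in> A" then show "x \<in> insert Inf (Fin ` {z. Fin z \<in> A})" by (cases x) auto
  qed
  ultimately show "finite A" by (meson finite_imageI finite_insert finite_subset)
qed

lemma infinite_UNIV_p1: "infinite (UNIV :: p1 set)"
  using finite_p1_iff[of UNIV] infinite_UNIV_char_0[where 'a=complex] by simp

lemma finite_homog_zeros: "q \<noteq> 0 \<Longrightarrow> finite {x. homog_eval n q x = 0}"
  unfolding finite_p1_iff using poly_roots_finite[of q] by simp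

lemma finite_zeros_poles:
  assumes "r \<noteq> 0"
  shows "finite {x. \<not> (reg_at x r \<and> val x r \<noteq> 0)}"
proof (cases r)
  case (Fract p q)
  then have pq: "p \<noteq> 0" "q \<noteq> 0" using assms by (auto simp: Zero_fract_def eq_fract)
  define n where "n = max (degree p) (degree q)"
  have "{x. \<not> (reg_at x r \<and> val x r \<noteq> 0)} \<subseteq> {x. homog_eval n p x = 0} \<union> {x. homog_eval n q x = 0}"
    using reg_at_Fract[of p n q] val_Fract[of p n q] Fract by (auto simp: n_def)
  then show ?thesis using finite_homog_zeros pq by (meson finite_UnI finite_subset)
qed

lemma finite_poles: "finite {x. \<not> reg_at x r}"
proof (cases "r = 0")
  case False
  then show ?thesis using finite_zeros_poles[of r] by (auto elim: rev_finite_subset)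
qed (simp add: reg_at_0_1_val)

text \<open>Identity principle: a nonzero difference is regular with nonzero value at all but
  finitely many points.\<close>

lemma ratfun_eqI:
  assumes "infinite X" "\<And>x. x \<in> X \<Longrightarrow> reg_at x r \<and> reg_at x s \<and> val x r = val x s"
  shows "r = s"
proof (rule ccontr)
  assume "r \<noteq> s"
  then have "finite {x. \<not> (reg_at x (r - s) \<and> val x (r - s) \<noteq> 0)}" by (intro finite_zeros_poles) auto
  moreover have "X \<subseteq> {x. \<not> (reg_at x (r - s) \<and> val x (r - s) \<noteq> 0)}"
    using assms(2) by (auto simp: val_simps)
  ultimately show False using assms(1) finite_subset by blast
qed

lemma zariski_open_Int: "zariski_open U \<Longrightarrow> zariski_open V \<Longrightarrow> zariski_open (U \<inter> V)"
  by (auto simp: zariski_open_def)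

lemma zariski_open_Int_nonempty:
  assumes "zariski_open U" "zariski_open V" "U \<noteq> {}" "V \<noteq> {}"
  shows "U \<inter> V \<noteq> {}"
proof
  assume "U \<inter> V = {}"
  then have "- U \<union> - V = UNIV" by auto
  moreover have "finite (- U \<union> - V)" using assms by (auto simp: zariski_open_def)
  ultimately show False using infinite_UNIV_p1 by simp
qed

lemma infinite_zariski_open:
  assumes "zariski_open U" "U \<noteq> {}"
  shows "infinite U"
  using assms infinite_UNIV_p1 by (metis Compl_partition finite_Un zariski_open_def)

text \<open>Local quotients glue: two nonempty open sets share infinitely many points, so the
  rational functions found near any two points of \<open>U\<close> are equal. This replaces a
  function on points by one element of the function field.\<close>

lemma regular_on_iff:
  assumes U: "zariski_open U"
  shows "regular_on U f \<longleftrightarrow> (\<exists>r. \<forall>x\<in>U. reg_at x r \<and> f x = val x r)"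
proof
  assume reg: "regular_on U f"
  show "\<exists>r. \<forall>x\<in>U. reg_at x r \<and> f x = val x r"
  proof (cases "U = {}")
    case False
    have loc: "\<exists>V r. zariski_open V \<and> x \<in> V \<and> (\<forall>y\<in>V. reg_at y r \<and> f y = val y r)" if x: "x \<in> U" for x
    proof -
      obtain V n p q where V: "zariski_open V" "x \<in> V" "V \<subseteq> U" "degree p \<le> n" "degree q \<le> n"
        "\<forall>y\<in>V. homog_eval n q y \<noteq> 0 \<and> f y = homog_eval n p y / homog_eval n q y"
        using reg x unfolding regular_on_def by metis
      have "\<forall>y\<in>V. reg_at y (Fract p q) \<and> f y = val y (Fract p q)"
        using V reg_at_Fract val_Fract by auto
      then show ?thesis using V by blast
    qed
    from False obtain x0 where "x0 \<in> U" by blast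
    from loc[OF this] obtain V0 r where V0: "zariski_open V0" "x0 \<in> V0" "\<forall>y\<in>V0. reg_at y r \<and> f y = val y r"
      by blast
    have "reg_at x r \<and> f x = val x r" if x: "x \<in> U" for x
    proof -
      from loc[OF x] obtain V s where V: "zariski_open V" "x \<in> V" "\<forall>y\<in>V. reg_at y s \<and> f y = val y s"
        by blast
      have "infinite (V0 \<inter> V)"
        using V V0 by (intro infinite_zariski_open zariski_open_Int zariski_open_Int_nonempty) auto
      then have "r = s" using V V0 by (intro ratfun_eqI[of "V0 \<inter> V"]) auto
      then show ?thesis using V by auto
    qed
    then show ?thesis by blast
  qed auto
next
  assume "\<exists>r. \<forall>x\<in>U. reg_at x r \<and> f x = val x r"
  then obtain r where r: "\<And>x. x \<in> U \<Longrightarrow> reg_at x r \<and> f x = val x r" by blast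
  show "regular_on U f"
    unfolding regular_on_def
  proof
    fix x assume x: "x \<in> U"
    obtain n p q where pq: "r = Fract p q" "degree p \<le> n" "degree q \<le> n" "homog_eval n q x \<noteq> 0"
      using r[OF x] by (auto elim: reg_atE)
    \<comment> \<open>The fraction that is defined at \<open>x\<close> works nearby, after removal
      of the finitely many zeros of its denominator.\<close>
    let ?V = "U \<inter> {y. homog_eval n q y \<noteq> 0}"
    have "q \<noteq> 0" using pq by auto
    then have "zariski_open {y. homog_eval n q y \<noteq> 0}"
      using finite_homog_zeros[of q n] by (simp add: zariski_open_def Compl_eq)
    then have "zariski_open ?V" using U by (intro zariski_open_Int)
    then show "\<exists>V n p q. zariski_open V \<and> x \<in> V \<and> V \<subseteq> U \<and> degree p \<le> n \<and> degree q \<le> n \<and>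
        (\<forall>y\<in>V. homog_eval n q y \<noteq> 0 \<and> f y = homog_eval n p y / homog_eval n q y)"
      using pq x r val_Fract[of p n q] by (intro exI[of _ ?V] exI[of _ n] exI[of _ p] exI[of _ q]) auto
  qed
qed

text \<open>The automorphism \<open>f(z) \<mapsto> f(z + c)\<close> of the function field.\<close>

definition tr :: "complex \<Rightarrow> ratfun \<Rightarrow> ratfun" where
  "tr c r = (THE s. \<exists>p q. q \<noteq> 0 \<and> r = Fract p q \<and> s = Fract (p \<circ>\<^sub>p [:c, 1:]) (q \<circ>\<^sub>p [:c, 1:]))"

lemma pcompose_shift_eq_0 [simp]: "p \<circ>\<^sub>p [:c, 1:] = 0 \<longleftrightarrow> p = (0 :: complex poly)"
  by (simp add: pcompose_eq_0_iff)

lemma tr_Fract: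
  assumes "q \<noteq> 0"
  shows "tr c (Fract p q) = Fract (p \<circ>\<^sub>p [:c, 1:]) (q \<circ>\<^sub>p [:c, 1:])"
  unfolding tr_def
proof (rule the_equality)
  show "\<exists>p' q'. q' \<noteq> 0 \<and> Fract p q = Fract p' q' \<and>
    Fract (p \<circ>\<^sub>p [:c, 1:]) (q \<circ>\<^sub>p [:c, 1:]) = Fract (p' \<circ>\<^sub>p [:c, 1:]) (q' \<circ>\<^sub>p [:c, 1:])"
    using assms by blast
next
  fix s assume "\<exists>p' q'. q' \<noteq> 0 \<and> Fract p q = Fract p' q' \<and> s = Fract (p' \<circ>\<^sub>p [:c, 1:]) (q' \<circ>\<^sub>p [:c, 1:])"
  then obtain p' q' where *: "q' \<noteq> 0" "Fract p q = Fract p' q'" "s = Fract (p' \<circ>\<^sub>p [:c, 1:]) (q' \<circ>\<^sub>p [:c, 1:])"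
    by blast
  then have "p * q' = p' * q" using assms by (simp add: eq_fract)
  then have "p \<circ>\<^sub>p [:c, 1:] * (q' \<circ>\<^sub>p [:c, 1:]) = p' \<circ>\<^sub>p [:c, 1:] * (q \<circ>\<^sub>p [:c, 1:])"
    by (metis pcompose_mult)
  then show "s = Fract (p \<circ>\<^sub>p [:c, 1:]) (q \<circ>\<^sub>p [:c, 1:])" using * assms by (simp add: eq_fract)
qed

lemma tr_add: "tr c (r + s) = tr c r + tr c s"
  by (cases r, cases s) (simp add: tr_Fract pcompose_add pcompose_mult)

lemma tr_mult: "tr c (r * s) = tr c r * tr c s"
  by (cases r, cases s) (simp add: tr_Fract pcompose_mult)

lemma tr_uminus: "tr c (- r) = - tr c r"
  by (cases r) (simp add: tr_Fract pcompose_uminus)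

lemma tr_diff: "tr c (r - s) = tr c r - tr c s"
  using tr_add[of c r "- s"] tr_uminus[of c s] by simp

lemma tr_cst [simp]: "tr c (cst k) = cst k"
  by (simp add: cst_def tr_Fract pcompose_1)

lemma tr_0 [simp]: "tr c 0 = 0" and tr_1 [simp]: "tr c 1 = 1"
  using tr_cst[of c 0] tr_cst[of c 1] by (simp_all add: cst_simps)

lemma tr_tr: "tr c (tr d r) = tr (c + d) r"
proof (cases r)
  case (Fract p q)
  have "[:d, 1:] \<circ>\<^sub>p [:c, 1:] = [:c + d, 1:]" by (simp add: pcompose_pCons)
  then show ?thesis using Fract by (simp add: tr_Fract flip: pcompose_assoc)
qed

lemma tr_by_0: "tr 0 r = r"
  by (cases r) (simp add: tr_Fract)

lemma tr_eq_0_iff [simp]: "tr c r = 0 \<longleftrightarrow> r = 0"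
  by (metis tr_0 tr_by_0 tr_tr add.left_inverse)

lemma tr_inverse: "tr c (inverse r) = inverse (tr c r)"
  by (cases "r = 0") (simp, metis inverse_unique right_inverse tr_1 tr_mult)

lemma tr_crd: "tr c crd = crd + cst c"
  by (simp add: crd_def cst_def tr_Fract pcompose_1 pcompose_pCons)

fun p1_shift :: "complex \<Rightarrow> p1 \<Rightarrow> p1" where
  "p1_shift c (Fin z) = Fin (z + c)"
| "p1_shift c Inf = Inf"

lemma p1_shift_1: "p1_shift 1 x = shift x"
  by (cases x) auto

lemma p1_shift_cancel [simp]: "p1_shift c (p1_shift (- c) x) = x"
  by (cases x) auto

text \<open>At infinity this says that a translation keeps degree and leading coefficient; if the
  degree stays below \<open>n\<close>, both sides are 0.\<close>

lemma homog_eval_pcompose_shift: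
  assumes "degree p \<le> n"
  shows "homog_eval n (p \<circ>\<^sub>p [:c, 1:]) x = homog_eval n p (p1_shift c x)"
proof (cases x)
  case (Fin z)
  then show ?thesis by (simp add: poly_pcompose add.commute)
next
  case Inf
  have deg: "degree (p \<circ>\<^sub>p [:c, 1:]) = degree p" by (simp add: degree_pcompose)
  show ?thesis
  proof (cases "degree p = n")
    case True
    then show ?thesis using Inf deg lead_coeff_comp[of "[:c, 1:]" p] by simp
  next
    case False
    then show ?thesis using Inf deg assms by (simp add: coeff_eq_0)
  qed
qed

lemma reg_at_tr_val:
  assumes "reg_at (p1_shift c x) r"
  shows "reg_at x (tr c r) \<and> val x (tr c r) = val (p1_shift c x) r"
proof -
  obtain n p q where r: "r = Fract p q" "degree p \<le> n" "degree q \<le> n" "homog_eval n q (p1_shift c x) \<noteq> 0"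
    "val (p1_shift c x) r = homog_eval n p (p1_shift c x) / homog_eval n q (p1_shift c x)"
    using assms by (rule reg_atE)
  have d: "degree (p \<circ>\<^sub>p [:c, 1:]) \<le> n" "degree (q \<circ>\<^sub>p [:c, 1:]) \<le> n"
    using r by (simp_all add: degree_pcompose)
  have "q \<noteq> 0" using r by auto
  then show ?thesis
    using reg_at_Fract[OF d] val_Fract[OF d] r by (simp add: tr_Fract homog_eval_pcompose_shift)
qed

lemma reg_at_tr_iff: "reg_at x (tr c r) \<longleftrightarrow> reg_at (p1_shift c x) r"
proof
  assume "reg_at x (tr c r)"
  then have "reg_at (p1_shift (- c) (p1_shift c x)) (tr c r)"
    using p1_shift_cancel[of "- c" x] by simp
  then have "reg_at (p1_shift c x) (tr (- c) (tr c r))" using reg_at_tr_val by blast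
  then show "reg_at (p1_shift c x) r" by (simp add: tr_tr tr_by_0)
qed (use reg_at_tr_val in blast)

section \<open>The point at infinity: algebraic regularity and analytic boundedness\<close>

lemma reg_at_Inf_or_inverse: "reg_at Inf r \<or> reg_at Inf (inverse r) \<and> val Inf (inverse r) = 0"
proof -
  obtain p q where r: "r = Fract p q" "q \<noteq> 0" by (cases r) auto
  show ?thesis
  proof (cases "degree p \<le> degree q")
    case True
    then show ?thesis using r reg_at_Fract[of p "degree q" q Inf] by simp
  next
    case False
    then have "p \<noteq> 0" "coeff q (degree p) = 0" by (auto simp: coeff_eq_0)
    then show ?thesis
      using r False reg_at_Fract[of q "degree p" p Inf] val_Fract[of q "degree p" p Inf] by simp
  qed
qed

lemma eventually_at_infinity_p1:
  assumes "finite {x. \<not> P x}"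
  shows "eventually (\<lambda>z. P (Fin z)) at_infinity"
proof -
  have fin: "finite {z. \<not> P (Fin z)}" using assms finite_p1_iff[of "{x. \<not> P x}"] by simp
  then have "bounded {z. \<not> P (Fin z)}" by (rule finite_imp_bounded)
  then obtain B where "\<forall>z\<in>{z. \<not> P (Fin z)}. norm z \<le> B" unfolding bounded_iff by blast
  then show ?thesis unfolding eventually_at_infinity
    by (intro exI[of _ "B + 1"]) force
qed

lemma tendsto_val_at_infinity:
  assumes "reg_at Inf r"
  shows "((\<lambda>z. val (Fin z) r) \<longlongrightarrow> val Inf r) at_infinity"
proof -
  obtain n p q where r: "r = Fract p q" "degree p \<le> n" "degree q \<le> n" "homog_eval n q Inf \<noteq> 0"
    "val Inf r = homog_eval n p Inf / homog_eval n q Inf" using assms by (rule reg_atE)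
  have n: "n = degree q" using r(3,4) by (metis coeff_eq_0 homog_eval.simps(2) le_neq_implies_less)
  have q: "q \<noteq> 0" using r by auto
  define c where "c = val Inf r"
  have c: "c = coeff p n / lead_coeff q" using r n by (simp add: c_def)
  \<comment> \<open>Subtracting the expected limit times the denominator lowers the degree of the
    numerator, so the remaining quotient tends to 0.\<close>
  define s where "s = p - smult c q"
  have "coeff s n = 0" using c n q by (simp add: s_def)
  moreover have "degree s \<le> n" using r by (simp add: s_def degree_diff_le)
  ultimately have "degree s < degree q \<or> s = 0"
    using n by (metis le_neq_implies_less leading_coeff_0_iff)
  then have "((\<lambda>z. poly s z / poly q z) \<longlongrightarrow> 0) at_infinity"
    using poly_divide_tendsto_0_at_infinity[of s q] by auto
  then have "((\<lambda>z. c + poly s z / poly q z) \<longlongrightarrow> c + 0) at_infinity" by (intro tendsto_intros)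
  moreover have "eventually (\<lambda>z. c + poly s z / poly q z = val (Fin z) r) at_infinity"
  proof -
    have "eventually (\<lambda>z. homog_eval n q (Fin z) \<noteq> 0) at_infinity"
      by (rule eventually_at_infinity_p1) (use finite_homog_zeros[OF q] in simp)
    then show ?thesis
    proof eventually_elim
      case (elim z)
      have "val (Fin z) r = poly p z / poly q z" using val_Fract[of p n q "Fin z"] r elim by simp
      then show ?case using elim by (simp add: s_def field_simps)
    qed
  qed
  ultimately show ?thesis unfolding c_def[symmetric] by (simp add: tendsto_cong)
qed

text \<open>Turns the analytic O(1) of the normal form into membership in the local ring at
  infinity. A rational function that is not regular there has an inverse tending to 0, which
  contradicts any bound.\<close>

lemma val_bigo_1_at_infinity_iff: "(\<lambda>z. val (Fin z) r) \<in> O[at_infinity](\<lambda>_. 1) \<longleftrightarrow> reg_at Inf r"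
proof
  assume "reg_at Inf r"
  then have "((\<lambda>z. val (Fin z) r / 1) \<longlongrightarrow> val Inf r) at_infinity"
    using tendsto_val_at_infinity by simp
  then show "(\<lambda>z. val (Fin z) r) \<in> O[at_infinity](\<lambda>_. 1)" by (intro bigoI_tendsto) auto
next
  assume O: "(\<lambda>z. val (Fin z) r) \<in> O[at_infinity](\<lambda>_. 1)"
  show "reg_at Inf r"
  proof (rule ccontr)
    assume nr: "\<not> reg_at Inf r"
    then have "r \<noteq> 0" using reg_at_0_1_val by auto
    have i: "reg_at Inf (inverse r)" "val Inf (inverse r) = 0" using nr reg_at_Inf_or_inverse[of r] by auto
    have t: "((\<lambda>z. val (Fin z) (inverse r)) \<longlongrightarrow> 0) at_infinity"
      using tendsto_val_at_infinity[OF i(1)] i(2) by simp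
    obtain C where C: "eventually (\<lambda>z. norm (val (Fin z) r) \<le> C * norm (1 :: complex)) at_infinity" "C > 0"
      using O by (elim landau_o.bigE) auto
    have "eventually (\<lambda>z. norm (val (Fin z) (inverse r)) < 1 / C) at_infinity"
      using t C(2) by (simp add: tendsto_iff)
    moreover have "eventually (\<lambda>z. reg_at (Fin z) r \<and> val (Fin z) r \<noteq> 0) at_infinity"
      by (rule eventually_at_infinity_p1) (use finite_zeros_poles[OF \<open>r \<noteq> 0\<close>] in simp)
    ultimately have "eventually (\<lambda>z :: complex. False) at_infinity" using C(1)
    proof eventually_elim
      case (elim z)
      then have "val (Fin z) (inverse r) = inverse (val (Fin z) r)" using reg_at_inverse_val by blast
      then have "norm (inverse (val (Fin z) r)) < 1 / C" using elim by simp
      moreover have "norm (val (Fin z) r) * norm (inverse (val (Fin z) r)) = 1"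
        using elim by (simp flip: norm_mult)
      moreover have "norm (val (Fin z) r) * norm (inverse (val (Fin z) r)) \<le> C * norm (inverse (val (Fin z) r))"
        using elim by (intro mult_right_mono) auto
      moreover have "C * norm (inverse (val (Fin z) r)) < C * (1 / C)"
        using calculation(1) C(2) by (intro mult_strict_left_mono) auto
      ultimately show ?case using C(2) by simp
    qed
    then show False by (metis eventually_happens trivial_limit_at_infinity)
  qed
qed

text \<open>Algebraic counterpart of \<open>zorder\<close> being 1: a uniformizer times a unit of
  the local ring. In this form the property passes through products with units and through
  translations.\<close>

definition simple_zero :: "complex \<Rightarrow> ratfun \<Rightarrow> bool" where
  "simple_zero a r \<longleftrightarrow> (\<exists>u. reg_at (Fin a) u \<and> val (Fin a) u \<noteq> 0 \<and> r = (crd - cst a) * u)"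

lemma reg_at_power_val: "reg_at x r \<Longrightarrow> reg_at x (r ^ k) \<and> val x (r ^ k) = val x r ^ k"
  by (induction k) (auto simp: val_simps intro!: reg_at_intros)

lemma val_local:
  assumes "reg_at (Fin a) u"
  obtains S where "open S" "a \<in> S" "\<And>z. z \<in> S \<Longrightarrow> reg_at (Fin z) u" "(\<lambda>z. val (Fin z) u) holomorphic_on S"
proof -
  obtain n p q where r: "u = Fract p q" "degree p \<le> n" "degree q \<le> n" "homog_eval n q (Fin a) \<noteq> 0"
    using assms by (auto elim: reg_atE)
  define S where "S = - {z. poly q z = 0}"
  have q: "q \<noteq> 0" using r by auto
  have eq: "val (Fin z) u = poly p z / poly q z" "reg_at (Fin z) u" if "z \<in> S" for z
    using that r val_Fract[of p n q "Fin z"] reg_at_Fract[of p n q "Fin z"] by (auto simp: S_def)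
  have "(\<lambda>z. poly p z / poly q z) holomorphic_on S"
    by (intro holomorphic_intros) (auto simp: S_def)
  then have "(\<lambda>z. val (Fin z) u) holomorphic_on S" using eq by (simp cong: holomorphic_cong)
  moreover have "open S" unfolding S_def
    by (intro open_Compl finite_imp_closed poly_roots_finite q)
  moreover have "a \<in> S" using r by (simp add: S_def)
  ultimately show ?thesis using that eq by blast
qed

text \<open>Stated for every exponent \<open>k\<close>, because the converse in
  \<open>zorder_val_eq_1_iff\<close> splits off the full power of \<open>crd - cst a\<close> and
  learns only from \<open>zorder\<close> that the exponent is 1.\<close>

lemma zorder_val_crd_power:
  assumes u: "reg_at (Fin a) u" "val (Fin a) u \<noteq> 0"
  shows "zorder (\<lambda>z. val (Fin z) ((crd - cst a) ^ k * u)) a = int k"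
proof -
  obtain S where S: "open S" "a \<in> S" "\<And>z. z \<in> S \<Longrightarrow> reg_at (Fin z) u" "(\<lambda>z. val (Fin z) u) holomorphic_on S"
    using val_local[OF u(1)] by blast
  show ?thesis
  proof (rule zorder_eqI[OF S(1,2,4) u(2)])
    fix z assume "z \<in> S" "z \<noteq> a"
    have c: "reg_at (Fin z) (crd - cst a)" "val (Fin z) (crd - cst a) = z - a"
      using reg_at_diff_val[OF reg_at_crd_val(1), of z "cst a"] reg_at_cst_val[of "Fin z" a]
        reg_at_crd_val(2)[of z] by auto
    show "val (Fin z) ((crd - cst a) ^ k * u) = val (Fin z) u * (z - a) powi int k"
      using reg_at_mult_val[of "Fin z" "(crd - cst a) ^ k" u] S(3)[OF \<open>z \<in> S\<close>] c
        reg_at_power_val[OF c(1), of k] by simp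
  qed
qed

lemma zorder_val_eq_1_iff:
  assumes "reg_at (Fin a) r" "r \<noteq> 0"
  shows "zorder (\<lambda>z. val (Fin z) r) a = 1 \<longleftrightarrow> simple_zero a r"
proof
  assume "simple_zero a r"
  then show "zorder (\<lambda>z. val (Fin z) r) a = 1"
    unfolding simple_zero_def using zorder_val_crd_power[of a _ 1] by auto
next
  assume z: "zorder (\<lambda>z. val (Fin z) r) a = 1"
  obtain n p q where r: "r = Fract p q" "degree p \<le> n" "degree q \<le> n" "homog_eval n q (Fin a) \<noteq> 0"
    using assms by (auto elim: reg_atE)
  have p: "p \<noteq> 0" using r assms by (auto simp: Zero_fract_def eq_fract)
  obtain p' where p': "p = [:- a, 1:] ^ order a p * p'" "\<not> [:- a, 1:] dvd p'"
    using order_decomp[OF p] by blast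
  have pa: "poly p' a \<noteq> 0" using p' by (simp add: poly_eq_0_iff_dvd)
  define k where "k = order a p"
  define u where "u = Fract p' q"
  define N where "N = max (degree p') (degree q)"
  have q: "poly q a \<noteq> 0" using r by simp
  have u: "reg_at (Fin a) u" "val (Fin a) u \<noteq> 0"
    unfolding u_def using reg_at_Fract[of p' N q "Fin a"] val_Fract[of p' N q "Fin a"] q pa
    by (auto simp: N_def)
  have c: "crd - cst a = Fract [:- a, 1:] 1" by (simp add: crd_def cst_def)
  have "(crd - cst a) ^ k = Fract ([:- a, 1:] ^ k) 1" for k
    by (induction k) (auto simp: c One_fract_def)
  then have req: "r = (crd - cst a) ^ k * u"
    using r(1) p'(1) by (simp add: u_def k_def)
  have "int k = 1" using z zorder_val_crd_power[OF u, of k] req by simp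
  then show "simple_zero a r" unfolding simple_zero_def using u req by auto
qed

lemma simple_zero_mult_unit:
  assumes "simple_zero a r" "reg_at (Fin a) u" "val (Fin a) u \<noteq> 0"
  shows "simple_zero a (r * u)" "simple_zero a (u * r)"
proof -
  obtain v where v: "reg_at (Fin a) v" "val (Fin a) v \<noteq> 0" "r = (crd - cst a) * v"
    using assms unfolding simple_zero_def by blast
  show "simple_zero a (r * u)" unfolding simple_zero_def
    by (rule exI[of _ "v * u"]) (use v assms in \<open>auto simp: val_simps intro!: reg_at_intros\<close>)
  then show "simple_zero a (u * r)" by (simp add: mult.commute)
qed

lemma simple_zero_tr:
  assumes "simple_zero (a + c) r"
  shows "simple_zero a (tr c r)"
proof -
  obtain v where v: "reg_at (Fin (a + c)) v" "val (Fin (a + c)) v \<noteq> 0" "r = (crd - cst (a + c)) * v"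
    using assms unfolding simple_zero_def by blast
  then show ?thesis unfolding simple_zero_def
    using reg_at_tr_val[of c "Fin a" v]
    by (intro exI[of _ "tr c v"]) (auto simp: tr_mult tr_diff tr_crd cst_simps tr_add)
qed

section \<open>Matrices of rational functions\<close>

text \<open>Evaluation at a point is a ring homomorphism only on the local ring there, while
  translation is one on the whole field. The locale treats determinants, products and inverses of
  matrices once for both. \<open>dom_inverse\<close> says that elements of nonzero value are
  units.\<close>

locale partial_ring_hom =
  fixes dom :: "'a::field \<Rightarrow> bool" and h :: "'a \<Rightarrow> 'b::field"
  assumes dom_0: "dom 0" and dom_1: "dom 1"
    and dom_add: "dom r \<Longrightarrow> dom s \<Longrightarrow> dom (r + s)"
    and dom_mult: "dom r \<Longrightarrow> dom s \<Longrightarrow> dom (r * s)"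
    and dom_uminus: "dom r \<Longrightarrow> dom (- r)"
    and dom_inverse: "dom r \<Longrightarrow> h r \<noteq> 0 \<Longrightarrow> dom (inverse r)"
    and h_0: "h 0 = 0" and h_1: "h 1 = 1"
    and h_add: "dom r \<Longrightarrow> dom s \<Longrightarrow> h (r + s) = h r + h s"
    and h_mult: "dom r \<Longrightarrow> dom s \<Longrightarrow> h (r * s) = h r * h s"
    and h_uminus: "dom r \<Longrightarrow> h (- r) = - h r"
begin

definition mdom :: "'a^'n^'m \<Rightarrow> bool" where "mdom M \<longleftrightarrow> (\<forall>i j. dom (M $ i $ j))"

lemma sum: "(\<And>i. i \<in> I \<Longrightarrow> dom (f i)) \<Longrightarrow> dom (sum f I) \<and> h (sum f I) = (\<Sum>i\<in>I. h (f i))"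
  by (induction I rule: infinite_finite_induct) (auto simp: dom_0 h_0 dom_add h_add)

lemma prod: "(\<And>i. i \<in> I \<Longrightarrow> dom (f i)) \<Longrightarrow> dom (prod f I) \<and> h (prod f I) = (\<Prod>i\<in>I. h (f i))"
  by (induction I rule: infinite_finite_induct) (auto simp: dom_1 h_1 dom_mult h_mult)

lemma of_int_sign: "dom (of_int (sign p)) \<and> h (of_int (sign p)) = of_int (sign p)"
  by (simp add: sign_def dom_1 h_1 dom_uminus h_uminus)

lemma det:
  fixes M :: "'a^'n^'n"
  assumes "mdom M"
  shows "dom (det M) \<and> h (det M) = det (map_matrix h M)"
proof -
  have p: "dom (\<Prod>i\<in>UNIV. M $ i $ p i) \<and> h (\<Prod>i\<in>UNIV. M $ i $ p i) = (\<Prod>i\<in>UNIV. h (M $ i $ p i))" for p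
    using assms prod[of UNIV "\<lambda>i. M $ i $ p i"] by (simp add: mdom_def)
  have t: "dom (of_int (sign p) * (\<Prod>i\<in>UNIV. M $ i $ p i)) \<and>
     h (of_int (sign p) * (\<Prod>i\<in>UNIV. M $ i $ p i)) = of_int (sign p) * (\<Prod>i\<in>UNIV. h (M $ i $ p i))" for p
    using dom_mult[OF conjunct1[OF of_int_sign] conjunct1[OF p], of p p]
      h_mult[OF conjunct1[OF of_int_sign] conjunct1[OF p], of p p] p of_int_sign[of p] by metis
  show ?thesis unfolding det_def nth_map_matrix
    using sum[of "{p. p permutes (UNIV :: 'n set)}" "\<lambda>p. of_int (sign p) * (\<Prod>i\<in>UNIV. M $ i $ p i)"] t
    by (simp only: t)
qed

lemma mult:
  assumes "mdom M" "mdom N"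
  shows "mdom (M ** N) \<and> map_matrix h (M ** N) = map_matrix h M ** map_matrix h N"
proof -
  have "dom (\<Sum>k\<in>UNIV. M $ i $ k * N $ k $ j) \<and>
    h (\<Sum>k\<in>UNIV. M $ i $ k * N $ k $ j) = (\<Sum>k\<in>UNIV. h (M $ i $ k) * h (N $ k $ j))" for i j
    using sum[of UNIV "\<lambda>k. M $ i $ k * N $ k $ j"] assms by (simp add: mdom_def dom_mult h_mult)
  then show ?thesis by (simp add: mdom_def matrix_matrix_mult_def map_matrix_def vec_eq_iff)
qed

lemma mat_1: "mdom (mat 1 :: 'a^'n^'n) \<and> map_matrix h (mat 1 :: 'a^'n^'n) = mat 1"
  by (simp add: mdom_def mat_def map_matrix_def vec_eq_iff dom_0 dom_1 h_0 h_1)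

end

lemma matrix_inv_right_left:
  fixes M :: "'a::field^'n^'n"
  assumes "det M \<noteq> 0"
  shows "M ** matrix_inv M = mat 1" "matrix_inv M ** M = mat 1"
proof -
  have "\<exists>A'. M ** A' = mat 1 \<and> A' ** M = mat 1"
    using assms invertible_det_nz[of M] unfolding invertible_def by simp
  from someI_ex[OF this] show "M ** matrix_inv M = mat 1" "matrix_inv M ** M = mat 1"
    unfolding matrix_inv_def by blast+
qed

lemma det_matrix_inv:
  fixes M :: "'a::field^'n^'n"
  assumes "det M \<noteq> 0"
  shows "det (matrix_inv M) = inverse (det M)"
  using matrix_inv_right_left(1)[OF assms] det_mul[of M "matrix_inv M"]
  by (metis det_I inverse_unique)

lemma det_matrix_inv_nz:
  fixes M :: "'a::field^'n^'n"
  assumes "det M \<noteq> 0"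
  shows "det (matrix_inv M) \<noteq> 0"
  using det_matrix_inv[OF assms] assms by simp

lemma matrix_inv_cancel:
  fixes M :: "'a::field^'n^'n" and N :: "'a::field^'m^'n" and P :: "'a::field^'n^'m"
  assumes "det M \<noteq> 0"
  shows "M ** (matrix_inv M ** N) = N" "matrix_inv M ** (M ** N) = N"
    "P ** M ** matrix_inv M = P" "P ** matrix_inv M ** M = P"
  using matrix_inv_right_left[OF assms]
  by (simp_all add: matrix_mul_assoc) (simp_all flip: matrix_mul_assoc)

lemma matrix_inv_eqI:
  fixes M :: "'a::field^'n^'n"
  assumes "M ** N = mat 1"
  shows "matrix_inv M = N"
proof -
  have "det M * det N = 1" using assms det_mul[of M N] by simp
  then have "det M \<noteq> 0" by auto
  from matrix_inv_cancel(2)[OF this, of N] show ?thesis using assms by simp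
qed

lemma matrix_inv_mult:
  fixes M N :: "'a::field^'n^'n"
  assumes "det M \<noteq> 0" "det N \<noteq> 0"
  shows "matrix_inv (M ** N) = matrix_inv N ** matrix_inv M"
proof (rule matrix_inv_eqI)
  have "M ** N ** (matrix_inv N ** matrix_inv M) = M ** (N ** matrix_inv N) ** matrix_inv M"
    by (simp only: matrix_mul_assoc)
  then show "M ** N ** (matrix_inv N ** matrix_inv M) = mat 1"
    using assms by (simp add: matrix_inv_right_left)
qed

lemma matrix_inv_matrix_inv:
  fixes M :: "'a::field^'n^'n"
  assumes "det M \<noteq> 0"
  shows "matrix_inv (matrix_inv M) = M"
  by (rule matrix_inv_eqI) (use assms matrix_inv_right_left in blast)

lemma matrix_inv_mat_1: "matrix_inv (mat 1 :: 'a::field^'n^'n) = mat 1"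
  by (rule matrix_inv_eqI) simp

text \<open>Cramer's rule applied to the columns of the identity. It writes the entries of the
  inverse as determinants over \<open>det M\<close>, so regularity of the inverse reduces to
  regularity of determinants.\<close>

lemma matrix_inv_nth:
  fixes M :: "'a::field^'n^'n"
  assumes "det M \<noteq> 0"
  shows "matrix_inv M $ k $ l = det (\<chi> i j. if j = k then (if i = l then 1 else 0) else M $ i $ j) / det M"
proof -
  have "M *v column l (matrix_inv M) = column l (mat 1)"
    using matrix_inv_right_left(1)[OF assms]
    by (simp add: column_def vec_eq_iff matrix_matrix_mult_def matrix_vector_mult_def)
  then have "M *v column l (matrix_inv M) = (\<chi> i. if i = l then 1 else 0)"
    by (simp add: column_def mat_def vec_eq_iff)
  then have "column l (matrix_inv M) =
     (\<chi> k. det (\<chi> i j. if j = k then (\<chi> i. if i = l then 1 else 0) $ i else M $ i $ j) / det M)"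
    using cramer[OF assms] by blast
  from arg_cong[OF this, of "\<lambda>v. v $ k"] show ?thesis by (simp add: column_def cong: if_cong)
qed

context partial_ring_hom
begin

lemma inv:
  fixes M :: "'a^'n^'n"
  assumes "mdom M" "h (det M) \<noteq> 0"
  shows "mdom (matrix_inv M) \<and> map_matrix h (matrix_inv M) = matrix_inv (map_matrix h M)"
proof -
  have nz: "det M \<noteq> 0" using assms h_0 by auto
  have "mdom (matrix_inv M)"
    unfolding mdom_def
  proof (intro allI)
    fix k l
    have "mdom (\<chi> i j. if j = k then (if i = l then 1 else 0) else M $ i $ j)"
      using assms by (simp add: mdom_def dom_0 dom_1)
    then have "dom (det (\<chi> i j. if j = k then (if i = l then 1 else 0) else M $ i $ j) * inverse (det M))"
      using det dom_mult dom_inverse assms by blast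
    then show "dom (matrix_inv M $ k $ l)" using matrix_inv_nth[OF nz] by (simp add: divide_inverse)
  qed
  moreover from this have "map_matrix h M ** map_matrix h (matrix_inv M) = mat 1"
    using mult[OF assms(1)] matrix_inv_right_left(1)[OF nz] mat_1 by metis
  ultimately show ?thesis using matrix_inv_eqI by metis
qed

end

interpretation val: partial_ring_hom "reg_at x" "val x" for x
  by unfold_locales (auto simp: val_simps reg_at_inverse_val intro!: reg_at_intros)

interpretation tr: partial_ring_hom "\<lambda>_. True" "tr c" for c
  by unfold_locales (auto simp: tr_add tr_mult tr_uminus)

abbreviation mreg :: "p1 \<Rightarrow> ratfun^'n^'m \<Rightarrow> bool" where "mreg \<equiv> val.mdom"
abbreviation mval :: "p1 \<Rightarrow> ratfun^'n^'m \<Rightarrow> complex^'n^'m" where "mval x \<equiv> map_matrix (val x)"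
abbreviation mtr :: "ratfun^'n^'m \<Rightarrow> ratfun^'n^'m" where "mtr \<equiv> map_matrix (tr 1)"

lemma mtr_mult: "map_matrix (tr c) (M ** N) = map_matrix (tr c) M ** map_matrix (tr c) N"
  using tr.mult by (auto simp: tr.mdom_def)

lemma det_mtr: "det (map_matrix (tr c) M) = tr c (det M)"
  using tr.det[of M c] by (auto simp: tr.mdom_def)

lemma mtr_inv: "det M \<noteq> 0 \<Longrightarrow> map_matrix (tr c) (matrix_inv M) = matrix_inv (map_matrix (tr c) M)"
  using tr.inv[of M c] by (auto simp: tr.mdom_def)

lemma mtr_mat_1: "map_matrix (tr c) (mat 1) = mat 1"
  using tr.mat_1 by auto

text \<open>Membership in GL_n of the local ring at \<open>x\<close>: exactly the changes of basis
  of a lattice at \<open>x\<close>.\<close>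

definition gl_at :: "p1 \<Rightarrow> ratfun^'n^'n \<Rightarrow> bool" where
  "gl_at x M \<longleftrightarrow> mreg x M \<and> val x (det M) \<noteq> 0"

lemma gl_at_det: "gl_at x M \<Longrightarrow> det M \<noteq> 0"
  by (auto simp: gl_at_def val_simps)

lemma gl_at_mult: "gl_at x M \<Longrightarrow> gl_at x N \<Longrightarrow> gl_at x (M ** N)"
  unfolding gl_at_def using val.mult[of x M N] val.det[of x M] val.det[of x N]
  by (auto simp: det_mul val_simps)

lemma gl_at_inv: 
  assumes "gl_at x M" shows "gl_at x (matrix_inv M)"
proof -
  have "reg_at x (det M)" "val x (det M) \<noteq> 0" using assms val.det unfolding gl_at_def by auto
  then show ?thesis using assms val.inv[of x M] gl_at_det[OF assms]
    by (auto simp: gl_at_def det_matrix_inv reg_at_inverse_val)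
qed

lemma gl_at_mat_1: "gl_at x (mat 1)"
  by (simp add: gl_at_def val_simps val.mat_1)

lemma gl_at_mreg: "gl_at x M \<Longrightarrow> mreg x M"
  by (simp add: gl_at_def)

lemma mval_inv: "gl_at x M \<Longrightarrow> mval x (matrix_inv M) = matrix_inv (mval x M)"
  using val.inv by (auto simp: gl_at_def)

lemma mval_mult: "mreg x M \<Longrightarrow> mreg x N \<Longrightarrow> mval x (M ** N) = mval x M ** mval x N"
  using val.mult by auto

lemma mreg_mult: "mreg x M \<Longrightarrow> mreg x N \<Longrightarrow> mreg x (M ** N)"
  using val.mult by auto

lemma gl_at_iff: "gl_at x M \<longleftrightarrow> mreg x M \<and> det (mval x M) \<noteq> 0"
  unfolding gl_at_def using val.det by metis

text \<open>The determinants of the values of \<open>M\<close> and of its inverse multiply to 1. In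
  this form an intertwiner is an isomorphism as soon as it and its inverse are regular.\<close>

lemma gl_at_iff_inv:
  assumes "det M \<noteq> 0"
  shows "gl_at x M \<longleftrightarrow> mreg x M \<and> mreg x (matrix_inv M)"
proof
  assume "gl_at x M" then show "mreg x M \<and> mreg x (matrix_inv M)" using gl_at_inv gl_at_mreg by blast
next
  assume "mreg x M \<and> mreg x (matrix_inv M)"
  then have "mval x M ** mval x (matrix_inv M) = mat 1"
    using mval_mult[of x M "matrix_inv M"] matrix_inv_right_left[OF assms] val.mat_1 by metis
  then have "det (mval x M) * det (mval x (matrix_inv M)) = 1" by (metis det_I det_mul)
  then show "gl_at x M" using \<open>mreg x M \<and> _\<close> by (auto simp: gl_at_iff)
qed

lemma mreg_mtr_iff: "mreg x (mtr M) \<longleftrightarrow> mreg (shift x) M"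
  by (simp add: val.mdom_def reg_at_tr_iff p1_shift_1)

lemma mval_mtr: "mreg (shift x) M \<Longrightarrow> mval x (mtr M) = mval (shift x) M"
  using reg_at_tr_val[of 1 x] by (simp add: val.mdom_def p1_shift_1 map_matrix_def)

lemma gl_at_mtr_iff: "gl_at x (mtr M) \<longleftrightarrow> gl_at (shift x) M"
  using mval_mtr[of x M] by (auto simp: gl_at_iff mreg_mtr_iff)

lemma finite_not_mreg: "finite {x. \<not> mreg x M}"
proof -
  have "{x. \<not> mreg x M} = (\<Union>i. \<Union>j. {x. \<not> reg_at x (M $ i $ j)})" by (auto simp: val.mdom_def)
  then show ?thesis using finite_poles by auto
qed

lemma finite_not_gl_at: "det M \<noteq> 0 \<Longrightarrow> finite {x. \<not> gl_at x M}"
  unfolding gl_at_def using finite_not_mreg[of M] finite_zeros_poles[of "det M"]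
  by (auto intro: finite_subset[of _ "{x. \<not> mreg x M} \<union> {x. \<not> (reg_at x (det M) \<and> val x (det M) \<noteq> 0)}"])

lemma matrix_ratfun_eqI:
  assumes "infinite X" "\<And>x. x \<in> X \<Longrightarrow> mreg x M \<and> mreg x N \<and> mval x M = mval x N"
  shows "M = N"
proof -
  have "M $ i $ j = N $ i $ j" for i j
  proof (rule ratfun_eqI[OF assms(1)])
    fix x assume "x \<in> X"
    from assms(2)[OF this] show "reg_at x (M $ i $ j) \<and> reg_at x (N $ i $ j) \<and> val x (M $ i $ j) = val x (N $ i $ j)"
      by (metis nth_map_matrix val.mdom_def)
  qed
  then show ?thesis by (simp add: vec_eq_iff)
qed

lemma mat_regular_on_iff:
  assumes "zariski_open U"
  shows "mat_regular_on U F \<longleftrightarrow> (\<exists>M. \<forall>x\<in>U. mreg x M \<and> F x = mval x M)"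
proof
  assume "mat_regular_on U F"
  then have "\<forall>i j. \<exists>r. \<forall>x\<in>U. reg_at x r \<and> F x $ i $ j = val x r"
    unfolding mat_regular_on_def regular_on_iff[OF assms] .
  then obtain r where "\<And>i j x. x \<in> U \<Longrightarrow> reg_at x (r i j) \<and> F x $ i $ j = val x (r i j)" by metis
  then show "\<exists>M. \<forall>x\<in>U. mreg x M \<and> F x = mval x M"
    by (intro exI[of _ "\<chi> i j. r i j"]) (auto simp: val.mdom_def vec_eq_iff)
next
  assume "\<exists>M. \<forall>x\<in>U. mreg x M \<and> F x = mval x M"
  then show "mat_regular_on U F"
    unfolding mat_regular_on_def regular_on_iff[OF assms] val.mdom_def by fastforce
qed

section \<open>Bundles as families of lattices\<close>

lemmas matrix_group_simps = matrix_mul_assoc[symmetric] matrix_inv_mult matrix_inv_cancel(1,2)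
  det_mul det_matrix_inv_nz matrix_inv_right_left matrix_inv_matrix_inv

text \<open>The columns of \<open>N x\<close> form a basis of a lattice over the local ring at
  \<open>x\<close>; another basis of the same lattice differs by right multiplication with an
  element of \<open>gl_at x\<close>. Being exactly \<open>mat 1\<close> outside a finite set is a
  normalization of the bases, available once a generic frame is fixed.\<close>

definition lattice :: "(p1 \<Rightarrow> ratfun^'n^'n) \<Rightarrow> bool" where
  "lattice N \<longleftrightarrow> (\<forall>x. det (N x) \<noteq> 0) \<and> finite {x. N x \<noteq> mat 1}"

definition chart_matrix ::
    "(p1 \<Rightarrow> ratfun^'n^'n) \<Rightarrow> (p1 \<Rightarrow> complex^'n^'n) \<Rightarrow> 'n triv \<Rightarrow> ratfun^'n^'n \<Rightarrow> bool" where
  "chart_matrix N E c M \<longleftrightarrow> zariski_open (fst c) \<and> (\<forall>x\<in>fst c.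
     gl_at x (matrix_inv (N x) ** M) \<and> snd c x = E x ** mval x (matrix_inv (N x) ** M))"

text \<open>\<open>E x\<close> maps \<open>\<complex>\<^sup>n\<close> to the fibre at \<open>x\<close>, in the basis given by the lattice basis \<open>N x\<close>. A chart with
  matrix \<open>M\<close> over the function field is regular at \<open>x\<close> iff \<open>M\<close> spans the same lattice there as \<open>N x\<close>.\<close>

definition models ::
    "'n vbundle \<Rightarrow> (p1 \<Rightarrow> ratfun^'n^'n) \<Rightarrow> (p1 \<Rightarrow> complex^'n^'n) \<Rightarrow> bool" where
  "models L N E \<longleftrightarrow> lattice N \<and> (\<forall>x. det (E x) \<noteq> 0) \<and> (\<Union>c\<in>L. fst c) = UNIV \<and>
     (\<forall>c\<in>L. \<exists>M. chart_matrix N E c M)"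

lemma matrix_field_eqI:
  fixes M N :: "'a::field^'n^'n"
  assumes "det P \<noteq> 0" "det Q \<noteq> 0" "P ** M ** Q = P ** N ** Q"
  shows "M = N"
proof -
  have "matrix_inv P ** (P ** M ** Q) ** matrix_inv Q = matrix_inv P ** (P ** N ** Q) ** matrix_inv Q"
    using assms(3) by simp
  then show ?thesis using assms(1,2) by (simp add: matrix_group_simps)
qed

text \<open>Regularity of a map between two lattices does not depend on the bases chosen for
  them.\<close>

lemma gl_at_conj_iff:
  assumes "gl_at x G" "gl_at x H"
  shows "mreg x (matrix_inv G ** P ** H) \<longleftrightarrow> mreg x P"
    and "mreg x P \<Longrightarrow> mval x (matrix_inv G ** P ** H) = matrix_inv (mval x G) ** mval x P ** mval x H"
proof -
  have i: "mreg x G" "mreg x H" "mreg x (matrix_inv G)" "mreg x (matrix_inv H)"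
    using assms gl_at_inv gl_at_mreg by blast+
  have d: "det G \<noteq> 0" "det H \<noteq> 0" using assms gl_at_det by blast+
  have "mreg x P" if "mreg x (matrix_inv G ** P ** H)"
  proof -
    have "mreg x (G ** (matrix_inv G ** P ** H) ** matrix_inv H)"
      by (rule mreg_mult[OF mreg_mult[OF i(1) that] i(4)])
    then show ?thesis using d by (simp add: matrix_group_simps)
  qed
  moreover have "mreg x (matrix_inv G ** P ** H)" if "mreg x P"
    by (rule mreg_mult[OF mreg_mult[OF i(3) that] i(2)])
  ultimately show "mreg x (matrix_inv G ** P ** H) \<longleftrightarrow> mreg x P" by (rule iffI)
  show "mreg x P \<Longrightarrow> mval x (matrix_inv G ** P ** H) = matrix_inv (mval x G) ** mval x P ** mval x H"
    by (simp add: mval_mult mval_inv[OF assms(1)] mreg_mult i)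
qed

text \<open>\<open>\<phi>\<close> is a map of fibres and \<open>\<Phi>\<close> the rational matrix
  meant to represent it. Both sides say that it does, on the left in the lattice bases
  \<open>N\<close>, \<open>N'\<close>, on the right in the chart frames \<open>M\<close>,
  \<open>M'\<close>; they differ by the conjugation of \<open>gl_at_conj_iff\<close>.\<close>

lemma chart_transition:
  fixes E E' \<phi> S T :: "complex^'n^'n"
  assumes "gl_at x (matrix_inv N ** M)" "S = E ** mval x (matrix_inv N ** M)"
    and "gl_at x (matrix_inv N' ** M')" "T = E' ** mval x (matrix_inv N' ** M')"
    and "det N \<noteq> 0" "det N' \<noteq> 0" "det E \<noteq> 0" "det E' \<noteq> 0"
  shows "mreg x (matrix_inv N' ** \<Phi> ** N) \<and> \<phi> = E' ** mval x (matrix_inv N' ** \<Phi> ** N) ** matrix_inv E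
    \<longleftrightarrow> mreg x (matrix_inv M' ** \<Phi> ** M) \<and> matrix_inv T ** \<phi> ** S = mval x (matrix_inv M' ** \<Phi> ** M)"
proof -
  define G where "G = matrix_inv N ** M"
  define G' where "G' = matrix_inv N' ** M'"
  define P where "P = matrix_inv N' ** \<Phi> ** N"
  have gl: "gl_at x G" "gl_at x G'" using assms by (simp_all add: G_def G'_def)
  have "det M' \<noteq> 0" "det M \<noteq> 0"
    using gl_at_det[OF gl(1)] gl_at_det[OF gl(2)] by (auto simp: G_def G'_def det_mul)
  then have eq: "matrix_inv M' ** \<Phi> ** M = matrix_inv G' ** P ** G"
    using assms by (simp add: G_def G'_def P_def matrix_group_simps)
  have nz: "det (mval x G) \<noteq> 0" "det (mval x G') \<noteq> 0" using gl by (auto simp: gl_at_iff)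
  have "matrix_inv T ** \<phi> ** S = matrix_inv (mval x G') ** mval x P ** mval x G \<longleftrightarrow>
      \<phi> = E' ** mval x P ** matrix_inv E"
  proof
    assume "matrix_inv T ** \<phi> ** S = matrix_inv (mval x G') ** mval x P ** mval x G"
    then have "T ** (matrix_inv T ** \<phi> ** S) ** matrix_inv S =
       T ** (matrix_inv (mval x G') ** mval x P ** mval x G) ** matrix_inv S" by simp
    then show "\<phi> = E' ** mval x P ** matrix_inv E"
      using assms nz by (simp add: matrix_group_simps flip: G_def G'_def)
  next
    assume "\<phi> = E' ** mval x P ** matrix_inv E"
    then show "matrix_inv T ** \<phi> ** S = matrix_inv (mval x G') ** mval x P ** mval x G"
      using assms nz by (simp add: matrix_group_simps flip: G_def G'_def)
  qed
  then show ?thesis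
    unfolding eq P_def[symmetric] using gl_at_conj_iff[OF gl(2,1), of P] by auto
qed

text \<open>The bridge from pointwise maps to single rational matrices. Each pair of charts yields a
  candidate \<open>\<Phi>\<close>; two candidates have equal values at infinitely many points where
  both lattices are standard, so all of them coincide.\<close>

lemma models_regular_map:
  assumes "models L N E" "models L' N' E'" "zariski_open W"
  shows "regular_map_on W L L' \<phi> \<longleftrightarrow> (\<exists>\<Phi>. \<forall>x\<in>W. mreg x (matrix_inv (N' x) ** \<Phi> ** N x) \<and>
     \<phi> x = E' x ** mval x (matrix_inv (N' x) ** \<Phi> ** N x) ** matrix_inv (E x))"
proof -
  define P where "P = (\<lambda>x \<Phi>. mreg x (matrix_inv (N' x) ** \<Phi> ** N x) \<and>
     \<phi> x = E' x ** mval x (matrix_inv (N' x) ** \<Phi> ** N x) ** matrix_inv (E x))"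
  have nz: "det (N x) \<noteq> 0" "det (N' x) \<noteq> 0" "det (E x) \<noteq> 0" "det (E' x) \<noteq> 0" for x
    using assms by (auto simp: models_def lattice_def)
  have "\<forall>c\<in>L. \<exists>M. chart_matrix N E c M" "\<forall>c\<in>L'. \<exists>M. chart_matrix N' E' c M"
    using assms by (auto simp: models_def)
  then obtain M M' where M: "\<And>c. c \<in> L \<Longrightarrow> chart_matrix N E c (M c)"
    and M': "\<And>c. c \<in> L' \<Longrightarrow> chart_matrix N' E' c (M' c)" by metis
  have trans: "P x \<Phi> \<longleftrightarrow> mreg x (matrix_inv (M' c') ** \<Phi> ** M c) \<and>
      matrix_inv (snd c' x) ** \<phi> x ** snd c x = mval x (matrix_inv (M' c') ** \<Phi> ** M c)"
    if "c \<in> L" "c' \<in> L'" "x \<in> fst c" "x \<in> fst c'" for c c' x \<Phi>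
    unfolding P_def
    by (rule chart_transition) (use M[OF that(1)] M'[OF that(2)] that nz in \<open>auto simp: chart_matrix_def\<close>)
  have uniq: "\<Phi> = \<Psi>" if X: "infinite X" "\<And>x. x \<in> X \<Longrightarrow> P x \<Phi> \<and> P x \<Psi>" for X \<Phi> \<Psi>
  proof (rule matrix_ratfun_eqI)
    have "finite ({x. N x \<noteq> mat 1} \<union> {x. N' x \<noteq> mat 1})"
      using assms by (auto simp: models_def lattice_def)
    then show "infinite (X - ({x. N x \<noteq> mat 1} \<union> {x. N' x \<noteq> mat 1}))" using X(1) by simp
  next
    fix x assume "x \<in> X - ({x. N x \<noteq> mat 1} \<union> {x. N' x \<noteq> mat 1})"
    then have "x \<in> X" "N x = mat 1" "N' x = mat 1" by auto
    then have *: "P x \<Phi>" "P x \<Psi>" and 1: "matrix_inv (N' x) = mat 1" "N x = mat 1"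
      using X(2)[of x] by (simp_all add: matrix_inv_mat_1)
    note * = *[unfolded P_def 1 matrix_mul_lid matrix_mul_rid]
    then have "E' x ** mval x \<Phi> ** matrix_inv (E x) = E' x ** mval x \<Psi> ** matrix_inv (E x)" by metis
    then have "mval x \<Phi> = mval x \<Psi>"
      by (rule matrix_field_eqI[rotated 2]) (rule nz det_matrix_inv_nz)+
    with * show "mreg x \<Phi> \<and> mreg x \<Psi> \<and> mval x \<Phi> = mval x \<Psi>" by blast
  qed
  have "regular_map_on W L L' \<phi> \<longleftrightarrow> (\<exists>\<Phi>. \<forall>x\<in>W. P x \<Phi>)"
  proof
    assume "\<exists>\<Phi>. \<forall>x\<in>W. P x \<Phi>"
    then obtain \<Phi> where \<Phi>: "\<And>x. x \<in> W \<Longrightarrow> P x \<Phi>" by blast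
    have "mat_regular_on (W \<inter> fst c \<inter> fst c') (\<lambda>x. matrix_inv (snd c' x) ** \<phi> x ** snd c x)"
      if "c \<in> L" "c' \<in> L'" for c c'
    proof -
      have op: "zariski_open (W \<inter> fst c \<inter> fst c')"
        using M[OF that(1)] M'[OF that(2)] assms(3) by (simp add: zariski_open_Int chart_matrix_def)
      show ?thesis unfolding mat_regular_on_iff[OF op]
        using trans[OF that] \<Phi> by (intro exI[of _ "matrix_inv (M' c') ** \<Phi> ** M c"]) auto
    qed
    then show "regular_map_on W L L' \<phi>" by (simp add: regular_map_on_def case_prod_unfold)
  next
    assume reg: "regular_map_on W L L' \<phi>"
    have loc: "\<exists>\<Phi>. \<forall>x\<in>W \<inter> fst c \<inter> fst c'. P x \<Phi>" if c: "c \<in> L" "c' \<in> L'" for c c'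
    proof (cases "W \<inter> fst c \<inter> fst c' = {}")
      case False
      have "zariski_open (W \<inter> fst c \<inter> fst c')"
        using M[OF c(1)] M'[OF c(2)] assms(3) by (simp add: zariski_open_Int chart_matrix_def)
      moreover have "mat_regular_on (W \<inter> fst c \<inter> fst c') (\<lambda>x. matrix_inv (snd c' x) ** \<phi> x ** snd c x)"
        using reg c by (simp add: regular_map_on_def case_prod_unfold)
      ultimately obtain X where X: "\<And>x. x \<in> W \<inter> fst c \<inter> fst c' \<Longrightarrow>
          mreg x X \<and> matrix_inv (snd c' x) ** \<phi> x ** snd c x = mval x X"
        by (subst (asm) mat_regular_on_iff) blast+
      obtain x where x: "x \<in> fst c" "x \<in> fst c'" using False by blast
      have "det (matrix_inv (N x) ** M c) \<noteq> 0" "det (matrix_inv (N' x) ** M' c') \<noteq> 0"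
        using x M[OF c(1)] M'[OF c(2)] gl_at_det unfolding chart_matrix_def by blast+
      then have "det (M c) \<noteq> 0" "det (M' c') \<noteq> 0" by (simp_all add: det_mul)
      \<comment> \<open>\<open>X\<close> is the matrix in the two charts; conjugation by the chart
        matrices carries it to the generic frames.\<close>
      then have "matrix_inv (M' c') ** (M' c' ** X ** matrix_inv (M c)) ** M c = X"
        by (simp add: matrix_group_simps)
      then have "\<forall>x\<in>W \<inter> fst c \<inter> fst c'. P x (M' c' ** X ** matrix_inv (M c))"
        using trans[OF c] X by auto
      then show ?thesis by blast
    qed auto
    have "\<exists>\<Phi>. \<forall>x\<in>W. P x \<Phi>"
    proof (cases "W = {}")
      case False
      then obtain x0 where x0: "x0 \<in> W" by blast
      have cov: "\<exists>c\<in>L. x \<in> fst c" "\<exists>c\<in>L'. x \<in> fst c" for x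
        using assms UNIV_I[of x] unfolding models_def by blast+
      have loc': "\<exists>V \<Phi>. zariski_open V \<and> x \<in> V \<and> (\<forall>y\<in>V. P y \<Phi>)" if x: "x \<in> W" for x
      proof -
        obtain c c' where c: "c \<in> L" "c' \<in> L'" "x \<in> fst c" "x \<in> fst c'" using cov by blast
        have "zariski_open (W \<inter> fst c \<inter> fst c')"
          using M[OF c(1)] M'[OF c(2)] assms(3) by (simp add: zariski_open_Int chart_matrix_def)
        then show ?thesis using loc[OF c(1,2)] c x by blast
      qed
      obtain V \<Phi> where V: "zariski_open V" "x0 \<in> V" "\<And>y. y \<in> V \<Longrightarrow> P y \<Phi>" using loc'[OF x0] by blast
      have "P x \<Phi>" if x: "x \<in> W" for x
      proof -
        obtain V' \<Psi> where V': "zariski_open V'" "x \<in> V'" "\<And>y. y \<in> V' \<Longrightarrow> P y \<Psi>" using loc'[OF x] by blast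
        have "infinite (V \<inter> V')" using V V'
          by (intro infinite_zariski_open zariski_open_Int zariski_open_Int_nonempty) auto
        then have "\<Phi> = \<Psi>" using V(3) V'(3) by (intro uniq[of "V \<inter> V'"]) auto
        then show ?thesis using V' by blast
      qed
      then show ?thesis by blast
    qed auto
    then show "\<exists>\<Phi>. \<forall>x\<in>W. P x \<Phi>" .
  qed
  then show ?thesis unfolding P_def .
qed

section \<open>From atlases to lattices and back\<close>

lemma frame_det: "frame c \<Longrightarrow> x \<in> fst c \<Longrightarrow> det (snd c x) \<noteq> 0"
  by (auto simp: frame_def invertible_det_nz split: prod.splits)

text \<open>One chart \<open>c0\<close> serves as generic frame. The transition matrices
  \<open>T c c'\<close> are rational and satisfy the cocycle rule, and \<open>T c c0\<close> becomes
  the matrix of the chart \<open>c\<close>.\<close>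

lemma vector_bundle_models:
  fixes L :: "('n::finite) vbundle"
  assumes "vector_bundle L"
  shows "\<exists>N E. models L N E"
proof -
  have fr: "frame c" if "c \<in> L" for c using assms that by (auto simp: vector_bundle_def)
  have op: "zariski_open (fst c)" if "c \<in> L" for c
    using fr[OF that] by (auto simp: frame_def split: prod.splits)
  have nz: "det (snd c x) \<noteq> 0" if "c \<in> L" "x \<in> fst c" for c x
    using fr[OF that(1)] that(2) by (rule frame_det)
  have cov: "(\<Union>c\<in>L. fst c) = UNIV" using assms by (simp add: vector_bundle_def case_prod_unfold)
  have "\<exists>T. \<forall>x\<in>fst c \<inter> fst c'. gl_at x T \<and> matrix_inv (snd c' x) ** snd c x = mval x T"
    if c: "c \<in> L" "c' \<in> L" for c c'
  proof -
    have "compatible c c'" using assms c by (auto simp: vector_bundle_def)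
    then have "mat_regular_on (fst c \<inter> fst c') (\<lambda>x. matrix_inv (snd c' x) ** snd c x)"
      by (auto simp: compatible_def split: prod.splits)
    then obtain T where T: "\<And>x. x \<in> fst c \<inter> fst c' \<Longrightarrow> mreg x T \<and> matrix_inv (snd c' x) ** snd c x = mval x T"
      unfolding mat_regular_on_iff[OF zariski_open_Int[OF op[OF c(1)] op[OF c(2)]]] by blast
    have "gl_at x T" if "x \<in> fst c \<inter> fst c'" for x
      using T[OF that] nz[OF c(1)] nz[OF c(2)] that unfolding gl_at_iff
      by (metis IntD1 IntD2 det_matrix_inv_nz det_mul mult_eq_0_iff)
    then show ?thesis using T by blast
  qed
  then have "\<forall>c c'. \<exists>T. c \<in> L \<longrightarrow> c' \<in> L \<longrightarrow>
      (\<forall>x\<in>fst c \<inter> fst c'. gl_at x T \<and> matrix_inv (snd c' x) ** snd c x = mval x T)" by blast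
  then obtain T where T: "\<And>c c' x. c \<in> L \<Longrightarrow> c' \<in> L \<Longrightarrow> x \<in> fst c \<Longrightarrow> x \<in> fst c' \<Longrightarrow>
      gl_at x (T c c') \<and> matrix_inv (snd c' x) ** snd c x = mval x (T c c')"
    unfolding choice_iff by blast
  have cocycle: "T c' c'' ** T c c' = T c c''"
    if c: "c \<in> L" "c' \<in> L" "c'' \<in> L" "fst c \<noteq> {}" "fst c' \<noteq> {}" "fst c'' \<noteq> {}" for c c' c''
  proof (rule matrix_ratfun_eqI)
    show "infinite (fst c \<inter> (fst c' \<inter> fst c''))"
      by (intro infinite_zariski_open zariski_open_Int zariski_open_Int_nonempty op c)
  next
    fix x assume x: "x \<in> fst c \<inter> (fst c' \<inter> fst c'')"
    have "mval x (T c' c'' ** T c c') = matrix_inv (snd c'' x) ** snd c' x ** (matrix_inv (snd c' x) ** snd c x)"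
      using T[of c' c'' x] T[of c c' x] c x mval_mult[of x "T c' c''" "T c c'"] gl_at_mreg by auto
    also have "\<dots> = mval x (T c c'')"
      using T[of c c'' x] nz[of c' x] c x by (simp add: matrix_group_simps)
    finally have eq: "mval x (T c' c'' ** T c c') = mval x (T c c'')" .
    have "gl_at x (T c' c'')" "gl_at x (T c c')" "gl_at x (T c c'')"
      using T[of c' c'' x] T[of c c' x] T[of c c'' x] c x by auto
    then show "mreg x (T c' c'' ** T c c') \<and> mreg x (T c c'') \<and> mval x (T c' c'' ** T c c') = mval x (T c c'')"
      using eq gl_at_mreg gl_at_mult by blast
  qed
  obtain c0 where c0: "c0 \<in> L" "Inf \<in> fst c0" using cov by blast
  \<comment> \<open>The chart chosen at \<open>x\<close> is \<open>c0\<close> wherever possible, so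
    that \<open>N x\<close> is \<open>T c0 c0 = mat 1\<close> on the whole domain of
    \<open>c0\<close>, whose complement is finite.\<close>
  have "\<exists>c. c \<in> L \<and> x \<in> fst c \<and> (x \<in> fst c0 \<longrightarrow> c = c0)" for x
    using cov c0 by (cases "x \<in> fst c0") blast+
  then obtain ch where ch: "\<And>x. ch x \<in> L \<and> x \<in> fst (ch x) \<and> (x \<in> fst c0 \<longrightarrow> ch x = c0)" by metis
  have ne: "fst c0 \<noteq> {}" "fst (ch x) \<noteq> {}" for x using c0 ch by blast+
  define N where "N = (\<lambda>x. T (ch x) c0)"
  define E where "E = (\<lambda>x. snd (ch x) x)"
  have detT: "det (T c c') \<noteq> 0" if "c \<in> L" "c' \<in> L" "fst c \<noteq> {}" "fst c' \<noteq> {}" for c c'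
    using T[of c c'] that zariski_open_Int_nonempty[OF op op, of c c'] gl_at_det by blast
  \<comment> \<open>An invertible idempotent is the identity.\<close>
  have T1: "T c0 c0 = mat 1"
    using cocycle[of c0 c0 c0] c0 ne(1) matrix_inv_cancel(2)[OF detT[of c0 c0], of "T c0 c0"]
      matrix_inv_right_left(2)[OF detT[of c0 c0]] by simp
  have "lattice N"
    unfolding lattice_def
  proof
    show "\<forall>x. det (N x) \<noteq> 0" using detT ch c0 ne by (simp add: N_def)
    have "{x. N x \<noteq> mat 1} \<subseteq> - fst c0" using ch T1 by (auto simp: N_def)
    moreover have "finite (- fst c0)" using op[OF c0(1)] ne(1) by (simp add: zariski_open_def)
    ultimately show "finite {x. N x \<noteq> mat 1}" by (rule finite_subset)
  qed
  moreover have "\<exists>M. chart_matrix N E c M" if c: "c \<in> L" for c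
  proof -
    have "gl_at x (matrix_inv (N x) ** T c c0) \<and> snd c x = E x ** mval x (matrix_inv (N x) ** T c c0)"
      if x: "x \<in> fst c" for x
    proof -
      have "N x ** T c (ch x) = T c c0"
        unfolding N_def using cocycle[of c "ch x" c0] c c0 ch ne x by blast
      then have "matrix_inv (N x) ** T c c0 = matrix_inv (N x) ** (N x ** T c (ch x))" by simp
      also have "\<dots> = T c (ch x)" using detT ch c0 ne by (simp add: N_def matrix_inv_cancel)
      finally have eq: "matrix_inv (N x) ** T c c0 = T c (ch x)" .
      have "matrix_inv (E x) ** snd c x = mval x (T c (ch x))" "gl_at x (T c (ch x))"
        using T[of c "ch x" x] c ch x by (auto simp: E_def)
      then show ?thesis unfolding eq using nz[of "ch x" x] ch
        by (metis E_def matrix_inv_cancel(1))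
    qed
    then show ?thesis using op[OF c] unfolding chart_matrix_def by blast
  qed
  moreover have "\<forall>x. det (E x) \<noteq> 0" using nz ch by (simp add: E_def)
  ultimately have "models L N E" using cov by (simp add: models_def)
  then show ?thesis by blast
qed

lemma chart_matrix_frame:
  assumes "\<And>x. det (E x) \<noteq> 0" "chart_matrix N E c M"
  shows "frame c"
  using assms by (auto simp: frame_def chart_matrix_def invertible_det_nz det_mul gl_at_iff split: prod.splits)

lemma chart_matrix_compatible:
  assumes nz: "\<And>x. det (E x) \<noteq> 0" "\<And>x. det (N x) \<noteq> 0"
    and M: "chart_matrix N E c M" "chart_matrix N E c' M'"
  shows "compatible c c'"
proof -
  have *: "mat_regular_on (fst c \<inter> fst c') (\<lambda>x. matrix_inv (snd c' x) ** snd c x)"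
    if M: "chart_matrix N E c M" "chart_matrix N E c' M'" for c c' M M'
  proof -
    have op: "zariski_open (fst c \<inter> fst c')" using M by (simp add: chart_matrix_def zariski_open_Int)
    have "mreg x (matrix_inv M' ** mat 1 ** M) \<and>
        matrix_inv (snd c' x) ** mat 1 ** snd c x = mval x (matrix_inv M' ** mat 1 ** M)"
      if x: "x \<in> fst c \<inter> fst c'" for x
      by (rule iffD1[OF chart_transition[of x "N x" M _ "E x" "N x" M' _ "E x"]])
         (use M x nz val.mat_1 in \<open>auto simp: chart_matrix_def matrix_inv_right_left\<close>)
    then show ?thesis unfolding mat_regular_on_iff[OF op]
      by (intro exI[of _ "matrix_inv M' ** M"]) simp
  qed
  show ?thesis using *[OF M] *[OF M(2,1)] by (auto simp: compatible_def Int_commute split: prod.splits)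
qed

lemma models_nz: "models L N E \<Longrightarrow> det (N x) \<noteq> 0" "models L N E \<Longrightarrow> det (E x) \<noteq> 0"
  by (auto simp: models_def lattice_def)

lemma models_vector_bundle:
  assumes "models L N E"
  shows "vector_bundle L"
  unfolding vector_bundle_def
proof (intro conjI ballI)
  fix c assume "c \<in> L" then show "frame c"
    using assms chart_matrix_frame[of E N c] models_nz[OF assms] by (auto simp: models_def)
next
  show "(\<Union>(U, S)\<in>L. U) = UNIV" using assms by (simp add: models_def case_prod_unfold)
next
  fix c c' assume "c \<in> L" "c' \<in> L"
  then obtain M M' where "chart_matrix N E c M" "chart_matrix N E c' M'"
    using assms unfolding models_def by meson
  then show "compatible c c'" using chart_matrix_compatible models_nz[OF assms] by metis
qed

lemma chart_matrix_trivialization: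
  assumes "models L N E" "chart_matrix N E c M"
  shows "trivialization L c"
  unfolding trivialization_def
proof (intro conjI ballI)
  show "frame c" using chart_matrix_frame assms(2) models_nz[OF assms(1)] by metis
  fix c' assume "c' \<in> L"
  then obtain M' where "chart_matrix N E c' M'" using assms unfolding models_def by meson
  then show "compatible c c'" using chart_matrix_compatible models_nz[OF assms(1)] assms(2) by metis
qed

text \<open>A frame over \<open>fst c\<close> is a regular map from the trivial bundle, so
  \<open>models_regular_map\<close> already provides its rational matrix; invertibility of the frame
  makes that matrix a lattice basis.\<close>

lemma trivialization_chart_matrix:
  assumes "models L N E" "trivialization L c"
  shows "\<exists>M. chart_matrix N E c M"
proof -
  define L0 :: "'a vbundle" where "L0 = {(UNIV, \<lambda>_. mat 1)}"
  have op: "zariski_open (fst c)" and fr: "frame c"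
    using assms by (auto simp: trivialization_def frame_def split: prod.splits)
  have "chart_matrix (\<lambda>_. mat 1) (\<lambda>_. mat 1) (UNIV, \<lambda>_. mat 1) (mat 1)"
    by (simp add: chart_matrix_def zariski_open_def matrix_inv_mat_1 gl_at_mat_1 val.mat_1)
  then have m0: "models L0 (\<lambda>_. mat 1) (\<lambda>_. mat 1)"
    by (auto simp: L0_def models_def lattice_def)
  have "regular_map_on (fst c) L0 L (snd c)"
    using assms(2) unfolding regular_map_on_def L0_def trivialization_def compatible_def
    by (auto split: prod.splits)
  then obtain M where M: "\<And>x. x \<in> fst c \<Longrightarrow> mreg x (matrix_inv (N x) ** M) \<and>
      snd c x = E x ** mval x (matrix_inv (N x) ** M)"
    using models_regular_map[OF m0 assms(1) op] by (auto simp: matrix_inv_mat_1)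
  then have "gl_at x (matrix_inv (N x) ** M)" if "x \<in> fst c" for x
    using frame_det[OF fr that] M[OF that] by (auto simp: gl_at_iff det_mul)
  then show ?thesis unfolding chart_matrix_def using op M by blast
qed

text \<open>One chart for each point \<open>x\<close>: the basis \<open>N x\<close> is a frame on
  the open set where it spans the prescribed lattices, and \<open>x\<close> belongs to this set. The
  fibre at \<open>y\<close> is identified with coordinates in the basis \<open>N y\<close>, hence
  \<open>E\<close> is constantly \<open>mat 1\<close> for this bundle.\<close>

definition lattice_bundle :: "(p1 \<Rightarrow> ratfun^'n^'n) \<Rightarrow> 'n vbundle" where
  "lattice_bundle N = range (\<lambda>x. ({y. gl_at y (matrix_inv (N y) ** N x)}, \<lambda>y. mval y (matrix_inv (N y) ** N x)))"

lemma zariski_open_gl_at: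
  assumes "lattice N" "det M \<noteq> 0"
  shows "zariski_open {y. gl_at y (matrix_inv (N y) ** M)}"
proof -
  have "finite ({y. N y \<noteq> mat 1} \<union> {y. \<not> gl_at y M})"
    using assms finite_not_gl_at by (auto simp: lattice_def)
  moreover have "- {y. gl_at y (matrix_inv (N y) ** M)} \<subseteq> {y. N y \<noteq> mat 1} \<union> {y. \<not> gl_at y M}"
    by (auto simp: matrix_inv_mat_1)
  ultimately show ?thesis unfolding zariski_open_def using finite_subset by blast
qed

lemma models_lattice_bundle:
  assumes "lattice N"
  shows "models (lattice_bundle N) N (\<lambda>_. mat 1)"
  unfolding models_def
proof (intro conjI ballI)
  have nz: "det (N x) \<noteq> 0" for x using assms by (simp add: lattice_def)
  have "x \<in> (\<Union>c\<in>lattice_bundle N. fst c)" for x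
    unfolding lattice_bundle_def using nz[of x] by (auto simp: matrix_inv_right_left gl_at_mat_1 intro!: exI[of _ x])
  then show "(\<Union>c\<in>lattice_bundle N. fst c) = UNIV" by blast
  fix c assume "c \<in> lattice_bundle N"
  then obtain x where c: "c = ({y. gl_at y (matrix_inv (N y) ** N x)}, \<lambda>y. mval y (matrix_inv (N y) ** N x))"
    by (auto simp: lattice_bundle_def)
  show "\<exists>M. chart_matrix N (\<lambda>_. mat 1) c M"
    unfolding chart_matrix_def using zariski_open_gl_at[OF assms nz[of x]] c by (intro exI[of _ "N x"]) simp
qed (use assms in auto)

lemma inj_shift: "inj shift"
proof (rule injI)
  fix x y assume "shift x = shift y" then show "x = y" by (cases x; cases y) auto
qed

lemma zariski_open_shift: "zariski_open U \<Longrightarrow> zariski_open (shift -` U)"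
  using finite_vimageI[OF _ inj_shift, of "- U"] by (auto simp: zariski_open_def vimage_Compl)

text \<open>The pullback has at \<open>x\<close> the translate of the lattice at
  \<open>shift x\<close>, and its chart matrices are the translated ones. A d-connection thereby
  falls under \<open>models_regular_map\<close> like any other map of bundles.\<close>

lemma models_shift_pullback:
  assumes "models L N E"
  shows "models (shift_pullback L) (\<lambda>x. mtr (N (shift x))) (\<lambda>x. E (shift x))"
proof -
  note nz = models_nz[OF assms]
  have "lattice (\<lambda>x. mtr (N (shift x)))"
    unfolding lattice_def
  proof
    show "\<forall>x. det (mtr (N (shift x))) \<noteq> 0" using nz by (simp add: det_mtr)
    have "{x. mtr (N (shift x)) \<noteq> mat 1} \<subseteq> shift -` {x. N x \<noteq> mat 1}" by (auto simp: mtr_mat_1)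
    moreover have "finite (shift -` {x. N x \<noteq> mat 1})"
      using assms by (intro finite_vimageI inj_shift) (auto simp: models_def lattice_def)
    ultimately show "finite {x. mtr (N (shift x)) \<noteq> mat 1}" by (rule finite_subset)
  qed
  moreover have "\<exists>M. chart_matrix (\<lambda>x. mtr (N (shift x))) (\<lambda>x. E (shift x)) c M" if c: "c \<in> shift_pullback L" for c
  proof -
    obtain c' where c': "c' \<in> L" "c = (shift -` fst c', snd c' \<circ> shift)"
      using c by (force simp: shift_pullback_def)
    obtain M where M: "chart_matrix N E c' M" using assms c' by (auto simp: models_def)
    have "matrix_inv (mtr (N (shift x))) ** mtr M = mtr (matrix_inv (N (shift x)) ** M)" for x
      using nz by (simp add: mtr_mult mtr_inv)
    then show ?thesis using M c' unfolding chart_matrix_def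
      by (intro exI[of _ "mtr M"]) (auto simp: zariski_open_shift gl_at_mtr_iff mval_mtr gl_at_mreg)
  qed
  moreover have "(\<Union>c\<in>shift_pullback L. fst c) = UNIV"
  proof -
    have "\<exists>c\<in>L. shift x \<in> fst c" for x using assms UNIV_I[of "shift x"] unfolding models_def by blast
    then show ?thesis unfolding shift_pullback_def by force
  qed
  ultimately show ?thesis using nz by (auto simp: models_def)
qed

section \<open>Intertwiners\<close>

text \<open>The matrix of the connection in the lattice bases at \<open>x\<close> and
  \<open>shift x\<close>. The target basis is translated because everything is read in the
  coordinate of the source.\<close>

definition loc :: "(p1 \<Rightarrow> ratfun^'n^'n) \<Rightarrow> ratfun^'n^'n \<Rightarrow> p1 \<Rightarrow> ratfun^'n^'n" where
  "loc N A x = matrix_inv (mtr (N (shift x))) ** A ** N x"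

definition nonresonant :: "('i \<Rightarrow> complex) \<Rightarrow> bool" where
  "nonresonant a \<longleftrightarrow> (\<forall>i j. i \<noteq> j \<longrightarrow> a i - a j \<notin> \<int>)"

definition zeros_at :: "(p1 \<Rightarrow> ratfun^'n^'n) \<Rightarrow> ratfun^'n^'n \<Rightarrow> ('i \<Rightarrow> complex) \<Rightarrow> bool" where
  "zeros_at N A a \<longleftrightarrow> (\<forall>z. mreg (Fin z) (loc N A (Fin z))) \<and>
     (\<forall>z. z \<notin> range a \<longrightarrow> gl_at (Fin z) (loc N A (Fin z))) \<and>
     (\<forall>i. simple_zero (a i) (det (loc N A (Fin (a i)))))"

definition normal_form :: "('n \<Rightarrow> complex) \<Rightarrow> ('n \<Rightarrow> complex) \<Rightarrow> ratfun^'n^'n" where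
  "normal_form \<rho> d = (\<chi> i j. if i = j then cst (\<rho> i) * crd ^ 2 + cst (\<rho> i * d i) * crd else 0)"

text \<open>\<open>M\<close> ranges over all bases of the lattice at infinity, so the condition
  concerns the lattice and not the particular basis \<open>N Inf\<close>.\<close>

definition normal_at_Inf ::
    "(p1 \<Rightarrow> ratfun^'n^'n) \<Rightarrow> ratfun^'n^'n \<Rightarrow> ('n \<Rightarrow> complex) \<Rightarrow> ('n \<Rightarrow> complex) \<Rightarrow> bool" where
  "normal_at_Inf N A \<rho> d \<longleftrightarrow> (\<exists>M. gl_at Inf (matrix_inv (N Inf) ** M) \<and>
     mreg Inf (matrix_inv (mtr M) ** A ** M - normal_form \<rho> d))"

lemma finite_not_mreg_lattice:
  assumes "lattice N" "lattice N'"
  shows "finite {x. \<not> mreg x (matrix_inv (N' x) ** R ** N x)}"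
proof -
  have "finite ({x. N x \<noteq> mat 1} \<union> {x. N' x \<noteq> mat 1} \<union> {x. \<not> mreg x R})"
    using assms finite_not_mreg by (auto simp: lattice_def)
  moreover have "{x. \<not> mreg x (matrix_inv (N' x) ** R ** N x)} \<subseteq>
      {x. N x \<noteq> mat 1} \<union> {x. N' x \<noteq> mat 1} \<union> {x. \<not> mreg x R}"
    by (auto simp: matrix_inv_mat_1)
  ultimately show ?thesis by (rule finite_subset[rotated])
qed

text \<open>If both directions met \<open>range a\<close>, two values of \<open>a\<close> would
  differ by the positive integer \<open>n + Suc m\<close>. The offset matters: passing between
  \<open>z\<close> and \<open>z + 1\<close> is governed by the connection at \<open>z\<close>, so
  the forward progression starts at \<open>z\<close> itself and the backward one at
  \<open>z - 1\<close>.\<close>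

lemma nonresonant_progression:
  assumes "nonresonant a"
  shows "(\<forall>n::nat. z + of_nat n \<notin> range a) \<or> (\<forall>n::nat. z - of_nat (Suc n) \<notin> range a)"
proof (rule ccontr)
  assume "\<not> ?thesis"
  then obtain n m i j where "z + of_nat n = a i" "z - of_nat (Suc m) = a j" by (auto simp: image_iff)
  then have d: "a i - a j = of_nat (n + Suc m)" by (simp add: algebra_simps)
  then have "a i - a j \<in> \<int>" by (metis Ints_of_nat)
  then have "i = j" using assms by (auto simp: nonresonant_def)
  then show False using d by (metis add_is_0 diff_self nat.distinct(1) of_nat_eq_0_iff)
qed

lemma ex_notin_progression:
  assumes "finite X" "e \<noteq> 0"
  shows "\<exists>n::nat. z + of_nat n * e \<notin> (X :: complex set)"
proof (rule ccontr)
  assume "\<not> ?thesis"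
  then have "range (\<lambda>n::nat. z + of_nat n * e) \<subseteq> X" by auto
  moreover have "inj (\<lambda>n::nat. z + of_nat n * e)" using assms(2) by (auto simp: inj_def)
  ultimately show False using assms(1) finite_subset range_inj_infinite by blast
qed

lemma intertwiner_loc:
  assumes N: "lattice N" "lattice N'" and R: "mtr R ** A = A' ** R"
  shows "mtr (matrix_inv (N' (shift x)) ** R ** N (shift x)) ** loc N A x =
    loc N' A' x ** (matrix_inv (N' x) ** R ** N x)"
proof -
  have Nz: "det (N x) \<noteq> 0" "det (N' x) \<noteq> 0" for x using N by (auto simp: lattice_def)
  have "mtr (matrix_inv (N' (shift x)) ** R ** N (shift x)) ** loc N A x =
      matrix_inv (mtr (N' (shift x))) ** (mtr R ** A) ** N x"
    using Nz by (simp add: loc_def mtr_mult mtr_inv det_mtr matrix_group_simps)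
  also have "\<dots> = loc N' A' x ** (matrix_inv (N' x) ** R ** N x)"
    unfolding R using Nz by (simp add: loc_def matrix_group_simps)
  finally show ?thesis .
qed

text \<open>A pole of \<open>R\<close> at \<open>z\<close> forces one at \<open>z + 1\<close> and one at \<open>z - 1\<close> unless it crosses a zero of \<open>det A\<close>.
  Each coset of \<open>\<int>\<close> contains at most one such zero, so poles would propagate to infinity.\<close>

lemma intertwiner_regular:
  assumes N: "lattice N" "lattice N'" and nz: "det A \<noteq> 0" "det A' \<noteq> 0"
    and a: "nonresonant a" "zeros_at N A a" "zeros_at N' A' a" and R: "mtr R ** A = A' ** R"
  shows "mreg (Fin z) (matrix_inv (N' (Fin z)) ** R ** N (Fin z))"
proof -
  define T where "T = (\<lambda>z. matrix_inv (N' (Fin z)) ** R ** N (Fin z))"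
  have step: "mtr (T (z + 1)) ** loc N A (Fin z) = loc N' A' (Fin z) ** T z" for z
    using intertwiner_loc[OF N R, of "Fin z"] by (simp add: T_def)
  \<comment> \<open>Invertibility of the first connection at \<open>z\<close> carries regularity
    forward; carrying it backward uses invertibility of the second one.\<close>
  have up: "mreg (Fin (z + 1)) (T (z + 1))" if z: "z \<notin> range a" "mreg (Fin z) (T z)" for z
  proof -
    have gl: "gl_at (Fin z) (loc N A (Fin z))" using a z by (simp add: zeros_at_def)
    have "mtr (T (z + 1)) = mtr (T (z + 1)) ** loc N A (Fin z) ** matrix_inv (loc N A (Fin z))"
      by (simp add: matrix_inv_cancel[OF gl_at_det[OF gl]])
    also have "mreg (Fin z) \<dots>"
      unfolding step using a z gl by (intro mreg_mult gl_at_mreg gl_at_inv) (auto simp: zeros_at_def)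
    finally show ?thesis using mreg_mtr_iff[of "Fin z" "T (z + 1)"] by simp
  qed
  have down: "mreg (Fin z) (T z)" if z: "z \<notin> range a" "mreg (Fin (z + 1)) (T (z + 1))" for z
  proof -
    have gl: "gl_at (Fin z) (loc N' A' (Fin z))" using a z by (simp add: zeros_at_def)
    have "T z = matrix_inv (loc N' A' (Fin z)) ** (loc N' A' (Fin z) ** T z)"
      by (simp add: matrix_inv_cancel[OF gl_at_det[OF gl]])
    also have "mreg (Fin z) \<dots>"
      unfolding step[symmetric] using a z mreg_mtr_iff[of "Fin z" "T (z + 1)"]
      by (intro mreg_mult gl_at_mreg[OF gl_at_inv[OF gl]]) (auto simp: zeros_at_def)
    finally show ?thesis .
  qed
  have fin: "finite {z. \<not> mreg (Fin z) (T z)}"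
    using finite_not_mreg_lattice[OF N, of R] finite_p1_iff[of "{x. \<not> mreg x (matrix_inv (N' x) ** R ** N x)}"]
    by (simp add: T_def)
  have "mreg (Fin z) (T z)"
    using nonresonant_progression[OF a(1), of z]
  proof
    assume *: "\<forall>n::nat. z + of_nat n \<notin> range a"
    \<comment> \<open>There are finitely many poles, so regularity holds somewhere along the
      progression that avoids \<open>range a\<close>; the induction transports it back to
      \<open>z\<close>.\<close>
    obtain n where "mreg (Fin (z + of_nat n)) (T (z + of_nat n))"
      using ex_notin_progression[OF fin, of 1 z] by auto
    then show ?thesis
    proof (induction n)
      case (Suc n)
      then show ?case using * down[of "z + of_nat n"] by (simp add: add_ac)
    qed simp
  next
    assume *: "\<forall>n::nat. z - of_nat (Suc n) \<notin> range a"
    obtain n where "mreg (Fin (z - of_nat n)) (T (z - of_nat n))"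
      using ex_notin_progression[OF fin, of "- 1" z] by auto
    then show ?thesis
    proof (induction n)
      case (Suc n)
      have "z - of_nat (Suc n) + 1 = z - of_nat n" by simp
      then show ?case using * Suc up[of "z - of_nat (Suc n)"] by metis
    qed simp
  qed
  then show ?thesis by (simp add: T_def)
qed

section \<open>Expansions in powers of 1/z at infinity\<close>

lemma val_0_if_reg_crd_mult:
  assumes "reg_at Inf (crd * p)"
  shows "reg_at Inf p" "val Inf p = 0"
proof -
  have eq: "inverse crd * (crd * p) = p" by simp
  show "reg_at Inf p" "val Inf p = 0"
    using reg_at_mult_val[OF reg_at_inverse_crd_val(1) assms] unfolding eq
    by (auto simp: reg_at_inverse_crd_val)
qed

lemma reg_crd_mult_if_val_0:
  assumes "reg_at Inf p" "val Inf p = 0"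
  shows "reg_at Inf (crd * p)"
proof -
  obtain n r q where p: "p = Fract r q" "degree r \<le> n" "degree q \<le> n" "homog_eval n q Inf \<noteq> 0"
    "val Inf p = homog_eval n r Inf / homog_eval n q Inf" using assms(1) by (rule reg_atE)
  have "coeff r n = 0" using p assms by simp
  then have "degree r < n \<or> r = 0" using p(2) by (metis le_neq_implies_less leading_coeff_0_iff)
  then have "degree ([:0, 1:] * r) \<le> n" using degree_mult_le[of "[:0,1:]" r] by auto
  then show ?thesis using reg_at_Fract[of "[:0, 1:] * r" n q Inf] p by (simp add: crd_def)
qed

lemma reg_at_cancel_cst: "c \<noteq> 0 \<Longrightarrow> reg_at x (cst c * r) \<Longrightarrow> reg_at x r"
proof -
  assume "c \<noteq> 0" "reg_at x (cst c * r)"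
  then have "reg_at x (cst (inverse c) * (cst c * r))"
    using reg_at_mult_val reg_at_cst_val by blast
  moreover have "cst (inverse c) * cst c = 1"
    using \<open>c \<noteq> 0\<close> cst_simps(4)[of "inverse c" c] by (simp add: cst_simps(2))
  ultimately show "reg_at x r" by (simp flip: mult.assoc)
qed

lemma crd_plus_1_nonzero: "crd + 1 \<noteq> 0"
  using tr_eq_0_iff[of 1 crd] by (simp add: tr_crd cst_simps)

lemma tr_1_crd: "tr 1 crd = crd + 1"
  by (simp add: tr_crd cst_simps)

lemma reg_crd_div: "reg_at Inf (crd / (crd + 1))" "val Inf (crd / (crd + 1)) = 1"
proof -
  have "reg_at Inf (1 + inverse crd)" "val Inf (1 + inverse crd) = 1"
    by (simp_all add: val_simps reg_at_intros)
  moreover have "crd / (crd + 1) = inverse (1 + inverse crd)"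
    using crd_plus_1_nonzero by (simp add: field_simps)
  ultimately show "reg_at Inf (crd / (crd + 1))" "val Inf (crd / (crd + 1)) = 1"
    by (simp_all add: reg_at_inverse_val)
qed

text \<open>Write \<open>p = c + q/z\<close> with \<open>q\<close> regular. Then z^2 times the
  difference equals \<open>z (q(z+1) - q(z)) - z/(z+1) q(z+1)\<close>, and
  \<open>q(z+1) - q(z)\<close> vanishes at infinity.\<close>

lemma reg_tr_diff:
  assumes "reg_at Inf p"
  shows "reg_at Inf (crd ^ 2 * (tr 1 p - p))"
proof -
  define c q where "c = val Inf p" and "q = crd * (p - cst c)"
  have q: "reg_at Inf q" unfolding q_def c_def
    using assms by (intro reg_crd_mult_if_val_0) (simp_all add: val_simps reg_at_intros)
  have p: "p = cst c + inverse crd * q" unfolding q_def by (simp flip: mult.assoc)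
  have tq: "reg_at Inf (tr 1 q)" "val Inf (tr 1 q) = val Inf q"
    using reg_at_tr_val[of 1 Inf q] q by simp_all
  have "tr 1 p = cst c + inverse (crd + 1) * tr 1 q"
    by (subst p) (simp only: tr_add tr_mult tr_inverse tr_1_crd tr_cst)
  then have dp: "tr 1 p - p = inverse (crd + 1) * tr 1 q - inverse crd * q"
    by (subst (2) p) simp
  have "crd ^ 2 * (tr 1 p - p) = crd * (tr 1 q - q) - crd / (crd + 1) * tr 1 q"
  proof -
    define s where "s = crd + 1"
    have s: "s \<noteq> 0" "crd = s - 1" using crd_plus_1_nonzero by (simp_all add: s_def)
    have "crd ^ 2 * inverse s = crd - crd / s"
      unfolding s(2) using s(1) by (simp add: field_simps power2_eq_square)
    moreover have "crd ^ 2 * (inverse s * tr 1 q - inverse crd * q) =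
        crd ^ 2 * inverse s * tr 1 q - crd * q"
      by (simp add: right_diff_distrib power2_eq_square)
    ultimately show ?thesis unfolding dp s_def[symmetric] by (simp only:) (simp add: algebra_simps)
  qed
  moreover have "reg_at Inf (crd * (tr 1 q - q))"
    using q tq by (intro reg_crd_mult_if_val_0) (simp_all add: val_simps reg_at_intros)
  moreover have "reg_at Inf (crd / (crd + 1) * tr 1 q)"
    using reg_at_mult_val[OF reg_crd_div(1) tq(1)] by blast
  ultimately show ?thesis using reg_at_diff_val by metis
qed

text \<open>This is \<open>(1 + 1/z)^n = 1 + n/z + O(z^-2)\<close>. Passing from \<open>n\<close> to
  \<open>Suc n\<close> multiplies the scaled remainder by \<open>1 + 1/z\<close> and adds exactly
  the constant \<open>n\<close>.\<close>

lemma reg_binomial_expansion: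
  "reg_at Inf (crd ^ 2 * ((1 + inverse crd) ^ n - 1 - cst (of_nat n) * inverse crd))"
proof (induction n)
  case 0
  show ?case by (simp add: cst_simps reg_at_intros)
next
  case (Suc n)
  have "crd ^ 2 * ((1 + inverse crd) ^ Suc n - 1 - cst (of_nat (Suc n)) * inverse crd) =
      crd ^ 2 * ((1 + inverse crd) ^ n - 1 - cst (of_nat n) * inverse crd) * (1 + inverse crd) + cst (of_nat n)"
    by (simp add: cst_simps field_simps power2_eq_square)
  then show ?case using Suc by (auto intro!: reg_at_intros)
qed

lemma ex_reg_pole_order: "\<exists>n. reg_at Inf (inverse crd ^ n * r)"
proof (cases r)
  case (Fract p q)
  define n where "n = degree p"
  have "reg_at Inf (Fract p ([:0, 1:] ^ n * q))"
  proof (rule reg_at_Fract)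
    have d: "degree ([:0, 1:] ^ n * q) = n + degree q"
      using Fract by (simp add: degree_mult_eq degree_power_eq)
    then show "degree ([:0, 1:] ^ n * q) \<le> n + degree q" "degree p \<le> n + degree q" by (simp_all add: n_def)
    have "coeff ([:0, 1:] ^ n * q) (degree ([:0, 1:] ^ n * q)) \<noteq> 0" using Fract by simp
    then show "homog_eval (n + degree q) ([:0, 1:] ^ n * q) Inf \<noteq> 0" unfolding d by simp
  qed
  moreover have "inverse crd ^ n = Fract 1 ([:0, 1:] ^ n)"
    by (induction n) (auto simp: crd_def One_fract_def)
  ultimately show ?thesis using Fract by (intro exI[of _ n]) simp
qed

lemma reg_at_power_mult_mono:
  assumes "reg_at Inf (inverse crd ^ n * r)" "n \<le> m"
  shows "reg_at Inf (inverse crd ^ m * r)"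
proof -
  have "inverse crd ^ m * r = inverse crd ^ (m - n) * (inverse crd ^ n * r)"
    using assms(2) by (simp flip: power_add mult.assoc)
  also have "reg_at Inf \<dots>"
    by (rule reg_at_mult_val[OF reg_at_power_val[OF reg_at_inverse_crd_val(1), THEN conjunct1] assms(1), THEN conjunct1])
  finally show ?thesis .
qed

lemma ex_mreg_pole_order: 
  fixes R :: "ratfun^'n^'m"
  shows "\<exists>n. mreg Inf (\<chi> i j. inverse crd ^ n * R $ i $ j)"
proof -
  have "\<forall>i j. \<exists>n. reg_at Inf (inverse crd ^ n * R $ i $ j)" using ex_reg_pole_order by blast
  then obtain n where n: "\<And>i j. reg_at Inf (inverse crd ^ n i j * R $ i $ j)" by metis
  define m where "m = Max (range (\<lambda>(i, j). n i j))"
  have "n i j \<le> m" for i j unfolding m_def by (rule Max_ge) (auto intro: image_eqI[of _ _ "(i, j)"])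
  then show ?thesis using reg_at_power_mult_mono[OF n] by (auto simp: val.mdom_def intro!: exI[of _ m])
qed

text \<open>Equality up to O(1) at infinity, the precision to which the normal form is prescribed.
  It can be multiplied by functions regular at infinity.\<close>

definition cong_Inf :: "ratfun \<Rightarrow> ratfun \<Rightarrow> bool" (infix "\<approx>\<^sub>\<infinity>" 50) where
  "r \<approx>\<^sub>\<infinity> s \<longleftrightarrow> reg_at Inf (r - s)"

lemma cong_Inf_refl [simp]: "r \<approx>\<^sub>\<infinity> r"
  by (simp add: cong_Inf_def reg_at_0_1_val)

lemma cong_Inf_sym: "r \<approx>\<^sub>\<infinity> s \<Longrightarrow> s \<approx>\<^sub>\<infinity> r"
  unfolding cong_Inf_def using reg_at_uminus_val[of Inf "r - s"] by simp

lemma cong_Inf_trans [trans]: "r \<approx>\<^sub>\<infinity> s \<Longrightarrow> s \<approx>\<^sub>\<infinity> t \<Longrightarrow> r \<approx>\<^sub>\<infinity> t"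
  unfolding cong_Inf_def using reg_at_add_val[of Inf "r - s" "s - t"] by simp

lemma cong_Inf_add: "r \<approx>\<^sub>\<infinity> s \<Longrightarrow> r' \<approx>\<^sub>\<infinity> s' \<Longrightarrow> r + r' \<approx>\<^sub>\<infinity> s + s'"
  unfolding cong_Inf_def using reg_at_add_val[of Inf "r - s" "r' - s'"] by (simp add: algebra_simps)

lemma cong_Inf_diff: "r \<approx>\<^sub>\<infinity> s \<Longrightarrow> r' \<approx>\<^sub>\<infinity> s' \<Longrightarrow> r - r' \<approx>\<^sub>\<infinity> s - s'"
  unfolding cong_Inf_def using reg_at_diff_val[of Inf "r - s" "r' - s'"] by (simp add: algebra_simps)

lemma cong_Inf_mult: "reg_at Inf u \<Longrightarrow> r \<approx>\<^sub>\<infinity> s \<Longrightarrow> u * r \<approx>\<^sub>\<infinity> u * s"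
  unfolding cong_Inf_def using reg_at_mult_val[of Inf u "r - s"] by (simp add: algebra_simps)

lemma cong_Inf_sum: "(\<And>i. i \<in> I \<Longrightarrow> f i \<approx>\<^sub>\<infinity> g i) \<Longrightarrow> sum f I \<approx>\<^sub>\<infinity> sum g I"
  by (induction I rule: infinite_finite_induct) (auto intro: cong_Inf_add)

lemma cong_Inf_0_iff: "r \<approx>\<^sub>\<infinity> 0 \<longleftrightarrow> reg_at Inf r"
  by (simp add: cong_Inf_def)

lemma cong_Inf_if_reg: "reg_at Inf r \<Longrightarrow> r \<approx>\<^sub>\<infinity> 0"
  by (simp add: cong_Inf_def)

lemma normal_form_nth: "normal_form \<rho> d $ i $ j = (if i = j then cst (\<rho> i) * crd ^ 2 + cst (\<rho> i * d i) * crd else 0)"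
  by (simp add: normal_form_def)

lemma mreg_diff_iff: "mreg Inf (B - C) \<longleftrightarrow> (\<forall>i j. B $ i $ j \<approx>\<^sub>\<infinity> C $ i $ j)"
  by (simp add: val.mdom_def cong_Inf_def)

text \<open>A matrix with this normal form is O(z^2), so an error O(z^-2) in another factor costs
  only O(1).\<close>

lemma reg_t2_normal:
  fixes B :: "ratfun^'n^'n"
  assumes "mreg Inf (B - normal_form \<rho> d)"
  shows "reg_at Inf (inverse crd ^ 2 * B $ k $ j)"
proof -
  have "inverse crd ^ 2 * normal_form \<rho> d $ k $ j = (if k = j then cst (\<rho> k) + cst (\<rho> k * d k) * inverse crd else 0)"
    by (simp add: normal_form_nth field_simps power2_eq_square)
  then have "reg_at Inf (inverse crd ^ 2 * normal_form \<rho> d $ k $ j)" by (auto intro!: reg_at_intros)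
  moreover have "reg_at Inf (inverse crd ^ 2 * (B $ k $ j - normal_form \<rho> d $ k $ j))"
    using assms unfolding val.mdom_def by (intro reg_at_intros(2)) (simp_all add: power2_eq_square reg_at_intros)
  ultimately have "reg_at Inf (inverse crd ^ 2 * (B $ k $ j - normal_form \<rho> d $ k $ j) +
      inverse crd ^ 2 * normal_form \<rho> d $ k $ j)" by (intro reg_at_intros(1))
  then show ?thesis by (simp add: algebra_simps)
qed

text \<open>Comparing the two leading coefficients of \<open>\<sigma>(R) B = B' R\<close> for \<open>R = R\<^sub>0 z\<^sup>n + \<dots>\<close>: the first
  makes \<open>R\<^sub>0\<close> diagonal because the \<open>\<rho>\<^sub>i\<close> are distinct, the second then reads \<open>n \<rho> R\<^sub>0 = 0\<close>.\<close>

lemma intertwiner_regular_Inf: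
  fixes R B B' :: "ratfun^'n^'n"
  assumes \<rho>: "inj \<rho>" "\<And>i. \<rho> i \<noteq> 0"
    and B: "mreg Inf (B - normal_form \<rho> d)" and B': "mreg Inf (B' - normal_form \<rho> d)"
    and R: "mtr R ** B = B' ** R"
  shows "mreg Inf R"
proof (rule ccontr)
  assume nreg: "\<not> mreg Inf R"
  define P where "P = (\<lambda>n i j. inverse crd ^ n * R $ i $ j)"
  \<comment> \<open>The pole order of \<open>R\<close> at infinity. Once \<open>P n\<close> is shown
    to vanish there, \<open>n - 1\<close> does as well, against minimality.\<close>
  define n where "n = (LEAST n. mreg Inf (\<chi> i j. P n i j))"
  have "mreg Inf (\<chi> i j. P n i j)"
    unfolding n_def by (rule LeastI_ex) (use ex_mreg_pole_order[of R] in \<open>simp add: P_def\<close>)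
  then have P: "reg_at Inf (P n i j)" for i j by (simp add: val.mdom_def)
  have "n \<noteq> 0"
  proof
    assume "n = 0" then show False using nreg P by (simp add: P_def val.mdom_def)
  qed
  then obtain k where k: "n = Suc k" by (cases n) auto
  have RP: "R $ i $ j = crd ^ n * P n i j" for i j by (simp add: P_def power_inverse)
  define t where "t = inverse crd"
  define c where "c = cst (of_nat n)"
  have regt: "reg_at Inf t" "reg_at Inf c" by (simp_all add: t_def c_def reg_at_intros)
  have ct: "crd * t = 1" by (simp add: t_def)
  \<comment> \<open>\<open>R(z+1)\<close> is \<open>z^n ((1 + n/z) P + O(z^-2))\<close>, and the
    error is absorbed because \<open>B = O(z^2)\<close>.\<close>
  have lead: "inverse crd ^ n * tr 1 (R $ i $ k) * B $ k $ j \<approx>\<^sub>\<infinity> (1 + c * t) * P n i k * B $ k $ j" for i j k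
  proof -
    define p where "p = P n i k"
    define f where "f = crd ^ 2 * (tr 1 p - p)"
    define e where "e = crd ^ 2 * ((1 + t) ^ n - 1 - c * t)"
    have f: "reg_at Inf f" unfolding f_def p_def by (rule reg_tr_diff[OF P])
    have e: "reg_at Inf e" unfolding e_def t_def c_def by (rule reg_binomial_expansion)
    have c2: "t ^ 2 * crd ^ 2 = 1" using ct by (simp add: power2_eq_square algebra_simps)
    have trp: "tr 1 p = p + t ^ 2 * f"
      unfolding f_def using c2 by (simp add: mult.assoc[symmetric])
    have pw: "(1 + t) ^ n = 1 + c * t + t ^ 2 * e"
      unfolding e_def using c2 by (simp add: mult.assoc[symmetric])
    have "tr 1 (R $ i $ k) = (crd + 1) ^ n * tr 1 p"
    proof -
      have "tr 1 (crd ^ n) = (crd + 1) ^ n" by (induction n) (simp_all add: tr_mult tr_1_crd)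
      then show ?thesis by (simp add: RP tr_mult p_def)
    qed
    moreover have "inverse crd ^ n * (crd + 1) ^ n = (1 + t) ^ n"
      using ct by (simp add: t_def distrib_left flip: power_mult_distrib)
    ultimately have "inverse crd ^ n * tr 1 (R $ i $ k) * B $ k $ j = (1 + t) ^ n * tr 1 p * B $ k $ j"
      by (simp flip: mult.assoc)
    also have "\<dots> = (1 + c * t) * p * B $ k $ j + (e * (p + t ^ 2 * f) + (1 + c * t) * f) * (t ^ 2 * B $ k $ j)"
      unfolding trp pw by (simp add: algebra_simps)
    also have "\<dots> \<approx>\<^sub>\<infinity> (1 + c * t) * p * B $ k $ j"
    proof -
      have "reg_at Inf ((e * (p + t ^ 2 * f) + (1 + c * t) * f) * (t ^ 2 * B $ k $ j))"
        by (rule reg_at_intros(2)[OF _ reg_t2_normal[OF B, of k j, folded t_def]])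
           (use e f P[of i k] regt in \<open>simp add: p_def power2_eq_square reg_at_intros\<close>)
      then show ?thesis by (simp add: cong_Inf_def)
    qed
    finally show ?thesis by (simp add: p_def)
  qed
  \<comment> \<open>Off the diagonal \<open>B\<close> and \<open>B'\<close> are O(1), so each matrix
    product collapses to its diagonal term.\<close>
  have eq: "(1 + c * t) * P n i j * normal_form \<rho> d $ j $ j \<approx>\<^sub>\<infinity> normal_form \<rho> d $ i $ i * P n i j" for i j
  proof -
    have "(1 + c * t) * P n i j * normal_form \<rho> d $ j $ j = (\<Sum>k\<in>UNIV. (1 + c * t) * P n i k * normal_form \<rho> d $ k $ j)"
      by (subst sum.remove[of _ j]) (simp_all add: normal_form_nth)
    also have "\<dots> \<approx>\<^sub>\<infinity> (\<Sum>k\<in>UNIV. (1 + c * t) * P n i k * B $ k $ j)"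
      using B P regt by (intro cong_Inf_sum cong_Inf_mult cong_Inf_sym[of "B $ _ $ _"])
        (simp_all add: mreg_diff_iff reg_at_intros)
    also have "\<dots> \<approx>\<^sub>\<infinity> (\<Sum>k\<in>UNIV. inverse crd ^ n * tr 1 (R $ i $ k) * B $ k $ j)"
      by (intro cong_Inf_sum cong_Inf_sym[OF lead])
    also have "\<dots> = inverse crd ^ n * (mtr R ** B) $ i $ j"
      by (simp add: matrix_matrix_mult_def sum_distrib_left mult.assoc)
    also have "\<dots> = (\<Sum>k\<in>UNIV. P n k j * B' $ i $ k)"
      unfolding R by (simp add: matrix_matrix_mult_def sum_distrib_left P_def mult_ac)
    also have "\<dots> \<approx>\<^sub>\<infinity> (\<Sum>k\<in>UNIV. P n k j * normal_form \<rho> d $ i $ k)"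
      using B' P by (intro cong_Inf_sum cong_Inf_mult) (simp_all add: mreg_diff_iff)
    also have "\<dots> = normal_form \<rho> d $ i $ i * P n i j"
      by (subst sum.remove[of _ i]) (simp_all add: normal_form_nth mult.commute)
    finally show ?thesis .
  qed
  have v0: "val Inf (P n i j) = 0" for i j
  proof -
    define p where "p = P n i j"
    have p: "reg_at Inf p" using P by (simp add: p_def)
    have "(1 + c * t) * p * normal_form \<rho> d $ j $ j - normal_form \<rho> d $ i $ i * p =
      ((1 + c * t) * (cst (\<rho> j) * crd ^ 2 + cst (\<rho> j * d j) * crd) - (cst (\<rho> i) * crd ^ 2 + cst (\<rho> i * d i) * crd)) * p"
      by (simp add: normal_form_nth algebra_simps)
    also have "(1 + c * t) * (cst (\<rho> j) * crd ^ 2 + cst (\<rho> j * d j) * crd) =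
      cst (\<rho> j) * crd ^ 2 + cst (\<rho> j * d j) * crd + c * (crd * t) * (cst (\<rho> j) * crd + cst (\<rho> j * d j))"
      by (simp add: algebra_simps power2_eq_square)
    finally have *: "reg_at Inf ((cst (\<rho> j) * crd ^ 2 + cst (\<rho> j * d j) * crd + c * (cst (\<rho> j) * crd + cst (\<rho> j * d j))
       - (cst (\<rho> i) * crd ^ 2 + cst (\<rho> i * d i) * crd)) * p)"
      using eq[of i j] unfolding ct cong_Inf_def by (simp add: p_def)
    show ?thesis
    proof (cases "i = j")
      case True
      \<comment> \<open>For equal indices the two normal form entries cancel. What the translation
        of z^n leaves is \<open>n * \<rho> j * crd * p\<close> plus a regular term, and the
        coefficient is nonzero.\<close>
      have "reg_at Inf ((c * (cst (\<rho> j) * crd + cst (\<rho> j * d j))) * p - c * cst (\<rho> j * d j) * p)"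
        using * True p regt by (intro reg_at_intros(4)) (simp_all add: reg_at_intros)
      also have "(c * (cst (\<rho> j) * crd + cst (\<rho> j * d j))) * p - c * cst (\<rho> j * d j) * p = cst (of_nat n * \<rho> j) * (crd * p)"
        by (simp add: c_def cst_simps algebra_simps)
      finally have "reg_at Inf (crd * p)"
        by (rule reg_at_cancel_cst[rotated]) (use \<rho> \<open>n \<noteq> 0\<close> in simp)
      then show ?thesis using val_0_if_reg_crd_mult by (simp add: p_def)
    next
      case False
      \<comment> \<open>After division by z the leading part is
        \<open>(\<rho> j - \<rho> i) * crd * p\<close>; \<open>w\<close> collects the rest, which is
        regular.\<close>
      define w where "w = (cst (\<rho> j * d j) + c * (cst (\<rho> j) + t * cst (\<rho> j * d j)) - cst (\<rho> i * d i)) * p"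
      have w: "reg_at Inf w" unfolding w_def using p regt by (simp add: reg_at_intros)
      have "reg_at Inf (t * ((cst (\<rho> j) * crd ^ 2 + cst (\<rho> j * d j) * crd + c * (cst (\<rho> j) * crd + cst (\<rho> j * d j))
       - (cst (\<rho> i) * crd ^ 2 + cst (\<rho> i * d i) * crd)) * p) - w)"
        by (rule reg_at_intros(4)[OF reg_at_intros(2)[OF regt(1) *] w])
      also have "t * ((cst (\<rho> j) * crd ^ 2 + cst (\<rho> j * d j) * crd + c * (cst (\<rho> j) * crd + cst (\<rho> j * d j))
       - (cst (\<rho> i) * crd ^ 2 + cst (\<rho> i * d i) * crd)) * p) =
         (crd * t) * ((cst (\<rho> j) * crd + cst (\<rho> j * d j) + c * cst (\<rho> j)
            - (cst (\<rho> i) * crd + cst (\<rho> i * d i))) * p) + t * (c * cst (\<rho> j * d j)) * p"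
        by (simp add: algebra_simps power2_eq_square)
      also have "(crd * t) * ((cst (\<rho> j) * crd + cst (\<rho> j * d j) + c * cst (\<rho> j)
            - (cst (\<rho> i) * crd + cst (\<rho> i * d i))) * p) + t * (c * cst (\<rho> j * d j)) * p - w = cst (\<rho> j - \<rho> i) * (crd * p)"
        unfolding ct by (simp add: w_def cst_simps algebra_simps)
      finally have "reg_at Inf (crd * p)"
        by (rule reg_at_cancel_cst[rotated]) (use \<rho> False in \<open>simp add: inj_eq\<close>)
      then show ?thesis using val_0_if_reg_crd_mult by (simp add: p_def)
    qed
  qed
  have "reg_at Inf (P k i j)" for i j
  proof -
    have "P k i j = crd * P n i j" by (simp add: P_def k)
    then show ?thesis using reg_crd_mult_if_val_0[OF P v0] by simp
  qed
  then have "mreg Inf (\<chi> i j. P k i j)" by (simp add: val.mdom_def)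
  then have "n \<le> k" unfolding n_def by (rule Least_le)
  then show False using k by simp
qed

section \<open>Shifting the parameters\<close>

lemma normal_at_Inf_cong: "N Inf = N' Inf \<Longrightarrow> normal_at_Inf N A \<rho> d \<longleftrightarrow> normal_at_Inf N' A \<rho> d"
  by (simp add: normal_at_Inf_def)

lemma lattice_upd: "lattice N \<Longrightarrow> det M \<noteq> 0 \<Longrightarrow> lattice (N(x := M))"
proof -
  assume *: "lattice N" "det M \<noteq> 0"
  have "{y. (N(x := M)) y \<noteq> mat 1} \<subseteq> insert x {y. N y \<noteq> mat 1}" by auto
  then have "finite {y. (N(x := M)) y \<noteq> mat 1}"
    by (rule finite_subset) (use * in \<open>simp add: lattice_def\<close>)
  then show ?thesis using * by (simp add: lattice_def)
qed

lemma nonresonant_upd: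
  assumes "nonresonant a" "e \<in> \<int>"
  shows "nonresonant (a(i := a i + e))"
proof -
  have "a j - a k \<in> \<int>" if *: "(a(i := a i + e)) j - (a(i := a i + e)) k \<in> \<int>" for j k
  proof -
    define f where "f = (if k = i then e else 0) - (if j = i then e else 0)"
    have "f \<in> \<int>" using assms(2) by (simp add: f_def)
    moreover have "a j - a k = (a(i := a i + e)) j - (a(i := a i + e)) k + f" by (auto simp: f_def)
    ultimately show ?thesis using * by (metis Ints_add)
  qed
  then show ?thesis using assms(1) unfolding nonresonant_def by blast
qed

lemma mtr_mtr_inverse: "mtr (map_matrix (tr (- 1)) M) = M" "map_matrix (tr (- 1)) (mtr M) = M"
  by (simp_all add: vec_eq_iff tr_tr tr_by_0)

lemma nonresonant_plus_1:
  assumes "nonresonant a"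
  shows "a i + 1 \<notin> range a" "a i - 1 \<notin> range a"
proof -
  have "a j \<noteq> a i + e" if "e = 1 \<or> e = - 1" for j and e :: complex
  proof
    assume *: "a j = a i + e"
    then have "j \<noteq> i" using that by auto
    then have "a j - a i \<notin> \<int>" using assms by (auto simp: nonresonant_def)
    then show False using * that by auto
  qed
  from this[of 1] this[of "- 1"] show "a i + 1 \<notin> range a" "a i - 1 \<notin> range a" by (force simp: image_iff)+
qed

text \<open>The lattice at \<open>a i + 1\<close> enters \<open>loc\<close> at \<open>a i\<close>,
  as target, and at \<open>a i + 1\<close>, as source. With the new basis the former becomes
  \<open>mat 1\<close>, and the latter becomes the old matrix there, invertible by nonresonance,
  times the translate of the old matrix at \<open>a i\<close>. So the simple zero is carried over
  intact.\<close>

lemma zeros_at_shift_up: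
  fixes a :: "'i \<Rightarrow> complex" and i :: 'i
  assumes N: "lattice N" and nz: "det A \<noteq> 0" and a: "nonresonant a" "zeros_at N A a"
  defines "M \<equiv> map_matrix (tr (- 1)) (A ** N (Fin (a i)))"
  shows "lattice (N(Fin (a i + 1) := M))" "zeros_at (N(Fin (a i + 1) := M)) A (a(i := a i + 1))"
proof -
  define b where "b = a i"
  define N' where "N' = N(Fin (b + 1) := M)"
  have Nz: "det (N x) \<noteq> 0" for x using N by (simp add: lattice_def)
  show "lattice (N(Fin (a i + 1) := M))"
    using N nz Nz by (intro lattice_upd) (simp_all add: M_def det_mtr det_mul)
  have loc0: "loc N' A (Fin b) = mat 1"
    using nz Nz by (simp add: loc_def N'_def M_def b_def mtr_mtr_inverse matrix_group_simps)
  have loc1: "loc N' A (Fin (b + 1)) = loc N A (Fin (b + 1)) ** map_matrix (tr (- 1)) (loc N A (Fin b))"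
  proof -
    have "map_matrix (tr (- 1)) (loc N A (Fin b)) = matrix_inv (N (Fin (b + 1))) ** M"
      using Nz by (simp add: loc_def M_def b_def mtr_mult mtr_inv det_mtr mtr_mtr_inverse matrix_group_simps)
    then show ?thesis using Nz by (simp add: loc_def N'_def matrix_group_simps)
  qed
  have loc2: "loc N' A (Fin z) = loc N A (Fin z)" if "z \<noteq> b" "z \<noteq> b + 1" for z
    using that by (simp add: loc_def N'_def)
  have nr: "b + 1 \<notin> range a" using nonresonant_plus_1[OF a(1)] by (simp add: b_def)
  have inj: "a j \<noteq> b" if "j \<noteq> i" for j
    using a(1) that unfolding nonresonant_def b_def by (metis Ints_0 diff_self)
  have gl1: "gl_at (Fin (b + 1)) (loc N A (Fin (b + 1)))" using a nr by (simp add: zeros_at_def)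
  have "p1_shift (- 1) (Fin (b + 1)) = Fin b" by simp
  then have reg1: "mreg (Fin (b + 1)) (map_matrix (tr (- 1)) (loc N A (Fin b)))"
    using a by (auto simp: zeros_at_def val.mdom_def reg_at_tr_iff)
  have "zeros_at N' A (a(i := b + 1))"
    unfolding zeros_at_def
  proof (intro conjI allI impI)
    show "mreg (Fin z) (loc N' A (Fin z))" for z
    proof -
      consider "z = b" | "z = b + 1" | "z \<noteq> b" "z \<noteq> b + 1" by blast
      then show ?thesis
      proof cases
        case 2
        then show ?thesis using loc1 gl1 reg1 by (simp add: mreg_mult gl_at_mreg)
      qed (use loc0 loc2 a in \<open>simp_all add: val.mat_1 zeros_at_def\<close>)
    qed
  next
    fix z assume z: "z \<notin> range (a(i := b + 1))"
    then have zb: "z \<noteq> b + 1" by (metis fun_upd_same rangeI)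
    show "gl_at (Fin z) (loc N' A (Fin z))"
    proof (cases "z = b")
      case False
      have "z \<notin> range a"
      proof
        assume "z \<in> range a"
        then obtain j where "z = a j" by blast
        with False have "j \<noteq> i" by (auto simp: b_def)
        with \<open>z = a j\<close> have "z = (a(i := b + 1)) j" by simp
        with z show False by blast
      qed
      then show ?thesis using loc2[OF False zb] a by (simp add: zeros_at_def)
    qed (simp add: loc0 gl_at_mat_1)
  next
    fix j
    show "simple_zero ((a(i := b + 1)) j) (det (loc N' A (Fin ((a(i := b + 1)) j))))"
    proof (cases "j = i")
      case True
      have "simple_zero (b + 1) (tr (- 1) (det (loc N A (Fin b))))"
        by (rule simple_zero_tr) (use a in \<open>simp add: zeros_at_def b_def\<close>)
      then have "simple_zero (b + 1) (det (loc N' A (Fin (b + 1))))"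
        unfolding loc1 det_mul det_mtr
        by (rule simple_zero_mult_unit(2)) (use gl1 val.det in \<open>auto simp: gl_at_def\<close>)
      then show ?thesis using True by simp
    next
      case False
      have "a j \<noteq> b + 1" using nr by (metis rangeI)
      then show ?thesis using False inj[OF False] loc2[of "a j"] a by (simp add: zeros_at_def)
    qed
  qed
  then show "zeros_at (N(Fin (a i + 1) := M)) A (a(i := a i + 1))" by (simp add: N'_def b_def)
qed

text \<open>Here the changed lattice enters at \<open>a i\<close> as source and at
  \<open>a i - 1\<close> as target. The choice of \<open>M\<close> makes the former
  \<open>mat 1\<close>; the latter gains the translated old matrix at \<open>a i\<close> as left
  factor, next to the old matrix at \<open>a i - 1\<close>, which is invertible.\<close>

lemma zeros_at_shift_down:
  fixes a :: "'i \<Rightarrow> complex" and i :: 'i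
  assumes N: "lattice N" and nz: "det A \<noteq> 0" and a: "nonresonant a" "zeros_at N A a"
  defines "M \<equiv> matrix_inv A ** mtr (N (Fin (a i + 1)))"
  shows "lattice (N(Fin (a i) := M))" "zeros_at (N(Fin (a i) := M)) A (a(i := a i - 1))"
proof -
  define b where "b = a i"
  define N' where "N' = N(Fin b := M)"
  have Nz: "det (N x) \<noteq> 0" for x using N by (simp add: lattice_def)
  show "lattice (N(Fin (a i) := M))"
    using N nz Nz by (intro lattice_upd) (simp_all add: M_def det_mtr det_mul det_matrix_inv_nz)
  have loc0: "loc N' A (Fin b) = mat 1"
    using nz Nz by (simp add: loc_def N'_def M_def b_def det_mtr matrix_group_simps)
  have loc1: "loc N' A (Fin (b - 1)) = mtr (loc N A (Fin b)) ** loc N A (Fin (b - 1))"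
    using Nz nz by (simp add: loc_def N'_def M_def b_def mtr_mult mtr_inv det_mtr matrix_group_simps)
  have loc2: "loc N' A (Fin z) = loc N A (Fin z)" if "z \<noteq> b" "z \<noteq> b - 1" for z
    using that by (auto simp: loc_def N'_def)
  have nr: "b - 1 \<notin> range a" using nonresonant_plus_1[OF a(1)] by (simp add: b_def)
  have inj: "a j \<noteq> b" if "j \<noteq> i" for j
    using a(1) that unfolding nonresonant_def b_def by (metis Ints_0 diff_self)
  have gl1: "gl_at (Fin (b - 1)) (loc N A (Fin (b - 1)))" using a nr by (simp add: zeros_at_def)
  have reg1: "mreg (Fin (b - 1)) (mtr (loc N A (Fin b)))"
    using a by (auto simp: zeros_at_def mreg_mtr_iff)
  have "zeros_at N' A (a(i := b - 1))"
    unfolding zeros_at_def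
  proof (intro conjI allI impI)
    show "mreg (Fin z) (loc N' A (Fin z))" for z
    proof -
      consider "z = b" | "z = b - 1" | "z \<noteq> b" "z \<noteq> b - 1" by blast
      then show ?thesis
      proof cases
        case 2
        then show ?thesis using loc1 gl1 reg1 by (simp add: mreg_mult gl_at_mreg)
      qed (use loc0 loc2 a in \<open>simp_all add: val.mat_1 zeros_at_def\<close>)
    qed
  next
    fix z assume z: "z \<notin> range (a(i := b - 1))"
    then have zb: "z \<noteq> b - 1" by (metis fun_upd_same rangeI)
    show "gl_at (Fin z) (loc N' A (Fin z))"
    proof (cases "z = b")
      case False
      have "z \<notin> range a"
      proof
        assume "z \<in> range a"
        then obtain j where "z = a j" by blast
        with False have "j \<noteq> i" by (auto simp: b_def)
        with \<open>z = a j\<close> have "z = (a(i := b - 1)) j" by simp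
        with z show False by blast
      qed
      then show ?thesis using loc2[OF False zb] a by (simp add: zeros_at_def)
    qed (simp add: loc0 gl_at_mat_1)
  next
    fix j
    show "simple_zero ((a(i := b - 1)) j) (det (loc N' A (Fin ((a(i := b - 1)) j))))"
    proof (cases "j = i")
      case True
      have "simple_zero (b - 1) (tr 1 (det (loc N A (Fin b))))"
        by (rule simple_zero_tr) (use a in \<open>simp add: zeros_at_def b_def\<close>)
      then have "simple_zero (b - 1) (det (loc N' A (Fin (b - 1))))"
        unfolding loc1 det_mul det_mtr
        by (rule simple_zero_mult_unit(1)) (use gl1 val.det in \<open>auto simp: gl_at_def\<close>)
      then show ?thesis using True by simp
    next
      case False
      have "a j \<noteq> b - 1" using nr by (metis rangeI)
      then show ?thesis using False inj[OF False] loc2[of "a j"] a by (simp add: zeros_at_def)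
    qed
  qed
  then show "zeros_at (N(Fin (a i) := M)) A (a(i := a i - 1))" by (simp add: N'_def b_def)
qed

text \<open>Induction on the sum of the absolute values: subtracting its sign from a nonzero entry
  gives a smaller instance, and one unit step leads back. Both the zeros \<open>a\<close> and the
  exponents \<open>d\<close> are shifted this way.\<close>

lemma int_shift_induct [consumes 1, case_names shift]:
  fixes a :: "'i::finite \<Rightarrow> complex" and m :: "'i \<Rightarrow> int"
  assumes "P a" and step: "\<And>b i e. P b \<Longrightarrow> e = 1 \<or> e = - 1 \<Longrightarrow> P (b(i := b i + e))"
  shows "P (\<lambda>i. a i + of_int (m i))"
proof -
  have "P (\<lambda>i. a i + of_int (m i))" if "n = (\<Sum>i\<in>UNIV. nat \<bar>m i\<bar>)" for n
    using that
  proof (induction n arbitrary: m rule: less_induct)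
    case (less n)
    show ?case
    proof (cases "\<forall>i. m i = 0")
      case True
      then show ?thesis using assms(1) by simp
    next
      case False
      then obtain i where i: "m i \<noteq> 0" by blast
      define m' where "m' = m(i := m i - sgn (m i))"
      have "(\<Sum>j\<in>UNIV. nat \<bar>m' j\<bar>) < (\<Sum>j\<in>UNIV. nat \<bar>m j\<bar>)"
      proof (rule sum_strict_mono_ex1)
        show "\<forall>j\<in>UNIV. nat \<bar>m' j\<bar> \<le> nat \<bar>m j\<bar>" by (auto simp: m'_def sgn_if)
        show "\<exists>j\<in>UNIV. nat \<bar>m' j\<bar> < nat \<bar>m j\<bar>" using i by (intro bexI[of _ i]) (auto simp: m'_def sgn_if)
      qed simp
      then have "P (\<lambda>j. a j + of_int (m' j))" using less by blast
      then have "P ((\<lambda>j. a j + of_int (m' j))(i := a i + of_int (m' i) + of_int (sgn (m i))))"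
        using i by (intro step) (auto simp: sgn_if)
      moreover have "(\<lambda>j. a j + of_int (m' j))(i := a i + of_int (m' i) + of_int (sgn (m i))) =
          (\<lambda>j. a j + of_int (m j))"
        by (auto simp: m'_def fun_eq_iff)
      ultimately show ?thesis by simp
    qed
  qed
  then show ?thesis by blast
qed

text \<open>Keeping \<open>N' Inf = N Inf\<close> separates the changes on the affine line from the
  change at infinity. Nonresonance belongs to the invariant because every single step relies on
  it.\<close>

lemma zeros_at_shift:
  fixes a :: "'i::finite \<Rightarrow> complex" and m :: "'i \<Rightarrow> int"
  assumes "lattice N" "det A \<noteq> 0" "nonresonant a" "zeros_at N A a"
  shows "nonresonant (\<lambda>i. a i + of_int (m i)) \<and> (\<exists>N'. lattice N' \<and> zeros_at N' A (\<lambda>i. a i + of_int (m i)) \<and> N' Inf = N Inf)"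
proof (rule int_shift_induct[where P = "\<lambda>a. nonresonant a \<and> (\<exists>N'. lattice N' \<and> zeros_at N' A a \<and> N' Inf = N Inf)"])
  show "nonresonant a \<and> (\<exists>N'. lattice N' \<and> zeros_at N' A a \<and> N' Inf = N Inf)" using assms by blast
next
  fix b :: "'i \<Rightarrow> complex" and i :: 'i and e :: complex
  assume "nonresonant b \<and> (\<exists>N'. lattice N' \<and> zeros_at N' A b \<and> N' Inf = N Inf)" and e: "e = 1 \<or> e = - 1"
  then obtain N' where N': "nonresonant b" "lattice N'" "zeros_at N' A b" "N' Inf = N Inf" by blast
  have "nonresonant (b(i := b i + e))" using e by (intro nonresonant_upd N') auto
  moreover have "\<exists>N'. lattice N' \<and> zeros_at N' A (b(i := b i + e)) \<and> N' Inf = N Inf"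
  proof (cases "e = 1")
    case True
    then show ?thesis using zeros_at_shift_up[OF N'(2) assms(2) N'(1,3), of i] N'(4)
      by (metis fun_upd_other p1.distinct(1))
  next
    case False
    then have "b i + e = b i - 1" using e by simp
    then show ?thesis using zeros_at_shift_down[OF N'(2) assms(2) N'(1,3), of i] N'(4)
      by (metis fun_upd_other p1.distinct(1))
  qed
  ultimately show "nonresonant (b(i := b i + e)) \<and> (\<exists>N'. lattice N' \<and> zeros_at N' A (b(i := b i + e)) \<and> N' Inf = N Inf)"
    by blast
qed

section \<open>Shifting the exponents at infinity\<close>

lemma matrix_diff_mult_distrib:
  fixes B C :: "'a::comm_ring_1^'n^'n"
  shows "(B - C) ** D = B ** D - C ** D"
  by (simp add: matrix_matrix_mult_def vec_eq_iff left_diff_distrib sum_subtractf)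

lemma inverse_crd_plus_1:
  "reg_at Inf (inverse (crd + 1))" "reg_at Inf (crd * inverse (crd + 1))"
  "crd * inverse (crd + 1) = 1 - inverse (crd + 1)"
proof -
  define s where "s = crd + 1"
  have s: "s \<noteq> 0" "crd = s - 1" using crd_plus_1_nonzero by (simp_all add: s_def)
  show 1: "reg_at Inf (crd * inverse (crd + 1))"
    using reg_crd_div(1) by (simp add: divide_inverse)
  show 2: "crd * inverse (crd + 1) = 1 - inverse (crd + 1)"
    unfolding s_def[symmetric] unfolding s(2) using s(1) by (simp add: field_simps)
  have "inverse (crd + 1) = 1 - crd * inverse (crd + 1)" using 2 by simp
  then show "reg_at Inf (inverse (crd + 1))" using 1 by (metis reg_at_diff_val reg_at_0_1_val(3))
qed

text \<open>The quotients by z and by z + 1 of a function O(z^2) differ by O(1), so both keep the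
  same linear term, and the coefficient \<open>b\<close> drops into the bounded part.\<close>

lemma inverse_crd_mult_normal:
  assumes "r \<approx>\<^sub>\<infinity> cst a * crd ^ 2 + cst b * crd"
  shows "inverse crd * r \<approx>\<^sub>\<infinity> cst a * crd" "inverse (crd + 1) * r \<approx>\<^sub>\<infinity> cst a * crd"
proof -
  have "inverse crd * r \<approx>\<^sub>\<infinity> inverse crd * (cst a * crd ^ 2 + cst b * crd)"
    by (rule cong_Inf_mult[OF _ assms]) (rule reg_at_intros)
  also have "inverse crd * (cst a * crd ^ 2 + cst b * crd) = cst a * crd + cst b"
    by (simp add: field_simps power2_eq_square)
  also have "\<dots> \<approx>\<^sub>\<infinity> cst a * crd" by (simp add: cong_Inf_def reg_at_intros)
  finally show "inverse crd * r \<approx>\<^sub>\<infinity> cst a * crd" .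
  define s where "s = inverse (crd + 1)"
  have s: "reg_at Inf s" "reg_at Inf (crd * s)" "crd * s = 1 - s"
    using inverse_crd_plus_1 by (simp_all add: s_def)
  have "s * r \<approx>\<^sub>\<infinity> s * (cst a * crd ^ 2 + cst b * crd)"
    by (rule cong_Inf_mult[OF s(1) assms])
  also have "s * (cst a * crd ^ 2 + cst b * crd) = cst a * crd * (crd * s) + cst b * (crd * s)"
    by (simp add: algebra_simps power2_eq_square)
  also have "cst a * crd * (crd * s) = cst a * crd - cst a * (crd * s)"
    by (subst s(3)) (simp add: algebra_simps)
  also have "cst a * crd - cst a * (crd * s) + cst b * (crd * s) \<approx>\<^sub>\<infinity> cst a * crd"
    using s(2) by (simp add: cong_Inf_def reg_at_intros)
  finally show "inverse (crd + 1) * r \<approx>\<^sub>\<infinity> cst a * crd" by (simp add: s_def)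
qed

lemma cong_leading:
  assumes "reg_at Inf (inverse crd * r)"
  shows "r \<approx>\<^sub>\<infinity> cst (val Inf (inverse crd * r)) * crd"
proof -
  let ?b = "val Inf (inverse crd * r)"
  have "reg_at Inf (crd * (inverse crd * r - cst ?b))"
    using assms by (intro reg_crd_mult_if_val_0) (simp_all add: val_simps reg_at_intros)
  also have "crd * (inverse crd * r - cst ?b) = r - cst ?b * crd" by (simp add: right_diff_distrib mult.commute)
  finally show ?thesis by (simp add: cong_Inf_def)
qed

text \<open>Conjugation by \<open>1 + X/z\<close> adds \<open>[X, diag \<rho>]\<close> to the coefficient of \<open>z\<close>, which kills its
  off-diagonal entries.\<close>

lemma ex_diagonalizing_gauge:
  fixes C :: "ratfun^2^2" and \<rho> d :: "2 \<Rightarrow> complex"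
  assumes \<rho>: "\<rho> 1 \<noteq> \<rho> 2"
    and diag: "\<And>i. C $ i $ i \<approx>\<^sub>\<infinity> normal_form \<rho> d $ i $ i"
    and off: "\<And>i j. i \<noteq> j \<Longrightarrow> reg_at Inf (inverse crd * C $ i $ j)"
  shows "\<exists>G. gl_at Inf G \<and> mreg Inf (mtr G ** C ** matrix_inv G - normal_form \<rho> d)"
proof -
  define t where "t = inverse crd"
  define s where "s = inverse (crd + 1)"
  define \<beta> where "\<beta> = (\<lambda>i j. val Inf (t * C $ i $ j))"
  \<comment> \<open>The entries of \<open>X\<close> solve
    \<open>x' * \<rho> j + \<beta> i j - x' * \<rho> i = 0\<close>, the vanishing of the
    off-diagonal coefficient of z.\<close>
  define x where "x = cst (\<beta> 1 2 / (\<rho> 1 - \<rho> 2))"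
  define y where "y = cst (\<beta> 2 1 / (\<rho> 2 - \<rho> 1))"
  define G :: "ratfun^2^2" where "G = (\<chi> i j. if i = j then 1 else if i = 1 then x * t else y * t)"
  have two: "(1::2) \<noteq> 2" "(2::2) \<noteq> 1" by simp_all
  have G: "G $ 1 $ 1 = 1" "G $ 2 $ 2 = 1" "G $ 1 $ 2 = x * t" "G $ 2 $ 1 = y * t"
    by (simp_all add: G_def)
  have "tr 1 x = x" "tr 1 y = y" "tr 1 t = s"
    by (simp_all add: x_def y_def t_def s_def tr_inverse tr_1_crd)
  then have trG: "tr 1 (x * t) = x * s" "tr 1 (y * t) = y * s"
    by (simp_all add: tr_mult)
  have reg: "reg_at Inf x" "reg_at Inf y" "reg_at Inf t" by (simp_all add: x_def y_def t_def reg_at_intros)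
  have vt: "val Inf t = 0" by (simp add: t_def reg_at_inverse_crd_val)
  have gl: "gl_at Inf G"
    unfolding gl_at_def
  proof
    show "mreg Inf G" unfolding val.mdom_def G_def using reg by (simp add: reg_at_intros)
    have "det G = 1 - x * t * (y * t)" by (simp add: det_2 G)
    then show "val Inf (det G) \<noteq> 0" using reg vt by (simp add: val_simps reg_at_intros)
  qed
  have sC: "reg_at Inf (s * C $ i $ j)" if "i \<noteq> j" for i j
  proof -
    have "s * C $ i $ j = (crd * s) * (t * C $ i $ j)" by (simp add: t_def)
    also have "reg_at Inf \<dots>"
      using reg_at_mult_val off[OF that] inverse_crd_plus_1(2) unfolding t_def s_def by blast
    finally show ?thesis .
  qed
  have sD: "s * C $ i $ i \<approx>\<^sub>\<infinity> cst (\<rho> i) * crd" for i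
    unfolding s_def by (rule inverse_crd_mult_normal(2)[of _ _ "\<rho> i * d i"]) (use diag[of i] in \<open>simp add: normal_form_nth\<close>)
  have tD: "t * normal_form \<rho> d $ i $ i \<approx>\<^sub>\<infinity> cst (\<rho> i) * crd" for i
    unfolding t_def by (rule inverse_crd_mult_normal(1)[of _ _ "\<rho> i * d i"]) (simp add: normal_form_nth)
  have Cb: "C $ i $ j \<approx>\<^sub>\<infinity> cst (\<beta> i j) * crd" if "i \<noteq> j" for i j
    using cong_leading[OF off[OF that]] by (simp add: \<beta>_def t_def)
  have offdiag: "x' * (s * C $ j $ j) + C $ i $ j - x' * (t * normal_form \<rho> d $ i $ i) \<approx>\<^sub>\<infinity> 0"
    if "i \<noteq> j" and x': "x' = cst (\<beta> i j / (\<rho> i - \<rho> j))" and "\<rho> i \<noteq> \<rho> j" for i j x'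
  proof -
    have "x' * (s * C $ j $ j) + C $ i $ j - x' * (t * normal_form \<rho> d $ i $ i) \<approx>\<^sub>\<infinity>
       x' * (cst (\<rho> j) * crd) + cst (\<beta> i j) * crd - x' * (cst (\<rho> i) * crd)"
      unfolding x' by (intro cong_Inf_diff cong_Inf_add cong_Inf_mult sD tD Cb that reg_at_intros)
    also have "\<dots> = (x' * cst (\<rho> j) + cst (\<beta> i j) - x' * cst (\<rho> i)) * crd" by (simp add: algebra_simps)
    also have "x' * cst (\<rho> j) + cst (\<beta> i j) - x' * cst (\<rho> i) = 
       cst (\<beta> i j / (\<rho> i - \<rho> j) * \<rho> j + \<beta> i j - \<beta> i j / (\<rho> i - \<rho> j) * \<rho> i)"
      by (simp only: x' cst_simps)
    also have "\<beta> i j / (\<rho> i - \<rho> j) * \<rho> j + \<beta> i j - \<beta> i j / (\<rho> i - \<rho> j) * \<rho> i = 0"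
      using that(3) by (simp add: field_simps)
    finally show ?thesis by (simp add: cst_simps)
  qed
  have nf0: "normal_form \<rho> d $ 1 $ 2 = 0" "normal_form \<rho> d $ 2 $ 1 = 0" by (simp_all add: normal_form_nth)
  \<comment> \<open>The comparison is made before inverting, \<open>G(z+1) C\<close> against the
    normal form times \<open>G\<close>; multiplication by the inverse of \<open>G\<close>, which is
    regular at infinity, comes last.\<close>
  have "mreg Inf (mtr G ** C - normal_form \<rho> d ** G)"
    unfolding mreg_diff_iff forall_2
  proof (intro conjI)
    \<comment> \<open>Off-diagonal entries of \<open>C\<close> are O(z) and meet a factor 1/(z+1),
      so they alter the diagonal only by O(1).\<close>
    have "C $ i $ i + x' * (s * C $ j $ i) \<approx>\<^sub>\<infinity> normal_form \<rho> d $ i $ i + 0" if "i \<noteq> j" "reg_at Inf x'" for i j x'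
      using that by (intro cong_Inf_add[OF diag cong_Inf_if_reg[OF reg_at_intros(2)[OF _ sC]]]) auto
    from this[of 1 2 x] this[of 2 1 y] show "(mtr G ** C) $ 1 $ 1 \<approx>\<^sub>\<infinity> (normal_form \<rho> d ** G) $ 1 $ 1"
      "(mtr G ** C) $ 2 $ 2 \<approx>\<^sub>\<infinity> (normal_form \<rho> d ** G) $ 2 $ 2"
      using reg two unfolding matrix_matrix_mult_def by (simp_all add: sum_2 G trG nf0 mult.assoc add.commute)
    show "(mtr G ** C) $ 1 $ 2 \<approx>\<^sub>\<infinity> (normal_form \<rho> d ** G) $ 1 $ 2"
      using offdiag[OF two(1) x_def] \<rho> unfolding matrix_matrix_mult_def
      by (simp add: sum_2 G trG nf0 cong_Inf_def) (simp add: algebra_simps)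
    show "(mtr G ** C) $ 2 $ 1 \<approx>\<^sub>\<infinity> (normal_form \<rho> d ** G) $ 2 $ 1"
      using offdiag[OF two(2) y_def] \<rho> unfolding matrix_matrix_mult_def
      by (simp add: sum_2 G trG nf0 cong_Inf_def) (simp add: algebra_simps)
  qed
  then have "mreg Inf ((mtr G ** C - normal_form \<rho> d ** G) ** matrix_inv G)"
    by (rule mreg_mult[OF _ gl_at_mreg[OF gl_at_inv[OF gl]]])
  then show ?thesis
    using gl by (auto simp: matrix_diff_mult_distrib matrix_inv_cancel[OF gl_at_det[OF gl]])
qed

definition diag_mat :: "('n \<Rightarrow> 'a::zero) \<Rightarrow> 'a^'n^'n" where
  "diag_mat q = (\<chi> i j. if i = j then q i else 0)"

lemma diag_mat_mult:
  fixes q :: "'n::finite \<Rightarrow> 'a::comm_ring_1"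
  shows "(diag_mat q ** B) $ i $ j = q i * B $ i $ j" "(B ** diag_mat q) $ i $ j = B $ i $ j * q j"
  by (simp_all add: diag_mat_def matrix_matrix_mult_def if_distrib[of "\<lambda>x. x * _"] if_distrib[of "\<lambda>x. _ * x"]
     cong: if_cong)

text \<open>The diagonal gauge multiplies the \<open>i\<close>-th diagonal entry by
  \<open>1 + 1/z\<close> or \<open>z/(z+1)\<close>, that is by \<open>1 + e/z + O(z^-2)\<close>,
  which replaces \<open>d i\<close> by \<open>d i + e\<close>. Off the diagonal the bounded entries
  grow to O(z) at most, and \<open>ex_diagonalizing_gauge\<close> removes that growth.\<close>

lemma ex_shifting_gauge:
  fixes B :: "ratfun^2^2" and \<rho> d :: "2 \<Rightarrow> complex"
  assumes \<rho>: "\<rho> 1 \<noteq> \<rho> 2" and B: "mreg Inf (B - normal_form \<rho> d)" and e: "e = 1 \<or> e = - 1"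
  shows "\<exists>R. det R \<noteq> 0 \<and> mreg Inf (mtr R ** B ** matrix_inv R - normal_form \<rho> (d(i := d i + e)))"
proof -
  define u where "u = (if e = 1 then crd else inverse crd)"
  define q where "q = (\<lambda>j. if j = i then u else 1)"
  define Q where "Q = diag_mat q"
  define C where "C = mtr Q ** B ** matrix_inv Q"
  have u0: "u \<noteq> 0" by (simp add: u_def)
  have "Q ** diag_mat (\<lambda>j. inverse (q j)) = mat 1"
    by (simp add: vec_eq_iff Q_def diag_mat_mult) (simp add: diag_mat_def mat_def q_def u0)
  then have Qi: "matrix_inv Q = diag_mat (\<lambda>j. inverse (q j))" and Qd: "det Q \<noteq> 0"
    by (rule matrix_inv_eqI, metis det_I det_mul mult_zero_left zero_neq_one)
  have trQ: "mtr Q = diag_mat (\<lambda>j. tr 1 (q j))" by (simp add: Q_def diag_mat_def vec_eq_iff)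
  have C: "C $ j $ k = tr 1 (q j) * B $ j $ k * inverse (q k)" for j k
    by (simp add: C_def trQ Qi diag_mat_mult)
  have Bc: "B $ j $ k \<approx>\<^sub>\<infinity> normal_form \<rho> d $ j $ k" for j k using B by (simp add: mreg_diff_iff)
  have tu: "tr 1 u = (if e = 1 then crd + 1 else inverse (crd + 1))"
    by (simp add: u_def tr_1_crd tr_inverse)
  have diag: "C $ j $ j \<approx>\<^sub>\<infinity> normal_form \<rho> (d(i := d i + e)) $ j $ j" for j
  proof (cases "j = i")
    case False
    then show ?thesis using Bc[of j j] by (simp add: C q_def normal_form_nth)
  next
    case True
    have nf: "B $ i $ i \<approx>\<^sub>\<infinity> cst (\<rho> i) * crd ^ 2 + cst (\<rho> i * d i) * crd"
      using Bc[of i i] by (simp add: normal_form_nth)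
    show ?thesis
    proof (cases "e = 1")
      case e1: True
      have "C $ i $ i = B $ i $ i + inverse crd * B $ i $ i"
        by (simp add: C q_def tu e1) (simp add: u_def e1 field_simps)
      also have "\<dots> \<approx>\<^sub>\<infinity> (cst (\<rho> i) * crd ^ 2 + cst (\<rho> i * d i) * crd) + cst (\<rho> i) * crd"
        by (intro cong_Inf_add nf inverse_crd_mult_normal(1)[OF nf])
      also have "\<dots> = normal_form \<rho> (d(i := d i + e)) $ i $ i"
        by (simp add: normal_form_nth cst_simps algebra_simps e1)
      finally show ?thesis using True by simp
    next
      case e2: False
      have "C $ i $ i = (crd * inverse (crd + 1)) * B $ i $ i"
        by (simp add: C q_def tu e2) (simp add: u_def e2 field_simps)
      also have "\<dots> = B $ i $ i - inverse (crd + 1) * B $ i $ i"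
        unfolding inverse_crd_plus_1(3) by (simp add: algebra_simps)
      also have "\<dots> \<approx>\<^sub>\<infinity> (cst (\<rho> i) * crd ^ 2 + cst (\<rho> i * d i) * crd) - cst (\<rho> i) * crd"
        by (intro cong_Inf_diff nf inverse_crd_mult_normal(2)[OF nf])
      also have "\<dots> = normal_form \<rho> (d(i := d i + e)) $ i $ i"
        using e e2 by (simp add: normal_form_nth cst_simps algebra_simps)
      finally show ?thesis using True by simp
    qed
  qed
  have off: "reg_at Inf (inverse crd * C $ j $ k)" if "j \<noteq> k" for j k
  proof -
    have rB: "reg_at Inf (B $ j $ k)" using Bc[of j k] that by (simp add: normal_form_nth cong_Inf_0_iff)
    have "reg_at Inf (inverse crd * tr 1 (q j) * inverse (q k))"
    proof -
      have 1: "inverse crd * (crd + 1) = 1 + inverse crd" by (simp add: field_simps)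
      \<comment> \<open>At most one of two distinct indices is \<open>i\<close>, so at most one
        factor of order z occurs.\<close>
      have "q j = 1 \<or> q k = 1" using that by (auto simp: q_def)
      then show ?thesis
      proof
        assume qj: "q j = 1"
        show ?thesis unfolding qj by (cases "e = 1") (auto simp: q_def u_def reg_at_intros intro: reg_at_intros(2))
      next
        assume qk: "q k = 1"
        show ?thesis unfolding qk
          by (cases "j = i") (auto simp: q_def tu 1 reg_at_intros inverse_crd_plus_1 simp del: inverse_mult_distrib)
      qed
    qed
    then have "reg_at Inf (inverse crd * tr 1 (q j) * inverse (q k) * B $ j $ k)"
      using rB reg_at_mult_val by blast
    then show ?thesis by (simp add: C mult_ac)
  qed
  obtain G where G: "gl_at Inf G" "mreg Inf (mtr G ** C ** matrix_inv G - normal_form \<rho> (d(i := d i + e)))"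
    using ex_diagonalizing_gauge[OF \<rho> diag off] by blast
  have "mtr (G ** Q) ** B ** matrix_inv (G ** Q) = mtr G ** C ** matrix_inv G"
    using gl_at_det[OF G(1)] Qd by (simp add: C_def mtr_mult matrix_inv_mult flip: matrix_mul_assoc)
  then show ?thesis using G gl_at_det[OF G(1)] Qd by (intro exI[of _ "G ** Q"]) (simp add: det_mul)
qed

lemma normal_at_Inf_shift:
  fixes N :: "p1 \<Rightarrow> ratfun^2^2" and k :: "2 \<Rightarrow> int"
  assumes "lattice N" "\<rho> 1 \<noteq> \<rho> 2" "normal_at_Inf N A \<rho> d"
  shows "\<exists>M. det M \<noteq> 0 \<and> normal_at_Inf (N(Inf := M)) A \<rho> (\<lambda>i. d i + of_int (k i))"
proof (rule int_shift_induct[where P = "\<lambda>d. \<exists>M. det M \<noteq> 0 \<and> normal_at_Inf (N(Inf := M)) A \<rho> d"])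
  show "\<exists>M. det M \<noteq> 0 \<and> normal_at_Inf (N(Inf := M)) A \<rho> d"
    using assms by (intro exI[of _ "N Inf"]) (simp add: lattice_def)
next
  fix b :: "2 \<Rightarrow> complex" and i :: 2 and e :: complex
  assume "\<exists>M. det M \<noteq> 0 \<and> normal_at_Inf (N(Inf := M)) A \<rho> b" and e: "e = 1 \<or> e = - 1"
  then obtain M K where M: "det M \<noteq> 0" "gl_at Inf (matrix_inv M ** K)"
    "mreg Inf (matrix_inv (mtr K) ** A ** K - normal_form \<rho> b)" by (auto simp: normal_at_Inf_def)
  have K: "det K \<noteq> 0" using gl_at_det[OF M(2)] by (auto simp: det_mul)
  obtain R where R: "det R \<noteq> 0"
    "mreg Inf (mtr R ** (matrix_inv (mtr K) ** A ** K) ** matrix_inv R - normal_form \<rho> (b(i := b i + e)))"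
    using ex_shifting_gauge[OF assms(2) M(3) e] by blast
  \<comment> \<open>Since \<open>R\<close> changes coordinates, the new frame is \<open>K\<close>
    times its inverse. It is taken directly as basis of the new lattice at infinity.\<close>
  define K' where "K' = K ** matrix_inv R"
  have K': "det K' \<noteq> 0" using K R by (simp add: K'_def det_mul det_matrix_inv_nz)
  have "matrix_inv (mtr K') ** A ** K' = mtr R ** (matrix_inv (mtr K) ** A ** K) ** matrix_inv R"
    using K R by (simp add: K'_def mtr_mult mtr_inv det_mtr matrix_group_simps)
  then have "normal_at_Inf (N(Inf := K')) A \<rho> (b(i := b i + e))"
    unfolding normal_at_Inf_def using R(2) K'
    by (intro exI[of _ K']) (simp add: matrix_inv_right_left gl_at_mat_1)
  then show "\<exists>M. det M \<noteq> 0 \<and> normal_at_Inf (N(Inf := M)) A \<rho> (b(i := b i + e))" using K' by blast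
qed

lemma zeros_at_upd_Inf: "zeros_at (N(Inf := M)) A a \<longleftrightarrow> zeros_at N A a"
  by (simp add: zeros_at_def loc_def)

lemma ex_shifted_lattice:
  fixes N :: "p1 \<Rightarrow> ratfun^2^2" and a :: "'i::finite \<Rightarrow> complex"
  assumes "lattice N" "det A \<noteq> 0" "nonresonant a" "zeros_at N A a" "\<rho> 1 \<noteq> \<rho> 2" "normal_at_Inf N A \<rho> d"
  shows "\<exists>N'. lattice N' \<and> zeros_at N' A (\<lambda>i. a i + of_int (m i)) \<and>
    normal_at_Inf N' A \<rho> (\<lambda>i. d i + of_int (k i))"
proof -
  obtain N' where N': "lattice N'" "zeros_at N' A (\<lambda>i. a i + of_int (m i))" "N' Inf = N Inf"
    using zeros_at_shift[OF assms(1-4)] by blast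
  have "normal_at_Inf N' A \<rho> d" using assms(6) normal_at_Inf_cong[of N' N] N'(3) by blast
  then obtain M where "det M \<noteq> 0" "normal_at_Inf (N'(Inf := M)) A \<rho> (\<lambda>i. d i + of_int (k i))"
    using normal_at_Inf_shift[OF N'(1) assms(5)] by blast
  then show ?thesis using N' lattice_upd zeros_at_upd_Inf by blast
qed

text \<open>The regularity results apply to \<open>R\<close> and also to its inverse, which
  intertwines in the opposite direction; a matrix regular together with its inverse lies in
  \<open>gl_at\<close>.\<close>

lemma intertwiner_gl_at:
  fixes \<rho> :: "'n::finite \<Rightarrow> complex"
  assumes N: "lattice N" "lattice N'" and nz: "det A \<noteq> 0" "det A' \<noteq> 0" "det R \<noteq> 0"
    and a: "nonresonant a" "zeros_at N A a" "zeros_at N' A' a"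
    and \<rho>: "inj \<rho>" "\<And>i. \<rho> i \<noteq> 0" "normal_at_Inf N A \<rho> d" "normal_at_Inf N' A' \<rho> d"
    and R: "mtr R ** A = A' ** R"
  shows "gl_at x (matrix_inv (N' x) ** R ** N x)"
proof -
  \<comment> \<open>Stated for arbitrary data, so that it can be used again with the two bundles
    exchanged.\<close>
  have reg: "mreg x (matrix_inv (N' x) ** R ** N x)"
    if N: "lattice N" "lattice N'" and nz: "det A \<noteq> 0" "det A' \<noteq> 0" "det R \<noteq> 0"
    and a: "zeros_at N A a" "zeros_at N' A' a"
    and \<rho>': "normal_at_Inf N A \<rho> d" "normal_at_Inf N' A' \<rho> d"
    and R: "mtr R ** A = A' ** R" for N N' A A' R
  proof (cases x)
    case (Fin z)
    then show ?thesis using intertwiner_regular[OF N nz(1,2) assms(6) a R] by simp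
  next
    case Inf
    obtain M where M: "gl_at Inf (matrix_inv (N Inf) ** M)" "mreg Inf (matrix_inv (mtr M) ** A ** M - normal_form \<rho> d)"
      using \<rho>'(1) by (auto simp: normal_at_Inf_def)
    obtain M' where M': "gl_at Inf (matrix_inv (N' Inf) ** M')" "mreg Inf (matrix_inv (mtr M') ** A' ** M' - normal_form \<rho> d)"
      using \<rho>'(2) by (auto simp: normal_at_Inf_def)
    have d: "det M \<noteq> 0" "det M' \<noteq> 0" using gl_at_det[OF M(1)] gl_at_det[OF M'(1)] by (auto simp: det_mul)
    have Nd: "det (N Inf) \<noteq> 0" "det (N' Inf) \<noteq> 0" using N by (auto simp: lattice_def)
    \<comment> \<open>In the frames \<open>M\<close> and \<open>M'\<close> both connections have the
      same normal form, as the argument at infinity requires; regularity is carried back to the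
      lattice bases afterwards.\<close>
    have "mtr (matrix_inv M' ** R ** M) ** (matrix_inv (mtr M) ** A ** M) = matrix_inv (mtr M') ** (mtr R ** A) ** M"
      using d by (simp add: mtr_mult mtr_inv det_mtr matrix_group_simps)
    also have "\<dots> = (matrix_inv (mtr M') ** A' ** M') ** (matrix_inv M' ** R ** M)"
      unfolding R using d by (simp add: matrix_group_simps)
    finally have "mreg Inf (matrix_inv M' ** R ** M)"
      by (rule intertwiner_regular_Inf[OF assms(9,10) M(2) M'(2)])
    also have "matrix_inv M' ** R ** M =
       matrix_inv (matrix_inv (N' Inf) ** M') ** (matrix_inv (N' Inf) ** R ** N Inf) ** (matrix_inv (N Inf) ** M)"
      using d Nd by (simp add: matrix_group_simps)
    finally show ?thesis using gl_at_conj_iff(1)[OF M'(1) M(1)] Inf by simp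
  qed
  have Nz: "det (N x) \<noteq> 0" "det (N' x) \<noteq> 0" for x using N by (auto simp: lattice_def)
  have "mtr (matrix_inv R) ** A' = mtr (matrix_inv R) ** (A' ** R) ** matrix_inv R"
    using nz by (simp add: matrix_group_simps)
  also have "\<dots> = A ** matrix_inv R"
    unfolding R[symmetric] using nz by (simp add: mtr_inv det_mtr matrix_group_simps)
  finally have R': "mtr (matrix_inv R) ** A' = A ** matrix_inv R" .
  have "mreg x (matrix_inv (N x) ** matrix_inv R ** N' x)"
    by (rule reg[OF N(2,1) nz(2,1) _ a(3,2) \<rho>(4,3) R']) (use nz in \<open>simp add: det_matrix_inv_nz\<close>)
  moreover have "matrix_inv (matrix_inv (N' x) ** R ** N x) = matrix_inv (N x) ** matrix_inv R ** N' x"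
    using Nz nz by (simp add: matrix_group_simps)
  ultimately show ?thesis
    using reg[OF N nz a(2,3) \<rho>(3,4) R] Nz nz
    by (subst gl_at_iff_inv) (simp_all add: det_mul det_matrix_inv_nz)
qed

section \<open>Parameters in terms of lattices\<close>

text \<open>Only finite points are constrained, since the connection has a pole at infinity in the
  case of interest. \<open>B\<close> is the matrix over the function field, and \<open>E\<close> at
  \<open>z + 1\<close> and at \<open>z\<close> accounts for the bases of the two fibres.\<close>

definition connection_matrix ::
    "(p1 \<Rightarrow> ratfun^'n^'n) \<Rightarrow> (p1 \<Rightarrow> complex^'n^'n) \<Rightarrow> (p1 \<Rightarrow> complex^'n^'n) \<Rightarrow> ratfun^'n^'n \<Rightarrow> bool" where
  "connection_matrix N E A B \<longleftrightarrow> (\<forall>z. mreg (Fin z) (loc N B (Fin z)) \<and>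
     A (Fin z) = E (Fin (z + 1)) ** mval (Fin z) (loc N B (Fin z)) ** matrix_inv (E (Fin z)))"

lemma zariski_open_affine: "zariski_open (range Fin)"
proof -
  have "- range Fin = {Inf}"
  proof (intro set_eqI iffI)
    fix x assume "x \<in> - range Fin" then show "x \<in> {Inf}" by (cases x) auto
  qed auto
  then show ?thesis by (simp add: zariski_open_def)
qed

lemma regular_connection_iff:
  assumes "models L N E"
  shows "regular_map_on (range Fin) L (shift_pullback L) A \<longleftrightarrow> (\<exists>B. connection_matrix N E A B)"
  using models_regular_map[OF assms models_shift_pullback[OF assms] zariski_open_affine, of A]
  by (simp add: connection_matrix_def loc_def)

lemma connection_in_charts:
  assumes L: "models L N E" and A: "connection_matrix N E A B"
    and c: "chart_matrix N E c M" "Fin z \<in> fst c" and c': "chart_matrix N E c' M'" "Fin (z + 1) \<in> fst c'"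
  shows "mreg (Fin z) (matrix_inv (mtr M') ** B ** M)"
    and "matrix_inv (snd c' (Fin (z + 1))) ** A (Fin z) ** snd c (Fin z) = mval (Fin z) (matrix_inv (mtr M') ** B ** M)"
proof -
  note nz = models_nz[OF L]
  have "matrix_inv (mtr (N (Fin (z + 1)))) ** mtr M' = mtr (matrix_inv (N (Fin (z + 1))) ** M')"
    using nz by (simp add: mtr_mult mtr_inv)
  then have gl: "gl_at (Fin z) (matrix_inv (mtr (N (Fin (z + 1)))) ** mtr M')"
    "snd c' (Fin (z + 1)) = E (Fin (z + 1)) ** mval (Fin z) (matrix_inv (mtr (N (Fin (z + 1)))) ** mtr M')"
    using c' by (auto simp: chart_matrix_def gl_at_mtr_iff mval_mtr gl_at_mreg)
  have "mreg (Fin z) (matrix_inv (mtr M') ** B ** M) \<and>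
     matrix_inv (snd c' (Fin (z + 1))) ** A (Fin z) ** snd c (Fin z) = mval (Fin z) (matrix_inv (mtr M') ** B ** M)"
    by (rule iffD1[OF chart_transition[of "Fin z" "N (Fin z)" M _ "E (Fin z)" _ _ _ "E (Fin (z + 1))", OF _ _ gl]])
       (use c A nz in \<open>auto simp: chart_matrix_def connection_matrix_def loc_def det_mtr\<close>)
  then show "mreg (Fin z) (matrix_inv (mtr M') ** B ** M)"
    "matrix_inv (snd c' (Fin (z + 1))) ** A (Fin z) ** snd c (Fin z) = mval (Fin z) (matrix_inv (mtr M') ** B ** M)"
    by blast+
qed

lemma finite_not_in_charts:
  assumes "zariski_open U" "zariski_open V" "U \<noteq> {}" "V \<noteq> {}"
  shows "finite {z. \<not> (Fin z \<in> U \<and> Fin (z + 1) \<in> V)}"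
proof -
  have "shift -` V \<noteq> {}"
  proof -
    have "infinite V" using assms by (intro infinite_zariski_open)
    then have "V \<noteq> {Inf}" by auto
    then obtain w where "Fin w \<in> V" using assms(4) by (metis ex_in_conv insertI1 p1.exhaust singletonD subsetI subset_singletonD)
    then have "shift (Fin (w - 1)) \<in> V" by simp
    then show ?thesis by blast
  qed
  then have "U \<inter> shift -` V \<noteq> {}" "zariski_open (U \<inter> shift -` V)"
    using zariski_open_Int_nonempty zariski_open_Int zariski_open_shift assms by metis+
  then have "finite (- (U \<inter> shift -` V))" by (simp add: zariski_open_def)
  then have "finite {z. Fin z \<in> - (U \<inter> shift -` V)}" by (simp only: finite_p1_iff)
  then show ?thesis by simp
qed

text \<open>In charts the determinant is that of \<open>loc\<close> times a unit at
  \<open>w\<close>, the quotient of the determinants of the two changes of basis. The charts reach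
  only cofinitely many z, which suffices because \<open>zorder\<close> depends on a punctured
  neighbourhood.\<close>

lemma zorder_connection_iff:
  assumes L: "models L N E" and A: "connection_matrix N E A B" and nz: "det B \<noteq> 0"
    and c: "chart_matrix N E c M" "Fin w \<in> fst c" and c': "chart_matrix N E c' M'" "Fin (w + 1) \<in> fst c'"
  shows "zorder (\<lambda>z. det (matrix_inv (snd c' (Fin (z + 1))) ** A (Fin z) ** snd c (Fin z))) w = 1 \<longleftrightarrow>
    simple_zero w (det (loc N B (Fin w)))"
proof -
  define X where "X = matrix_inv (mtr M') ** B ** M"
  define F where "F = {z. \<not> (Fin z \<in> fst c \<and> Fin (z + 1) \<in> fst c')}"
  have "finite F" unfolding F_def
    using c c' by (intro finite_not_in_charts) (auto simp: chart_matrix_def)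
  moreover have "w \<notin> F" using c c' by (simp add: F_def)
  ultimately have ev: "eventually (\<lambda>z. z \<notin> F) (at w)"
    using eventually_at_topological finite_imp_closed by (metis Compl_iff open_Compl)
  have eq: "det (matrix_inv (snd c' (Fin (z + 1))) ** A (Fin z) ** snd c (Fin z)) = val (Fin z) (det X)"
    if "z \<notin> F" for z
    using connection_in_charts[OF L A c(1) _ c'(1), of z] that val.det[of "Fin z" X]
    by (auto simp: F_def X_def)
  have "zorder (\<lambda>z. det (matrix_inv (snd c' (Fin (z + 1))) ** A (Fin z) ** snd c (Fin z))) w =
      zorder (\<lambda>z. val (Fin z) (det X)) w"
    by (rule zorder_cong) (use ev eq in \<open>auto elim: eventually_mono\<close>)
  moreover have Mz: "det M \<noteq> 0" "det M' \<noteq> 0"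
    using c c' gl_at_det[of _ "matrix_inv (N _) ** _"] unfolding chart_matrix_def det_mul by fastforce+
  moreover have "reg_at (Fin w) (det X)"
    using connection_in_charts(1)[OF L A c c'] val.det unfolding X_def by blast
  moreover have "det X \<noteq> 0" using Mz nz by (simp add: X_def det_mul det_matrix_inv_nz det_mtr)
  ultimately have *: "zorder (\<lambda>z. det (matrix_inv (snd c' (Fin (z + 1))) ** A (Fin z) ** snd c (Fin z))) w = 1 \<longleftrightarrow>
      simple_zero w (det X)"
    by (simp add: zorder_val_eq_1_iff)
  define G where "G = matrix_inv (N (Fin w)) ** M"
  define H where "H = matrix_inv (mtr (N (Fin (w + 1)))) ** mtr M'"
  have "H = mtr (matrix_inv (N (Fin (w + 1))) ** M')"
    using models_nz[OF L] by (simp add: H_def mtr_mult mtr_inv)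
  then have gl: "gl_at (Fin w) G" "gl_at (Fin w) H"
    using c c' by (auto simp: G_def chart_matrix_def gl_at_mtr_iff)
  have "X = matrix_inv H ** loc N B (Fin w) ** G"
    using models_nz[OF L] Mz by (simp add: X_def H_def G_def loc_def det_mtr matrix_group_simps)
  then have dX: "det X = (inverse (det H) * det G) * det (loc N B (Fin w))"
    using gl_at_det[OF gl(2)] by (simp add: det_mul det_matrix_inv)
  define u where "u = inverse (det H) * det G"
  have u: "reg_at (Fin w) u" "val (Fin w) u \<noteq> 0"
    using gl val.det[of "Fin w" G] val.det[of "Fin w" H]
    by (auto simp: u_def gl_at_def val_simps reg_at_inverse_val reg_at_intros)
  have u0: "u \<noteq> 0" using u by (auto simp: val_simps)
  have "simple_zero w (u * r) \<longleftrightarrow> simple_zero w r" for r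
  proof
    assume "simple_zero w (u * r)"
    then have "simple_zero w (inverse u * (u * r))"
      by (rule simple_zero_mult_unit(2)) (use u in \<open>simp_all add: reg_at_inverse_val\<close>)
    moreover have "inverse u * (u * r) = r" using u0 by simp
    ultimately show "simple_zero w r" by simp
  qed (use simple_zero_mult_unit(2) u in blast)
  then show ?thesis unfolding * dX u_def[symmetric] by blast
qed

text \<open>For large z both z and z + 1 lie in the chart, so the analytic expression is the value
  of a rational function and the O(1) criterion applies to it.\<close>

lemma bigo_normal_form_iff:
  fixes \<rho> d :: "'n::finite \<Rightarrow> complex"
  assumes L: "models L N E" and A: "connection_matrix N E A B"
    and c: "chart_matrix N E c M" "Inf \<in> fst c"
  shows "(\<lambda>z. (matrix_inv (snd c (Fin (z + 1))) ** A (Fin z) ** snd c (Fin z)) $ i $ j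
                    - (if i = j then \<rho> i * z ^ 2 + \<rho> i * d i * z else 0)) \<in> O[at_infinity](\<lambda>_. 1) \<longleftrightarrow>
     (matrix_inv (mtr M) ** B ** M) $ i $ j \<approx>\<^sub>\<infinity> normal_form \<rho> d $ i $ j"
proof -
  define X where "X = matrix_inv (mtr M) ** B ** M"
  have "finite {z. \<not> (Fin z \<in> fst c \<and> Fin (z + 1) \<in> fst c)}"
    using c by (intro finite_not_in_charts) (auto simp: chart_matrix_def)
  then have ev: "eventually (\<lambda>z. Fin z \<in> fst c \<and> Fin (z + 1) \<in> fst c) at_infinity"
    using eventually_at_infinity_p1[of "\<lambda>x. x \<in> fst c \<and> shift x \<in> fst c"]
      finite_p1_iff[of "{x. \<not> (x \<in> fst c \<and> shift x \<in> fst c)}"] by simp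
  have eq: "(matrix_inv (snd c (Fin (z + 1))) ** A (Fin z) ** snd c (Fin z)) $ i $ j
      - (if i = j then \<rho> i * z ^ 2 + \<rho> i * d i * z else 0) = val (Fin z) (X $ i $ j - normal_form \<rho> d $ i $ j)"
    if z: "Fin z \<in> fst c \<and> Fin (z + 1) \<in> fst c" for z
  proof -
    have X: "reg_at (Fin z) (X $ i $ j)"
      "(matrix_inv (snd c (Fin (z + 1))) ** A (Fin z) ** snd c (Fin z)) $ i $ j = val (Fin z) (X $ i $ j)"
      using connection_in_charts[OF L A c(1) _ c(1), of z] z by (auto simp: X_def val.mdom_def)
    have nf: "reg_at (Fin z) (normal_form \<rho> d $ i $ j)"
      "val (Fin z) (normal_form \<rho> d $ i $ j) = (if i = j then \<rho> i * z ^ 2 + \<rho> i * d i * z else 0)"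
      by (simp_all add: normal_form_nth val_simps reg_at_intros power2_eq_square)
    show ?thesis unfolding X(2) nf(2)[symmetric] using reg_at_diff_val[OF X(1) nf(1)] by simp
  qed
  have "(\<lambda>z. (matrix_inv (snd c (Fin (z + 1))) ** A (Fin z) ** snd c (Fin z)) $ i $ j
                    - (if i = j then \<rho> i * z ^ 2 + \<rho> i * d i * z else 0)) \<in> O[at_infinity](\<lambda>_. 1) \<longleftrightarrow>
     (\<lambda>z. val (Fin z) (X $ i $ j - normal_form \<rho> d $ i $ j)) \<in> O[at_infinity](\<lambda>_. 1)"
    by (rule landau_o.big.in_cong) (use ev eq in \<open>auto elim: eventually_mono\<close>)
  then show ?thesis by (simp add: val_bigo_1_at_infinity_iff cong_Inf_def X_def)
qed

text \<open>All clauses phrased with charts, orders and bounds become conditions on one rational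
  matrix \<open>B\<close> and the lattices. The regularity clause produces \<open>B\<close>; the
  other clauses are translated for that \<open>B\<close>.\<close>

lemma has_parameters_iff:
  fixes a :: "4 \<Rightarrow> complex"
  assumes L: "models L N E"
  shows "has_parameters L A a \<rho> d \<longleftrightarrow> inj a \<and>
    (\<exists>B. det B \<noteq> 0 \<and> connection_matrix N E A B \<and> zeros_at N B a \<and> normal_at_Inf N B \<rho> d)"
proof -
  note nz = models_nz[OF L]
  have inv: "invertible (A (Fin z)) \<longleftrightarrow> gl_at (Fin z) (loc N B (Fin z))" if "connection_matrix N E A B" for z B
    using that nz by (auto simp: connection_matrix_def invertible_det_nz gl_at_iff det_mul det_matrix_inv_nz)
  have zo: "(\<forall>i. \<forall>c\<in>L. \<forall>c'\<in>L. Fin (a i) \<in> fst c \<longrightarrow> Fin (a i + 1) \<in> fst c' \<longrightarrow>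
      zorder (\<lambda>z. det (matrix_inv (snd c' (Fin (z + 1))) ** A (Fin z) ** snd c (Fin z))) (a i) = 1) \<longleftrightarrow>
      (\<forall>i. simple_zero (a i) (det (loc N B (Fin (a i)))))"
    if B: "connection_matrix N E A B" "det B \<noteq> 0" for B
  proof -
    have ch: "\<exists>M. chart_matrix N E c M" if "c \<in> L" for c using L that by (auto simp: models_def)
    have "(\<Union>c\<in>L. fst c) = UNIV" using L by (simp add: models_def)
    then have cov: "\<exists>c\<in>L. x \<in> fst c" for x by blast
    have iff: "zorder (\<lambda>z. det (matrix_inv (snd c' (Fin (z + 1))) ** A (Fin z) ** snd c (Fin z))) (a i) = 1 \<longleftrightarrow>
        simple_zero (a i) (det (loc N B (Fin (a i))))"
      if c: "c \<in> L" "c' \<in> L" "Fin (a i) \<in> fst c" "Fin (a i + 1) \<in> fst c'" for i c c'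
    proof -
      obtain M M' where "chart_matrix N E c M" "chart_matrix N E c' M'"
        using ch[OF c(1)] ch[OF c(2)] by blast
      then show ?thesis using zorder_connection_iff[OF L B _ c(3) _ c(4)] by blast
    qed
    show ?thesis
    proof (intro iffI allI)
      fix i assume h: "\<forall>i. \<forall>c\<in>L. \<forall>c'\<in>L. Fin (a i) \<in> fst c \<longrightarrow> Fin (a i + 1) \<in> fst c' \<longrightarrow>
        zorder (\<lambda>z. det (matrix_inv (snd c' (Fin (z + 1))) ** A (Fin z) ** snd c (Fin z))) (a i) = 1"
      obtain c c' where c: "c \<in> L" "c' \<in> L" "Fin (a i) \<in> fst c" "Fin (a i + 1) \<in> fst c'"
        using cov by meson
      show "simple_zero (a i) (det (loc N B (Fin (a i))))"
        using h[rule_format, OF c] iff[OF c] by simp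
    qed (use iff in simp)
  qed
  have inf: "(\<exists>W S. trivialization L (W, S) \<and> Inf \<in> W \<and>
        (\<forall>i j. (\<lambda>z. (matrix_inv (S (Fin (z + 1))) ** A (Fin z) ** S (Fin z)) $ i $ j
                    - (if i = j then \<rho> i * z ^ 2 + \<rho> i * d i * z else 0)) \<in> O[at_infinity](\<lambda>_. 1))) \<longleftrightarrow>
      normal_at_Inf N B \<rho> d" (is "?l \<longleftrightarrow> ?r")
    if B: "connection_matrix N E A B" for B
  proof
    assume ?l
    then obtain W S where W: "trivialization L (W, S)" "Inf \<in> W" and
      O: "\<And>i j. (\<lambda>z. (matrix_inv (S (Fin (z + 1))) ** A (Fin z) ** S (Fin z)) $ i $ j
                    - (if i = j then \<rho> i * z ^ 2 + \<rho> i * d i * z else 0)) \<in> O[at_infinity](\<lambda>_. 1)" by blast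
    obtain M where M: "chart_matrix N E (W, S) M" using trivialization_chart_matrix[OF L W(1)] by blast
    have "(matrix_inv (mtr M) ** B ** M) $ i $ j \<approx>\<^sub>\<infinity> normal_form \<rho> d $ i $ j" for i j
      using bigo_normal_form_iff[OF L B M, of i j \<rho> d] O[of i j] W(2) by simp
    then show ?r unfolding normal_at_Inf_def mreg_diff_iff using M W(2) by (auto simp: chart_matrix_def)
  next
    assume ?r
    then obtain M where M: "gl_at Inf (matrix_inv (N Inf) ** M)"
      "mreg Inf (matrix_inv (mtr M) ** B ** M - normal_form \<rho> d)" by (auto simp: normal_at_Inf_def)
    \<comment> \<open>A basis of the lattice at infinity also spans the lattices at all but finitely
      many other points, so it extends to a trivialization on an open set containing
      infinity.\<close>
    define c where "c = ({y. gl_at y (matrix_inv (N y) ** M)}, \<lambda>y. E y ** mval y (matrix_inv (N y) ** M))"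
    have "det M \<noteq> 0" using gl_at_det[OF M(1)] by (auto simp: det_mul)
    then have "zariski_open (fst c)"
      using L zariski_open_gl_at[of N M] by (simp add: c_def models_def)
    then have c: "chart_matrix N E c M" by (auto simp: chart_matrix_def c_def)
    have i: "Inf \<in> fst c" using M by (simp add: c_def)
    show ?l
      using bigo_normal_form_iff[OF L B c i, of _ _ \<rho> d] M(2) i chart_matrix_trivialization[OF L c]
      unfolding mreg_diff_iff by (intro exI[of _ "fst c"] exI[of _ "snd c"]) simp
  qed
  have hp: "has_parameters L A a \<rho> d \<longleftrightarrow> (\<exists>B. connection_matrix N E A B) \<and>
     (\<forall>z. z \<notin> range a \<longrightarrow> invertible (A (Fin z))) \<and> inj a \<and>
     (\<forall>i. \<forall>c\<in>L. \<forall>c'\<in>L. Fin (a i) \<in> fst c \<longrightarrow> Fin (a i + 1) \<in> fst c' \<longrightarrow>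
        zorder (\<lambda>z. det (matrix_inv (snd c' (Fin (z + 1))) ** A (Fin z) ** snd c (Fin z))) (a i) = 1) \<and>
     (\<exists>W S. trivialization L (W, S) \<and> Inf \<in> W \<and>
        (\<forall>i j. (\<lambda>z. (matrix_inv (S (Fin (z + 1))) ** A (Fin z) ** S (Fin z)) $ i $ j
                    - (if i = j then \<rho> i * z ^ 2 + \<rho> i * d i * z else 0)) \<in> O[at_infinity](\<lambda>_. 1)))"
    unfolding has_parameters_def regular_connection_iff[OF L] case_prod_unfold ..
  \<comment> \<open>\<open>range a\<close> is finite, so the connection is invertible at some point,
    and one such point forces \<open>det B\<close> to be nonzero.\<close>
  have detB: "det B \<noteq> 0" if "connection_matrix N E A B" "\<forall>z. z \<notin> range a \<longrightarrow> invertible (A (Fin z))" for B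
  proof -
    obtain z where "z \<notin> range a"
      using ex_new_if_finite[OF infinite_UNIV_char_0, of "range a"] by auto
    then have "gl_at (Fin z) (loc N B (Fin z))" using inv that by blast
    then show ?thesis using gl_at_det by (fastforce simp: loc_def det_mul)
  qed
  show ?thesis
  proof
    assume h: "has_parameters L A a \<rho> d"
    then obtain B where B: "connection_matrix N E A B" unfolding hp by blast
    have "det B \<noteq> 0" using detB[OF B] h unfolding hp by blast
    moreover have "zeros_at N B a"
      using h zo[OF B \<open>det B \<noteq> 0\<close>] inv[OF B] B unfolding hp zeros_at_def connection_matrix_def by blast
    moreover have "normal_at_Inf N B \<rho> d" using h inf[OF B] unfolding hp by blast
    ultimately show "inj a \<and> (\<exists>B. det B \<noteq> 0 \<and> connection_matrix N E A B \<and> zeros_at N B a \<and> normal_at_Inf N B \<rho> d)"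
      using h B unfolding hp by blast
  next
    assume "inj a \<and> (\<exists>B. det B \<noteq> 0 \<and> connection_matrix N E A B \<and> zeros_at N B a \<and> normal_at_Inf N B \<rho> d)"
    then obtain B where a: "inj a" and B: "det B \<noteq> 0" "connection_matrix N E A B" "zeros_at N B a" "normal_at_Inf N B \<rho> d"
      by blast
    show "has_parameters L A a \<rho> d"
      unfolding hp inf[OF B(2)] zo[OF B(2,1)] inv[OF B(2)] using a B by (auto simp: zeros_at_def)
  qed
qed

section \<open>Modifications and isomorphisms as rational intertwiners\<close>

lemma related_by_modification_matrix:
  assumes L: "models L N E" and L': "models L' N' E'"
    and A: "connection_matrix N E A B" and A': "connection_matrix N' E' A' B'"
    and rel: "related_by_modification L A L' A'"
  shows "\<exists>\<Phi>. det \<Phi> \<noteq> 0 \<and> mtr \<Phi> ** B = B' ** \<Phi>"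
proof -
  note nz = models_nz[OF L] models_nz[OF L']
  obtain R W where W: "zariski_open W" "W \<noteq> {}" "regular_map_on W L L' R" "\<And>x. x \<in> W \<Longrightarrow> invertible (R x)"
    "\<And>z. Fin z \<in> W \<Longrightarrow> Fin (z + 1) \<in> W \<Longrightarrow> R (Fin (z + 1)) ** A (Fin z) = A' (Fin z) ** R (Fin z)"
    using rel unfolding related_by_modification_def by blast
  obtain \<Phi> where \<Phi>: "\<And>x. x \<in> W \<Longrightarrow> mreg x (matrix_inv (N' x) ** \<Phi> ** N x) \<and>
     R x = E' x ** mval x (matrix_inv (N' x) ** \<Phi> ** N x) ** matrix_inv (E x)"
    using W(3) unfolding models_regular_map[OF L L' W(1)] by blast
  \<comment> \<open>On this cofinite set both lattices are standard, so \<open>R\<close> is the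
    value of \<open>\<Phi>\<close> up to the bases of the fibres.\<close>
  define V where "V = W \<inter> {x. N x = mat 1 \<and> N' x = mat 1}"
  have "- V \<subseteq> - W \<union> ({x. N x \<noteq> mat 1} \<union> {x. N' x \<noteq> mat 1})" by (auto simp: V_def)
  moreover have "finite (- W \<union> ({x. N x \<noteq> mat 1} \<union> {x. N' x \<noteq> mat 1}))"
    using L L' W(1,2) by (simp add: models_def lattice_def zariski_open_def)
  ultimately have finV: "finite (- V)" by (rule finite_subset)
  then have V: "zariski_open V" "V \<noteq> {}"
    using infinite_UNIV_p1 by (auto simp: zariski_open_def)
  have RV: "mreg x \<Phi>" "R x = E' x ** mval x \<Phi> ** matrix_inv (E x)" if "x \<in> V" for x
    using \<Phi>[of x] that by (auto simp: V_def matrix_inv_mat_1)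
  obtain x where x: "x \<in> V" using V by blast
  have "det (R x) \<noteq> 0" using W(4)[of x] x by (simp add: V_def invertible_det_nz)
  then have "gl_at x \<Phi>" using RV[OF x] by (auto simp: gl_at_iff det_mul)
  then have "det \<Phi> \<noteq> 0" by (rule gl_at_det)
  \<comment> \<open>The relation is known at the infinitely many z for which z and z + 1 both lie in
    \<open>V\<close>, hence it holds between rational matrices.\<close>
  moreover have "mtr \<Phi> ** B = B' ** \<Phi>"
  proof (rule matrix_ratfun_eqI)
    have "finite (- (V \<inter> shift -` V) \<union> {Inf})"
      using finV zariski_open_shift[OF V(1)] finite_vimageI[OF finV inj_shift] by (simp add: vimage_Compl)
    moreover have "- (V \<inter> shift -` V - {Inf}) = - (V \<inter> shift -` V) \<union> {Inf}" by auto
    ultimately show "infinite (V \<inter> shift -` V - {Inf})"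
      using infinite_UNIV_p1 by (metis Compl_partition finite_Un)
  next
    fix y assume y: "y \<in> V \<inter> shift -` V - {Inf}"
    then obtain z where z: "y = Fin z" "Fin z \<in> V" "Fin (z + 1) \<in> V" by (cases y) auto
    then have "loc N B (Fin z) = B" "loc N' B' (Fin z) = B'"
      by (simp_all add: loc_def V_def mtr_mat_1 matrix_inv_mat_1)
    then have B: "mreg (Fin z) B" "A (Fin z) = E (Fin (z + 1)) ** mval (Fin z) B ** matrix_inv (E (Fin z))"
      and B': "mreg (Fin z) B'" "A' (Fin z) = E' (Fin (z + 1)) ** mval (Fin z) B' ** matrix_inv (E' (Fin z))"
      using A A' unfolding connection_matrix_def by metis+
    have tr: "mreg (Fin z) (mtr \<Phi>)" "mval (Fin z) (mtr \<Phi>) = mval (Fin (z + 1)) \<Phi>"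
      using RV(1)[OF z(3)] mreg_mtr_iff[of "Fin z" \<Phi>] mval_mtr[of "Fin z" \<Phi>] by simp_all
    have "E' (Fin (z + 1)) ** mval (Fin z) (mtr \<Phi> ** B) ** matrix_inv (E (Fin z)) = R (Fin (z + 1)) ** A (Fin z)"
      unfolding RV(2)[OF z(3)] B(2) using nz
      by (simp add: mval_mult tr B(1) matrix_group_simps)
    also have "\<dots> = A' (Fin z) ** R (Fin z)" using W(5)[of z] z by (simp add: V_def)
    also have "\<dots> = E' (Fin (z + 1)) ** mval (Fin z) (B' ** \<Phi>) ** matrix_inv (E (Fin z))"
      unfolding RV(2)[OF z(2)] B'(2) using nz
      by (simp add: mval_mult RV(1)[OF z(2)] B'(1) matrix_group_simps)
    finally have "mval (Fin z) (mtr \<Phi> ** B) = mval (Fin z) (B' ** \<Phi>)"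
      by (rule matrix_field_eqI[rotated 2]) (rule nz det_matrix_inv_nz)+
    then show "mreg y (mtr \<Phi> ** B) \<and> mreg y (B' ** \<Phi>) \<and> mval y (mtr \<Phi> ** B) = mval y (B' ** \<Phi>)"
      using z tr B B' RV(1)[OF z(2)] mreg_mult by blast
  qed
  ultimately show ?thesis by blast
qed

text \<open>The modification is the identity of the generic fibre: where both lattices are standard,
  \<open>R\<close> merely passes from the bases \<open>E\<close> to the bases
  \<open>E'\<close>.\<close>

lemma related_by_modification_if_same_matrix:
  assumes L: "models L N E" and L': "models L' N' E'"
    and A: "connection_matrix N E A B" and A': "connection_matrix N' E' A' B"
  shows "related_by_modification L A L' A'"
proof -
  note nz = models_nz[OF L] models_nz[OF L']
  define W where "W = {x. N x = mat 1 \<and> N' x = mat 1}"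
  define R where "R = (\<lambda>x. E' x ** matrix_inv (E x))"
  have "- W = {x. N x \<noteq> mat 1} \<union> {x. N' x \<noteq> mat 1}" by (auto simp: W_def)
  then have finW: "finite (- W)" using L L' by (simp add: models_def lattice_def)
  then have W: "zariski_open W" "W \<noteq> {}" using infinite_UNIV_p1 by (auto simp: zariski_open_def)
  have "regular_map_on W L L' R"
    unfolding models_regular_map[OF L L' W(1)]
    by (intro exI[of _ "mat 1"]) (simp add: W_def R_def matrix_inv_mat_1 val.mat_1)
  moreover have "invertible (R x)" for x
    using nz by (simp add: R_def invertible_det_nz det_mul det_matrix_inv_nz)
  moreover have "R (Fin (z + 1)) ** A (Fin z) = A' (Fin z) ** R (Fin z)"
    if "Fin z \<in> W" "Fin (z + 1) \<in> W" for z
  proof -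
    have "loc N B (Fin z) = B" "loc N' B (Fin z) = B"
      using that by (simp_all add: loc_def W_def mtr_mat_1 matrix_inv_mat_1)
    then have "A (Fin z) = E (Fin (z + 1)) ** mval (Fin z) B ** matrix_inv (E (Fin z))"
      "A' (Fin z) = E' (Fin (z + 1)) ** mval (Fin z) B ** matrix_inv (E' (Fin z))"
      using A A' unfolding connection_matrix_def by metis+
    then show ?thesis using nz by (simp add: R_def matrix_group_simps)
  qed
  ultimately show ?thesis unfolding related_by_modification_def using W by blast
qed

text \<open>\<open>\<Phi>\<close> carries every lattice of \<open>N\<close> onto that of
  \<open>N'\<close>, infinity included, so its values form a regular isomorphism; at finite points
  the rational relation specializes to the required compatibility.\<close>

lemma isomorphic_if_intertwiner_gl_at:
  assumes L: "models L N E" and L': "models L' N' E'"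
    and A: "connection_matrix N E A B" and A': "connection_matrix N' E' A' B'"
    and \<Phi>: "mtr \<Phi> ** B = B' ** \<Phi>" "\<And>x. gl_at x (matrix_inv (N' x) ** \<Phi> ** N x)"
  shows "isomorphic_d_connections L A L' A'"
proof -
  note nz = models_nz[OF L] models_nz[OF L']
  define T where "T = (\<lambda>x. matrix_inv (N' x) ** \<Phi> ** N x)"
  define \<phi> where "\<phi> = (\<lambda>x. E' x ** mval x (T x) ** matrix_inv (E x))"
  have T: "gl_at x (T x)" "mreg x (T x)" for x using \<Phi>(2) gl_at_mreg by (auto simp: T_def)
  have "zariski_open UNIV" by (simp add: zariski_open_def)
  from models_regular_map[OF L L' this] have "regular_map_on UNIV L L' \<phi>"
    using T(2) unfolding \<phi>_def T_def by blast
  moreover have "invertible (\<phi> x)" for x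
    using nz T(1)[of x] by (simp add: \<phi>_def invertible_det_nz det_mul det_matrix_inv_nz gl_at_iff)
  moreover have "\<phi> (Fin (z + 1)) ** A (Fin z) = A' (Fin z) ** \<phi> (Fin z)" for z
  proof -
    have l: "mreg (Fin z) (loc N B (Fin z))" "mreg (Fin z) (loc N' B' (Fin z))"
      and Az: "A (Fin z) = E (Fin (z + 1)) ** mval (Fin z) (loc N B (Fin z)) ** matrix_inv (E (Fin z))"
      and Az': "A' (Fin z) = E' (Fin (z + 1)) ** mval (Fin z) (loc N' B' (Fin z)) ** matrix_inv (E' (Fin z))"
      using A A' by (auto simp: connection_matrix_def)
    have "mtr (T (Fin (z + 1))) ** loc N B (Fin z) = loc N' B' (Fin z) ** T (Fin z)"
      using intertwiner_loc[of N N' \<Phi> B B' "Fin z"] L L' \<Phi>(1) by (simp add: T_def models_def)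
    moreover have "mreg (Fin z) (mtr (T (Fin (z + 1))))" "mval (Fin z) (mtr (T (Fin (z + 1)))) = mval (Fin (z + 1)) (T (Fin (z + 1)))"
      using T(2) mreg_mtr_iff[of "Fin z" "T (Fin (z + 1))"] mval_mtr[of "Fin z" "T (Fin (z + 1))"] by simp_all
    ultimately have "mval (Fin (z + 1)) (T (Fin (z + 1))) ** mval (Fin z) (loc N B (Fin z)) =
        mval (Fin z) (loc N' B' (Fin z)) ** mval (Fin z) (T (Fin z))"
      using mval_mult l T(2) by metis
    from arg_cong[OF this, of "\<lambda>M. E' (Fin (z + 1)) ** M ** matrix_inv (E (Fin z))"]
    show ?thesis unfolding Az Az' \<phi>_def using nz by (simp add: matrix_group_simps)
  qed
  ultimately show ?thesis unfolding isomorphic_d_connections_def by blast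
qed

theorem mainTheorem1:
  fixes a :: "4 \<Rightarrow> complex" and \<rho> d :: "2 \<Rightarrow> complex"
    and m :: "4 \<Rightarrow> int" and k :: "2 \<Rightarrow> int"
    and L :: "2 vbundle" and A :: "p1 \<Rightarrow> complex^2^2"
  assumes "\<And>i j. i \<noteq> j \<Longrightarrow> a i - a j \<notin> \<int>"
    and "\<rho> 1 \<noteq> 0" and "\<rho> 2 \<noteq> 0" and "\<rho> 1 \<noteq> \<rho> 2"
    and "vector_bundle L" and "d_connection L A" and "has_parameters L A a \<rho> d"
  shows "\<exists>L' A'.
    (vector_bundle L' \<and> d_connection L' A' \<and> related_by_modification L A L' A' \<and>
     has_parameters L' A' (\<lambda>i. a i + of_int (m i)) \<rho> (\<lambda>i. d i + of_int (k i))) \<and>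
    (\<forall>L'' A''.
       vector_bundle L'' \<and> d_connection L'' A'' \<and> related_by_modification L A L'' A'' \<and>
       has_parameters L'' A'' (\<lambda>i. a i + of_int (m i)) \<rho> (\<lambda>i. d i + of_int (k i))
       \<longrightarrow> isomorphic_d_connections L' A' L'' A'')"
proof -
  have nonres: "nonresonant a" using assms(1) by (auto simp: nonresonant_def)
  have \<rho>: "inj \<rho>" "\<rho> i \<noteq> 0" for i
    using assms(2-4) exhaust_2 by (auto intro!: injI, metis+)
  define a' where "a' = (\<lambda>i. a i + of_int (m i))"
  define d' where "d' = (\<lambda>i. d i + of_int (k i))"
  obtain N E where L: "models L N E" using vector_bundle_models[OF assms(5)] by blast
  obtain B where B: "det B \<noteq> 0" "connection_matrix N E A B" "zeros_at N B a" "normal_at_Inf N B \<rho> d"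
    using assms(7) unfolding has_parameters_iff[OF L] by blast
  have N: "lattice N" using L by (simp add: models_def)
  have nonres': "nonresonant a'"
    using zeros_at_shift[OF N B(1) nonres B(3)] unfolding a'_def by blast
  then have inj': "inj a'" unfolding nonresonant_def inj_def by (metis Ints_0 diff_self)
  obtain N' where N': "lattice N'" "zeros_at N' B a'" "normal_at_Inf N' B \<rho> d'"
    using ex_shifted_lattice[OF N B(1) nonres B(3) assms(4) B(4)] unfolding a'_def d'_def by blast
  define L' where "L' = lattice_bundle N'"
  \<comment> \<open>The fibre bases of \<open>L'\<close> are its lattice bases, so the connection is
    the value of \<open>loc\<close>. At \<open>Inf\<close>, where \<open>loc\<close> may have a
    pole, it is whatever \<open>val\<close> returns.\<close>
  define A' where "A' = (\<lambda>x. mval x (loc N' B x))"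
  have L': "models L' N' (\<lambda>_. mat 1)" unfolding L'_def by (rule models_lattice_bundle[OF N'(1)])
  have A': "connection_matrix N' (\<lambda>_. mat 1) A' B"
    using N'(2) by (simp add: connection_matrix_def A'_def zeros_at_def matrix_inv_mat_1)
  have "vector_bundle L'" by (rule models_vector_bundle[OF L'])
  moreover have "d_connection L' A'"
    unfolding d_connection_def rational_map_def
    using regular_connection_iff[OF L'] A' zariski_open_affine by blast
  moreover have "related_by_modification L A L' A'"
    by (rule related_by_modification_if_same_matrix[OF L L' B(2) A'])
  moreover have "has_parameters L' A' a' \<rho> d'"
    unfolding has_parameters_iff[OF L'] using inj' B(1) A' N' by blast
  moreover have "isomorphic_d_connections L' A' L'' A''"
    if h: "vector_bundle L''" "related_by_modification L A L'' A''" "has_parameters L'' A'' a' \<rho> d'" for L'' A''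
  proof -
    obtain N'' E'' where L'': "models L'' N'' E''" using vector_bundle_models[OF h(1)] by blast
    obtain B'' where B'': "det B'' \<noteq> 0" "connection_matrix N'' E'' A'' B''" "zeros_at N'' B'' a'"
      "normal_at_Inf N'' B'' \<rho> d'"
      using h(3) unfolding has_parameters_iff[OF L''] by blast
    have N'': "lattice N''" using L'' by (simp add: models_def)
    \<comment> \<open>\<open>L'\<close> has the same matrix \<open>B\<close> as \<open>L\<close>, so
      an intertwiner out of \<open>L\<close> is at once one out of \<open>L'\<close>, although the
      lattices differ.\<close>
    obtain \<Phi> where \<Phi>: "det \<Phi> \<noteq> 0" "mtr \<Phi> ** B = B'' ** \<Phi>"
      using related_by_modification_matrix[OF L L'' B(2) B''(2) h(2)] by blast
    show ?thesis
      by (rule isomorphic_if_intertwiner_gl_at[OF L' L'' A' B''(2) \<Phi>(2)])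
         (rule intertwiner_gl_at[OF N'(1) N'' B(1) B''(1) \<Phi>(1) nonres' N'(2) B''(3) \<rho> N'(3) B''(4) \<Phi>(2)])
  qed
  ultimately show ?thesis unfolding a'_def d'_def by blast
qed

end
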